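(* Let $R$ be a principal ideal domain. An integral domain $D$ is isomorphic to a quotient ring $R[[X]]/I$ (for some ideal $I$ of $R[[X]]$) if and only if $D$ is isomorphic to one of the following rings: $R[[X]]$; $R$; $(R/\mathfrak m)[[X]]$; $R/\mathfrak m$; or $\widehat{R}_{\mathfrak m}[\alpha]$, where $\mathfrak m$ is a maximal ideal of $R$ and $\alpha$ is an element of the unique maximal ideal of the absolute integral closure of $\widehat{R}_{\mathfrak m}$.
   Context: For an ideal $\mathfrak m$ of $R$, $\widehat{R}_{\mathfrak m}=\varprojlim R/\mathfrak m^n$ is the $\mathfrak m$-adic completion of $R$. The absolute integral closure $S^+$ of an integral domain $S$ is the integral closure of $S$ in an algebraic closure of its fraction field; for $S=\widehat{R}_{\mathfrak m}$ (a Henselian local domain) $S^+$ is a local ring, and $\widehat{R}_{\mathfrak m}[\alpha]$ denotes the subring of $S^+$ generated by $\widehat{R}_{\mathfrak m}$ and $\alpha$. *)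

theory Defs
  imports "HOL-Algebra.Algebra" "HOL-Algebra.Algebraic_Closure"
begin

definition fps_ring :: "('a, 'b) ring_scheme \<Rightarrow> (nat \<Rightarrow> 'a) ring" where
  "fps_ring R =
    \<lparr> partial_object.carrier = {f. \<forall>n. f n \<in> carrier R},
      monoid.mult = (\<lambda>f g n. finsum R (\<lambda>i. f i \<otimes>\<^bsub>R\<^esub> g (n - i)) {..n}),
      monoid.one = (\<lambda>n. if n = 0 then \<one>\<^bsub>R\<^esub> else \<zero>\<^bsub>R\<^esub>),
      ring.zero = (\<lambda>n. \<zero>\<^bsub>R\<^esub>),
      ring.add = (\<lambda>f g n. f n \<oplus>\<^bsub>R\<^esub> g n) \<rparr>"

fun ideal_pow :: "('a, 'b) ring_scheme \<Rightarrow> 'a set \<Rightarrow> nat \<Rightarrow> 'a set" where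
  "ideal_pow R I 0 = carrier R"
| "ideal_pow R I (Suc n) = ideal_prod R I (ideal_pow R I n)"

text \<open>The inverse limit of the rings R/m^n along the canonical projections
  R/m^(n+1) -> R/m^n. An element is a coherent sequence of cosets: the coset
  f (Suc n) of m^(n+1) is contained in (i.e. projects to) the coset f n of m^n.\<close>

definition adic_completion :: "('a, 'b) ring_scheme \<Rightarrow> 'a set \<Rightarrow> (nat \<Rightarrow> 'a set) ring" where
  "adic_completion R m =
    \<lparr> partial_object.carrier = {f. (\<forall>n. f n \<in> carrier (R Quot ideal_pow R m n)) \<and> (\<forall>n. f (Suc n) \<subseteq> f n)},
      monoid.mult = (\<lambda>f g n. f n \<otimes>\<^bsub>R Quot ideal_pow R m n\<^esub> g n),
      monoid.one = (\<lambda>n. \<one>\<^bsub>R Quot ideal_pow R m n\<^esub>),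
      ring.zero = (\<lambda>n. \<zero>\<^bsub>R Quot ideal_pow R m n\<^esub>),
      ring.add = (\<lambda>f g n. f n \<oplus>\<^bsub>R Quot ideal_pow R m n\<^esub> g n) \<rparr>"

text \<open>L together with the embedding h of the domain S is an algebraic closure of
  the fraction field of S: h is an injective ring homomorphism S -> L and L is an
  algebraic closure of the subfield generated by h(S) (which is the fraction
  field of S).\<close>

definition alg_closure_of_frac ::
    "('s, 'c) ring_scheme \<Rightarrow> ('l, 'd) ring_scheme \<Rightarrow> ('s \<Rightarrow> 'l) \<Rightarrow> bool" where
  "alg_closure_of_frac S L h \<longleftrightarrow>
     h \<in> ring_hom S L \<and> inj_on h (carrier S) \<and>
     algebraic_closure L (generate_field L (h ` carrier S))"

definition integral_over :: "('l, 'd) ring_scheme \<Rightarrow> 'l set \<Rightarrow> 'l \<Rightarrow> bool" where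
  "integral_over L A x \<longleftrightarrow>
     (\<exists>p. polynomial\<^bsub>L\<^esub> A p \<and> p \<noteq> [] \<and> lead_coeff p = \<one>\<^bsub>L\<^esub> \<and> ring.eval L p x = \<zero>\<^bsub>L\<^esub>)"

definition abs_int_closure ::
    "('s, 'c) ring_scheme \<Rightarrow> ('l, 'd) ring_scheme \<Rightarrow> ('s \<Rightarrow> 'l) \<Rightarrow> 'l set" where
  "abs_int_closure S L h = {x \<in> carrier L. integral_over L (h ` carrier S) x}"

definition adjoin_ring ::
    "('s, 'c) ring_scheme \<Rightarrow> ('l, 'd) ring_scheme \<Rightarrow> ('s \<Rightarrow> 'l) \<Rightarrow> 'l \<Rightarrow> ('l, 'd) ring_scheme" where
  "adjoin_ring S L h \<alpha> = L\<lparr>carrier := generate_ring L (h ` carrier S \<union> {\<alpha>})\<rparr>"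

end

theory Submission
  imports Defs
begin

text \<open>Let \<open>I\<close> be a prime ideal of \<open>R[[X]]\<close> and \<open>B = R[[X]]/I\<close>. If \<open>I\<close> contains \<open>X\<close> or a nonzero constant, then
  \<open>B\<close> is \<open>R\<close>, \<open>R/m\<close> or \<open>(R/m)[[X]]\<close>. Otherwise \<open>I\<close> is zero or generated by a series \<open>g\<close> with \<open>g(0) \<noteq> 0\<close>;
  in the latter case \<open>B\<close> is complete for the image \<open>x\<close> of \<open>X\<close>, and since idempotents lift along
  \<open>B \<rightarrow> B/xB = R/(g(0))\<close> while \<open>B\<close> is a domain, \<open>g(0)\<close> divides a power of a single prime \<open>p\<close>. Then \<open>x\<close> divides
  a power of \<open>p\<close> and \<open>p\<close> divides a power of \<open>x\<close>, so \<open>B\<close> is also \<open>p\<close>-adically complete, hence a finite module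
  over the completion \<open>S\<close> of \<open>R\<close> at \<open>(p)\<close>, generated by the powers of \<open>x\<close>: \<open>B = S[x]\<close>.

  Conversely let \<open>\<alpha>\<close> be a nonunit in the integral closure of \<open>S\<close>. The same lifting of idempotents in the
  domain \<open>S[\<alpha>]\<close> shows that \<open>p\<close> divides a power of \<open>\<alpha>\<close>; if \<open>\<alpha> \<noteq> 0\<close> then \<open>\<alpha>\<close> divides a power of \<open>p\<close>, so that
  \<open>S[\<alpha>]\<close> is \<open>\<alpha>\<close>-adically complete with \<open>S[\<alpha>] = R + \<alpha> S[\<alpha>]\<close>, and evaluation at \<open>\<alpha>\<close> maps \<open>R[[X]]\<close> onto it.
  For \<open>\<alpha> = 0\<close> evaluate at \<open>p\<close> instead.\<close>

section \<open>Adically complete rings\<close>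

text \<open>HOL does not quantify over types, so the closure of the fraction field of the completion
  has to live in one fixed type. The type \<open>(nat \<Rightarrow> 'a set) \<times> nat\<close> is
  large enough for every such closure: an element is determined by finitely many elements of the
  completion and a root index. A closure built on another type is therefore copied into this one
  along an injection.

  Its work is done by splitting a series at its first coefficient outside an ideal. Integrality over
  the completion is treated by elimination over a valuation ring, in the form "some power lies in
  the span of the lower ones".

  The maximal ideal of the absolute integral closure enters through nonunits: a member of a maximal
  ideal \<open>M\<close> is no unit there, and conversely Zorn's lemma provides an \<open>M\<close>
  around a given nonunit.\<close>

context cring
begin

lemma divides_sum:
  assumes "a \<in> carrier R" "a divides b" "a divides c"
  shows "a divides (b \<oplus> c)"
proof -
  obtain x y where "x \<in> carrier R" "b = a \<otimes> x" "y \<in> carrier R" "c = a \<otimes> y"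
    using assms unfolding factor_def by auto
  then have "b \<oplus> c = a \<otimes> (x \<oplus> y)" "x \<oplus> y \<in> carrier R" using assms(1) by (auto simp: r_distr)
  then show ?thesis unfolding factor_def by blast
qed

lemma divides_prod_r:
  assumes "a \<in> carrier R" "a divides b" "c \<in> carrier R"
  shows "a divides (b \<otimes> c)" "a divides (c \<otimes> b)"
proof -
  obtain x where x: "x \<in> carrier R" "b = a \<otimes> x" using assms unfolding factor_def by auto
  then have "b \<otimes> c = a \<otimes> (x \<otimes> c)" "c \<otimes> b = a \<otimes> (x \<otimes> c)" "x \<otimes> c \<in> carrier R"
    using assms by (auto simp: m_ac)
  then show "a divides (b \<otimes> c)" "a divides (c \<otimes> b)" unfolding factor_def by blast+
qed

lemma divides_uminus:
  assumes "a \<in> carrier R" "a divides b"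
  shows "a divides (\<ominus> b)"
proof -
  obtain x where x: "x \<in> carrier R" "b = a \<otimes> x" using assms unfolding factor_def by auto
  then have "\<ominus> b = a \<otimes> (\<ominus> x)" "\<ominus> x \<in> carrier R" using assms by (auto simp: r_minus)
  then show ?thesis unfolding factor_def by blast
qed

lemma divides_diff:
  assumes "a \<in> carrier R" "a divides b" "a divides c"
  shows "a divides (b \<ominus> c)"
  using divides_sum[OF assms(1,2) divides_uminus[OF assms(1,3)]] by (simp add: a_minus_def)

lemma divides_pow_mono:
  assumes "a \<in> carrier R" "m \<le> (n::nat)"
  shows "a [^] m divides (a [^] n)"
proof -
  have "a [^] n = a [^] m \<otimes> a [^] (n - m)" using assms nat_pow_mult by simp
  then show ?thesis using assms unfolding factor_def by auto
qed

lemma divides_pow_pow: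
  assumes "a \<in> carrier R" "b \<in> carrier R" "a divides b"
  shows "a [^] (n::nat) divides (b [^] n)"
proof -
  obtain x where x: "x \<in> carrier R" "b = a \<otimes> x" using assms unfolding factor_def by auto
  then have "b [^] n = a [^] n \<otimes> x [^] n" using assms by (simp add: nat_pow_distrib)
  then show ?thesis using assms x unfolding factor_def by auto
qed

lemma divides_zero_r: "a \<in> carrier R \<Longrightarrow> a divides \<zero>"
  unfolding factor_def by (rule bexI[of _ \<zero>]) auto

text \<open>Telescoping: every difference from index \<open>m\<close> on is divisible at least by
  \<open>q [^] m\<close>.\<close>

lemma cauchy_divides:
  assumes q: "q \<in> carrier R" and s: "\<And>n. s n \<in> carrier R"
    and step: "\<And>n::nat. q [^] n divides (s (Suc n) \<ominus> s n)"
  shows "q [^] m divides (s (m + k) \<ominus> s m)"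
proof (induction k)
  case 0
  have "s m \<ominus> s m = \<zero>" using s by (simp add: r_neg a_minus_def)
  then show ?case using q divides_zero_r by simp
next
  case (Suc k)
  have "q [^] m divides (s (Suc (m + k)) \<ominus> s (m + k))"
    using step[of "m + k"] divides_pow_mono[OF q, of m "m + k"] q s
    by (meson divides_trans le_add1 nat_pow_closed)
  then have "q [^] m divides ((s (Suc (m + k)) \<ominus> s (m + k)) \<oplus> (s (m + k) \<ominus> s m))"
    using Suc q by (auto intro: divides_sum)
  moreover have "(s (Suc (m + k)) \<ominus> s (m + k)) \<oplus> (s (m + k) \<ominus> s m) = s (Suc (m + k)) \<ominus> s m"
    using s by algebra
  ultimately show ?case by simp
qed

end

text \<open>Completeness in Horner form: \<open>e j\<close> plays the role of the series
  \<open>d j + q d (j + 1) + q^2 d (j + 2) + \<dots>\<close>. For power series rings, finite modules and quotients this form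
  is immediate, since nothing has to be summed.\<close>

locale adic = cring R for R (structure) +
  fixes q
  assumes q_closed [simp, intro]: "q \<in> carrier R"
    and separated: "\<lbrakk> x \<in> carrier R; \<And>n::nat. q [^] n divides x \<rbrakk> \<Longrightarrow> x = \<zero>"
    and horner: "(\<And>j::nat. d j \<in> carrier R) \<Longrightarrow>
      \<exists>e. (\<forall>j. e j \<in> carrier R) \<and> (\<forall>j. e j = d j \<oplus> q \<otimes> e (Suc j))"
begin

text \<open>The difference of two solutions at \<open>j\<close> is \<open>q\<close> times their
  difference at \<open>Suc j\<close>, so it is divisible by every power of \<open>q\<close>.
  Identities between infinite sums are proved later by exhibiting both sides as solutions of one
  recursion.\<close>

lemma horner_unique:
  assumes e: "\<And>j. e j \<in> carrier R" "\<And>j. e j = d j \<oplus> q \<otimes> e (Suc j)"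
    and e': "\<And>j. e' j \<in> carrier R" "\<And>j. e' j = d j \<oplus> q \<otimes> e' (Suc j)"
    and d: "\<And>j::nat. d j \<in> carrier R"
  shows "e j = e' j"
proof -
  have step: "e j \<ominus> e' j = q \<otimes> (e (Suc j) \<ominus> e' (Suc j))" for j
  proof -
    have "e j \<ominus> e' j = (d j \<oplus> q \<otimes> e (Suc j)) \<ominus> (d j \<oplus> q \<otimes> e' (Suc j))"
      by (subst e(2), subst e'(2)) (rule refl)
    also have "\<dots> = q \<otimes> (e (Suc j) \<ominus> e' (Suc j))"
      using e(1)[of "Suc j"] e'(1)[of "Suc j"] d[of j] q_closed by algebra
    finally show ?thesis .
  qed
  have "q [^] n divides (e j \<ominus> e' j)" for n :: nat
  proof (induction n arbitrary: j)
    case 0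
    then show ?case using e(1)[of j] e'(1)[of j] by (auto simp: factor_def intro!: bexI[of _ "e j \<ominus> e' j"])
  next
    case (Suc n)
    obtain x where x: "x \<in> carrier R" "e (Suc j) \<ominus> e' (Suc j) = q [^] n \<otimes> x"
      using Suc[of "Suc j"] unfolding factor_def by auto
    have "e j \<ominus> e' j = q [^] Suc n \<otimes> x" unfolding step[of j] x(2) using x(1) by (simp add: m_ac)
    then show ?case using x(1) unfolding factor_def by auto
  qed
  then have "e j \<ominus> e' j = \<zero>" using separated[of "e j \<ominus> e' j"] e(1) e'(1) by simp
  then show ?thesis using e(1) e'(1) by (metis r_right_minus_eq)
qed

text \<open>\<open>e 0\<close> is the geometric series in \<open>q \<otimes> b\<close>. Its tail
  \<open>e (Suc 0)\<close> equals \<open>b \<otimes> e 0\<close>, because the shifted sequence and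
  the sequence scaled by \<open>b\<close> solve the same recursion.\<close>

lemma geometric:
  assumes b: "b \<in> carrier R"
  obtains v where "v \<in> carrier R" "v = \<one> \<oplus> q \<otimes> b \<otimes> v"
proof -
  obtain e where e: "\<And>j::nat. e j \<in> carrier R" "\<And>j. e j = b [^] j \<oplus> q \<otimes> e (Suc j)"
    using horner[of "\<lambda>j. b [^] j"] nat_pow_closed[OF b] by blast
  have 1: "e (Suc j) = b [^] Suc j \<oplus> q \<otimes> e (Suc (Suc j))" for j by (rule e(2))
  have 2: "b \<otimes> e j = b [^] Suc j \<oplus> q \<otimes> (b \<otimes> e (Suc j))" for j
  proof -
    have "b \<otimes> e j = b \<otimes> (b [^] j \<oplus> q \<otimes> e (Suc j))" using e(2)[of j] by simp
    then show ?thesis using b e(1)[of "Suc j"] by (simp add: r_distr m_ac)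
  qed
  have "e (Suc 0) = b \<otimes> e 0"
    by (rule horner_unique[where e="\<lambda>j. e (Suc j)" and e'="\<lambda>j. b \<otimes> e j" and d="\<lambda>j. b [^] Suc j", OF e(1) 1 _ 2])
      (use b e(1) in auto)
  then have "q \<otimes> e (Suc 0) = q \<otimes> b \<otimes> e 0" using b e(1)[of 0] by (simp only: m_assoc[OF q_closed])
  then have "e 0 = \<one> \<oplus> q \<otimes> b \<otimes> e 0" using e(2)[of 0] by (metis nat_pow_0)
  then show thesis using that e(1) by blast
qed

text \<open>The geometric series is the inverse. Thus \<open>q\<close> lies in the Jacobson radical,
  and units can be recognised modulo \<open>q\<close>.\<close>

lemma one_minus_unit:
  assumes b: "b \<in> carrier R"
  shows "\<one> \<ominus> q \<otimes> b \<in> Units R"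
proof -
  obtain v where v: "v \<in> carrier R" "v = \<one> \<oplus> q \<otimes> b \<otimes> v" using geometric[OF b] .
  have "v \<otimes> (\<one> \<ominus> q \<otimes> b) = v \<ominus> q \<otimes> b \<otimes> v" using v(1) b q_closed by algebra
  also have "\<dots> = (\<one> \<oplus> q \<otimes> b \<otimes> v) \<ominus> q \<otimes> b \<otimes> v"
    by (subst v(2)) (rule refl)
  also have "\<dots> = \<one>" using v(1) b q_closed by algebra
  finally have 1: "v \<otimes> (\<one> \<ominus> q \<otimes> b) = \<one>" .
  moreover have c: "\<one> \<ominus> q \<otimes> b \<in> carrier R" using b by simp
  ultimately have "(\<one> \<ominus> q \<otimes> b) \<otimes> v = \<one>" using m_comm[OF v(1) c] by simp
  then show ?thesis using 1 c v(1) unfolding Units_def by blast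
qed

lemma unit_modI:
  assumes "q divides (\<one> \<ominus> u \<otimes> a)" "u \<in> carrier R" "a \<in> carrier R"
  shows "u \<in> Units R"
proof -
  obtain b where b: "b \<in> carrier R" "\<one> \<ominus> u \<otimes> a = q \<otimes> b" using assms unfolding factor_def by auto
  have "u \<otimes> a = \<one> \<ominus> (\<one> \<ominus> u \<otimes> a)" using assms(2,3) by algebra
  then have "u \<otimes> a \<in> Units R" using one_minus_unit[OF b(1)] b(2) by simp
  then show ?thesis by (rule unit_factor) (fact assms(2), fact assms(3))
qed

text \<open>Passage from the Horner form to ordinary completeness. The limit is \<open>s 0\<close>
  plus the series with coefficients \<open>d n\<close>, the quotients of consecutive differences,
  and \<open>q [^] n \<otimes> e n\<close> is the exact error after \<open>n\<close> steps.\<close>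

lemma cauchy:
  assumes s: "\<And>n. s n \<in> carrier R" and step: "\<And>n::nat. q [^] n divides (s (Suc n) \<ominus> s n)"
  obtains l where "l \<in> carrier R" "\<And>n. q [^] n divides (l \<ominus> s n)"
proof -
  obtain d where d: "\<And>n. d n \<in> carrier R" "\<And>n. s (Suc n) \<ominus> s n = q [^] n \<otimes> d n"
    using step unfolding factor_def by metis
  obtain e where e: "\<And>j::nat. e j \<in> carrier R" "\<And>j. e j = d j \<oplus> q \<otimes> e (Suc j)"
    using horner[of d] d(1) by blast
  have "s 0 \<oplus> e 0 = s n \<oplus> q [^] n \<otimes> e n" for n
  proof (induction n)
    case 0 then show ?case using e(1)[of 0] s[of 0] by simp
  next
    case (Suc n)
    have "s (Suc n) = s n \<oplus> (s (Suc n) \<ominus> s n)" using s[of n] s[of "Suc n"] by algebra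
    then have "s (Suc n) = s n \<oplus> q [^] n \<otimes> d n" using d(2) by simp
    moreover have "q [^] n \<otimes> e n = q [^] n \<otimes> (d n \<oplus> q \<otimes> e (Suc n))" using e(2)[of n] by simp
    ultimately show ?case using Suc s d(1) e(1) by (simp add: r_distr m_ac a_ac)
  qed
  moreover have "(s n \<oplus> q [^] n \<otimes> e n) \<ominus> s n = q [^] n \<otimes> e n" for n
    using s[of n] e(1)[of n] nat_pow_closed[OF q_closed, of n] by algebra
  ultimately have "(s 0 \<oplus> e 0) \<ominus> s n = q [^] n \<otimes> e n" for n by metis
  then show thesis using that[of "s 0 \<oplus> e 0"] s e(1) unfolding factor_def by blast
qed

end

text \<open>The converse passage. The limits of the partial sums of the tails satisfy the Horner
  recursion modulo every power of \<open>q\<close>, and separatedness turns this into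
  equality.\<close>

lemma (in cring) adic_cauchyI:
  assumes q: "q \<in> carrier R"
    and sep: "\<And>x. \<lbrakk> x \<in> carrier R; \<And>n::nat. q [^] n divides x \<rbrakk> \<Longrightarrow> x = \<zero>"
    and complete: "\<And>s. \<lbrakk> \<And>n. s n \<in> carrier R; \<And>n::nat. q [^] n divides (s (Suc n) \<ominus> s n )\<rbrakk> \<Longrightarrow>
      \<exists>l \<in> carrier R. \<forall>n. q [^] n divides (l \<ominus> s n)"
  shows "adic R q"
proof (unfold_locales, fact q, fact sep)
  fix d :: "nat \<Rightarrow> 'a" assume d: "\<And>j. d j \<in> carrier R"
  \<comment> \<open>\<open>s j n\<close> is the sum of \<open>q [^] i \<otimes> d (j + i)\<close>
    over \<open>i < n\<close>. The recursion appends the last term; \<open>shift\<close> below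
    splits off the first one.\<close>
  define s where "s j n = rec_nat \<zero> (\<lambda>n t. t \<oplus> q [^] n \<otimes> d (j + n)) n" for j n
  have s0: "s j 0 = \<zero>" and sS: "s j (Suc n) = s j n \<oplus> q [^] n \<otimes> d (j + n)" for j n
    by (simp_all add: s_def)
  have sc: "s j n \<in> carrier R" for j n by (induction n) (auto simp: s0 sS q d)
  have shift: "s j (Suc n) = d j \<oplus> q \<otimes> s (Suc j) n" for j n
  proof (induction n)
    case 0 then show ?case using q d by (simp add: s0 sS)
  next
    case (Suc n)
    have "s j (Suc (Suc n)) = d j \<oplus> q \<otimes> s (Suc j) n \<oplus> q [^] Suc n \<otimes> d (j + Suc n)"
      using Suc sS by simp
    then show ?case using q d sc by (simp add: sS r_distr m_ac a_ac)
  qed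
  have "\<exists>l \<in> carrier R. \<forall>n. q [^] n divides (l \<ominus> s j n)" for j
  proof (rule complete)
    fix n :: nat
    have "s j (Suc n) \<ominus> s j n = q [^] n \<otimes> d (j + n)"
      unfolding sS using sc[of j n] d q by (simp add: a_minus_def a_ac r_neg1 r_neg2)
    then show "q [^] n divides (s j (Suc n) \<ominus> s j n)" using d unfolding factor_def by auto
  qed (rule sc)
  then obtain e where e: "\<And>j. e j \<in> carrier R" "\<And>j n. q [^] (n::nat) divides (e j \<ominus> s j n)" by metis
  have "e j = d j \<oplus> q \<otimes> e (Suc j)" for j
  proof -
    have "q [^] n divides (e j \<ominus> (d j \<oplus> q \<otimes> e (Suc j)))" for n :: nat
    proof -
      have "q [^] n divides (e j \<ominus> s j (Suc n))"
        using e(2)[of "Suc n" j] e(2)[of j "Suc n"] divides_pow_mono[OF q, of n "Suc n"] q e(1) sc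
        by (meson divides_trans le_SucI nat_pow_closed order_refl)
      moreover have "q [^] n divides (q \<otimes> (e (Suc j) \<ominus> s (Suc j) n))"
        using q e sc by (intro divides_prod_r(2)) auto
      ultimately have "q [^] n divides ((e j \<ominus> s j (Suc n)) \<ominus> q \<otimes> (e (Suc j) \<ominus> s (Suc j) n))"
        by (rule divides_diff[OF nat_pow_closed[OF q]])
      moreover have "(e j \<ominus> s j (Suc n)) \<ominus> q \<otimes> (e (Suc j) \<ominus> s (Suc j) n) =
          e j \<ominus> (d j \<oplus> q \<otimes> e (Suc j))"
        unfolding shift using q d[of j] sc[of "Suc j" n] e(1)[of j] e(1)[of "Suc j"] by algebra
      ultimately show ?thesis by simp
    qed
    then have "e j \<ominus> (d j \<oplus> q \<otimes> e (Suc j)) = \<zero>" using e(1) q d by (intro sep) auto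
    then show ?thesis using e(1) q d by simp
  qed
  then show "\<exists>e. (\<forall>j. e j \<in> carrier R) \<and> (\<forall>j. e j = d j \<oplus> q \<otimes> e (Suc j))" using e(1) by blast
qed

text \<open>Powers of \<open>p\<close> and of \<open>q\<close> divide each other cofinally, so both
  elements define the same topology. The subsequence \<open>s (k * n)\<close> of a
  \<open>p\<close>-Cauchy sequence is \<open>q\<close>-Cauchy, and its limit serves the whole
  sequence.\<close>

lemma (in adic) change_base:
  assumes p: "p \<in> carrier R" and pN: "p divides (q [^] (N::nat))" and qk: "q divides (p [^] (k::nat))"
  shows "adic R p"
proof (rule adic_cauchyI[OF p])
  fix x assume x: "x \<in> carrier R" "\<And>n::nat. p [^] n divides x"
  show "x = \<zero>"
  proof (rule separated[OF x(1)])
    fix n :: nat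
    have "q [^] n divides (p [^] k) [^] n" using divides_pow_pow qk p by simp
    then have "q [^] n divides (p [^] (k * n))" using p by (simp add: nat_pow_pow)
    then show "q [^] n divides x" using x(2)[of "k * n"] p x(1) by (meson divides_trans nat_pow_closed q_closed)
  qed
next
  fix s assume s: "\<And>n. s n \<in> carrier R" and step: "\<And>n::nat. p [^] n divides (s (Suc n) \<ominus> s n)"
  have ps: "p [^] m divides (s (m + i) \<ominus> s m)" for m i :: nat by (rule cauchy_divides[OF p s step])
  have qp: "q [^] n divides (p [^] (k * n))" for n :: nat
    using divides_pow_pow[of q "p [^] k" n] qk p by (simp add: nat_pow_pow)
  have pq: "p [^] n divides (q [^] (N * n))" for n :: nat
    using divides_pow_pow[of p "q [^] N" n] pN p by (simp add: nat_pow_pow)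
  have "q [^] n divides (s (k * Suc n) \<ominus> s (k * n))" for n :: nat
  proof -
    have "p [^] (k * n) divides (s (k * n + k) \<ominus> s (k * n))" by (rule ps)
    then show ?thesis using qp[of n] p s by (metis add.commute divides_trans mult_Suc_right nat_pow_closed q_closed)
  qed
  then obtain l where l: "l \<in> carrier R" "\<And>n. q [^] n divides (l \<ominus> s (k * n))"
    using cauchy[of "\<lambda>n. s (k * n)"] s by blast
  have "p [^] n divides (l \<ominus> s n)" for n :: nat
  proof -
    \<comment> \<open>\<open>q [^] (N * n)\<close> is already divisible by \<open>p [^] n\<close>.
      The successor makes \<open>m\<close> positive, so that the index \<open>k * m + n * m\<close>
      used below is at least \<open>n\<close>.\<close>
    define m where "m = Suc (N * n)"
    have "p [^] n divides (q [^] m)" unfolding m_def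
      using pq[of n] p by (simp add: divides_prod_r)
    then have 1: "p [^] n divides (l \<ominus> s (k * m + n * m))"
    proof -
      have "p [^] (k * m) divides (s (k * m + n * m) \<ominus> s (k * m))" by (rule ps)
      then have "q [^] m divides (s (k * m + n * m) \<ominus> s (k * m))"
        using qp[of m] p s by (meson divides_trans nat_pow_closed q_closed)
      then have "q [^] m divides ((l \<ominus> s (k * m)) \<ominus> (s (k * m + n * m) \<ominus> s (k * m)))"
        by (rule divides_diff[OF nat_pow_closed[OF q_closed] l(2)])
      moreover have "(l \<ominus> s (k * m)) \<ominus> (s (k * m + n * m) \<ominus> s (k * m)) = l \<ominus> s (k * m + n * m)"
        using l(1) s[of "k * m"] s[of "k * m + n * m"] by algebra
      ultimately show ?thesis using \<open>p [^] n divides (q [^] m)\<close> p l s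
        by (metis divides_trans nat_pow_closed)
    qed
    have "k * m + n * m = n + (k * m + (n * m - n))" by (simp add: m_def)
    then have "p [^] n divides (s (k * m + n * m) \<ominus> s n)" using ps[of n "k * m + (n * m - n)"] by metis
    then have "p [^] n divides ((l \<ominus> s (k * m + n * m)) \<oplus> (s (k * m + n * m) \<ominus> s n))"
      using 1 p by (intro divides_sum) auto
    moreover have "(l \<ominus> s (k * m + n * m)) \<oplus> (s (k * m + n * m) \<ominus> s n) = l \<ominus> s n"
      using l(1) s[of n] s[of "k * m + n * m"] by algebra
    ultimately show ?thesis by simp
  qed
  then show "\<exists>l \<in> carrier R. \<forall>n. p [^] n divides (l \<ominus> s n)" using l(1) by blast
qed

text \<open>A pair of complementary elements whose product vanishes modulo \<open>q\<close> lifts to a pair of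
  complementary idempotents; the correction term solves \<open>z = z^2 - \<epsilon>\<close> by iteration.\<close>

lemma (in adic) complementary_mod_q:
  assumes "domain R" and a: "a \<in> carrier R" and b: "b \<in> carrier R" and ab: "a \<oplus> b = \<one>"
    and q: "q divides (a \<otimes> b)"
  shows "q divides a \<or> q divides b"
proof -
  obtain d where d: "d \<in> carrier R" "a \<otimes> b = q \<otimes> d" using q unfolding factor_def by auto
  \<comment> \<open>From \<open>a \<oplus> b = \<one>\<close> the square of
    \<open>b \<ominus> a\<close> is 1 - 4ab, which is 1 modulo \<open>q\<close> and hence a
    unit.\<close>
  have sq: "(b \<ominus> a) \<otimes> (b \<ominus> a) = \<one> \<ominus> q \<otimes> (d \<oplus> d \<oplus> d \<oplus> d)"
  proof -
    have "(b \<ominus> a) \<otimes> (b \<ominus> a) = (a \<oplus> b) \<otimes> (a \<oplus> b) \<ominus> (a \<otimes> b \<oplus> a \<otimes> b \<oplus> a \<otimes> b \<oplus> a \<otimes> b)"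
      using a b by algebra
    also have "\<dots> = \<one> \<ominus> (q \<otimes> d \<oplus> q \<otimes> d \<oplus> q \<otimes> d \<oplus> q \<otimes> d)" using ab d by simp
    finally show ?thesis using d(1) by (simp add: r_distr)
  qed
  have "(b \<ominus> a) \<otimes> (b \<ominus> a) \<in> Units R" unfolding sq using d by (intro one_minus_unit) auto
  then obtain w where w: "w \<in> carrier R" "(b \<ominus> a) \<otimes> (b \<ominus> a) \<otimes> w = \<one>"
    using Units_r_inv_ex by blast
  \<comment> \<open>This is \<open>a \<otimes> b\<close> divided by the square of
    \<open>b \<ominus> a\<close>. Adding \<open>(b \<ominus> a) \<otimes> l\<close> to
    \<open>a\<close> and subtracting it from \<open>b\<close> changes the product by that square
    times \<open>l \<ominus> l \<otimes> l\<close>; the product vanishes if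
    \<open>l \<ominus> l \<otimes> l = \<ominus> \<epsilon>\<close>.\<close>
  define \<epsilon> where "\<epsilon> = q \<otimes> (d \<otimes> w)"
  have \<epsilon>: "\<epsilon> \<in> carrier R" "q divides \<epsilon>" using d w unfolding \<epsilon>_def factor_def by auto
  define z where "z n = rec_nat \<zero> (\<lambda>_ t. t \<otimes> t \<ominus> \<epsilon>) n" for n
  have z0: "z 0 = \<zero>" and zS: "z (Suc n) = z n \<otimes> z n \<ominus> \<epsilon>" for n by (simp_all add: z_def)
  have zc: "z n \<in> carrier R" for n by (induction n) (auto simp: z0 zS \<epsilon>)
  have zq: "q divides (z n)" for n
  proof (induction n)
    case (Suc n)
    then show ?case unfolding zS using zc[of n] \<epsilon> by (intro divides_diff divides_prod_r(1)) auto
  qed (auto simp: z0 divides_zero_r)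
  \<comment> \<open>Squaring contracts: a difference of squares has the factor
    \<open>z (Suc n) \<oplus> z n\<close>, and all iterates are multiples of
    \<open>q\<close>.\<close>
  have "q [^] n divides (z (Suc n) \<ominus> z n)" for n
  proof (induction n)
    case 0 then show ?case using zc by (auto simp: factor_def intro!: bexI[of _ "z (Suc 0) \<ominus> z 0"])
  next
    case (Suc n)
    obtain x where x: "x \<in> carrier R" "z (Suc n) \<ominus> z n = q [^] n \<otimes> x" using Suc unfolding factor_def by auto
    have "q divides (z (Suc n) \<oplus> z n)" using zq by (auto intro: divides_sum)
    then obtain y where y: "y \<in> carrier R" "z (Suc n) \<oplus> z n = q \<otimes> y" unfolding factor_def by auto
    have "z (Suc (Suc n)) \<ominus> z (Suc n) = (z (Suc n) \<otimes> z (Suc n) \<ominus> \<epsilon>) \<ominus> (z n \<otimes> z n \<ominus> \<epsilon>)"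
      by (subst zS, subst (2) zS) (rule refl)
    also have "\<dots> = (z (Suc n) \<ominus> z n) \<otimes> (z (Suc n) \<oplus> z n)"
      using zc[of n] zc[of "Suc n"] \<epsilon>(1) by algebra
    also have "\<dots> = q [^] Suc n \<otimes> (x \<otimes> y)" unfolding x(2) y(2) using x(1) y(1) by (simp add: m_ac)
    finally show ?case using x(1) y(1) unfolding factor_def by auto
  qed
  then obtain l where l: "l \<in> carrier R" "\<And>n. q [^] n divides (l \<ominus> z n)" using cauchy zc by metis
  have "l \<ominus> (l \<otimes> l \<ominus> \<epsilon>) = \<zero>"
  proof (rule separated)
    fix n :: nat
    have "q [^] n divides ((l \<ominus> z (Suc n)) \<ominus> (l \<oplus> z n) \<otimes> (l \<ominus> z n))"
    proof (rule divides_diff)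
      show "q [^] n divides (l \<ominus> z (Suc n))"
        by (rule divides_trans[OF divides_pow_mono l(2)[of "Suc n"]]) auto
      show "q [^] n divides ((l \<oplus> z n) \<otimes> (l \<ominus> z n))"
        by (rule divides_prod_r(2)) (use l zc in auto)
    qed auto
    moreover have "(l \<ominus> z (Suc n)) \<ominus> (l \<oplus> z n) \<otimes> (l \<ominus> z n) = l \<ominus> (l \<otimes> l \<ominus> \<epsilon>)"
      unfolding zS using l(1) zc[of n] \<epsilon>(1) by algebra
    ultimately show "q [^] n divides (l \<ominus> (l \<otimes> l \<ominus> \<epsilon>))" by simp
  qed (use l \<epsilon> in auto)
  moreover have "l \<ominus> l \<otimes> l = (l \<ominus> (l \<otimes> l \<ominus> \<epsilon>)) \<ominus> \<epsilon>" using l(1) \<epsilon>(1) by algebra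
  ultimately have ll: "l \<ominus> l \<otimes> l = \<ominus> \<epsilon>" using \<epsilon>(1) by (simp add: a_minus_def)
  have "q divides ((l \<ominus> z 1) \<oplus> z 1)" using l(2)[of 1] zq[of 1] by (auto intro: divides_sum)
  moreover have "(l \<ominus> z 1) \<oplus> z 1 = l" using l(1) zc[of 1] by algebra
  ultimately have lq: "q divides l" by simp
  have "(a \<oplus> (b \<ominus> a) \<otimes> l) \<otimes> (b \<ominus> (b \<ominus> a) \<otimes> l) = a \<otimes> b \<oplus> (b \<ominus> a) \<otimes> (b \<ominus> a) \<otimes> (l \<ominus> l \<otimes> l)"
    using a b l(1) by algebra
  also have "\<dots> = q \<otimes> d \<ominus> (b \<ominus> a) \<otimes> (b \<ominus> a) \<otimes> w \<otimes> (q \<otimes> d)"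
    unfolding ll d(2) \<epsilon>_def using a b w(1) d(1) q_closed by algebra
  also have "\<dots> = \<zero>" unfolding w(2) using d(1) by (simp add: a_minus_def r_neg)
  \<comment> \<open>In a domain one of the two lifted elements is zero. As \<open>l\<close> is
    divisible by \<open>q\<close>, so is the original \<open>a\<close> or \<open>b\<close>.\<close>
  finally have "a \<oplus> (b \<ominus> a) \<otimes> l = \<zero> \<or> b \<ominus> (b \<ominus> a) \<otimes> l = \<zero>"
    by (rule domain.integral[OF assms(1)]) (use a b l(1) in auto)
  then show ?thesis
  proof
    assume *: "a \<oplus> (b \<ominus> a) \<otimes> l = \<zero>"
    have "a = (a \<oplus> (b \<ominus> a) \<otimes> l) \<ominus> (b \<ominus> a) \<otimes> l" using a b l(1) by algebra
    also have "\<dots> = \<ominus> ((b \<ominus> a) \<otimes> l)" unfolding * using a b l(1) by (simp add: a_minus_def)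
    finally show ?thesis using a b lq by (metis divides_prod_r(2) divides_uminus minus_closed q_closed)
  next
    assume *: "b \<ominus> (b \<ominus> a) \<otimes> l = \<zero>"
    then have "b = (b \<ominus> a) \<otimes> l" using a b l(1) by simp
    then show ?thesis using a b lq by (metis divides_prod_r(2) minus_closed q_closed)
  qed
qed

section \<open>Finite modules and integrality over a complete discrete valuation ring\<close>

text \<open>The generators are the first \<open>n\<close> terms of a sequence, so that
  \<open>u j \<in> lin_span R A u j\<close> expresses the dependence of a term on the earlier
  ones.\<close>

primrec lin_span :: "('a, 'b) ring_scheme \<Rightarrow> 'a set \<Rightarrow> (nat \<Rightarrow> 'a) \<Rightarrow> nat \<Rightarrow> 'a set" where
  "lin_span R A w 0 = {\<zero>\<^bsub>R\<^esub>}"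
| "lin_span R A w (Suc n) = {v \<oplus>\<^bsub>R\<^esub> a \<otimes>\<^bsub>R\<^esub> w n | v a. v \<in> lin_span R A w n \<and> a \<in> A}"

section \<open>Spans with coefficients in a subring, and integrality\<close>

locale over_subring = cring R for R (structure) +
  fixes A
  assumes sub: "subring A R"
begin

lemma A_in: "a \<in> A \<Longrightarrow> a \<in> carrier R"
  using subringE(1)[OF sub] by auto

lemma A_subset: "A \<subseteq> carrier R"
  using A_in by auto

lemma eval_closed_A: "set l \<subseteq> A \<Longrightarrow> x \<in> carrier R \<Longrightarrow> eval l x \<in> carrier R"
  using A_subset eval_in_carrier by blast

lemma lin_span_SucI: "v \<in> lin_span R A w n \<Longrightarrow> a \<in> A \<Longrightarrow> v \<oplus> a \<otimes> w n \<in> lin_span R A w (Suc n)"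
  by auto

lemmas A_closed = subringE(2,3,5,6,7)[OF sub]

lemma lin_span_closed:
  assumes "\<And>i. w i \<in> carrier R"
  shows "lin_span R A w n \<subseteq> carrier R"
  by (induction n) (use assms A_in in auto)

lemma lin_span_zero: "(\<And>i. w i \<in> carrier R) \<Longrightarrow> \<zero> \<in> lin_span R A w n"
proof (induction n)
  case (Suc n)
  then have "\<zero> = \<zero> \<oplus> \<zero> \<otimes> w n" "\<zero> \<in> lin_span R A w n" by auto
  then show ?case using A_closed(1) by auto
qed auto

lemma lin_span_add:
  assumes w: "\<And>i. w i \<in> carrier R"
  shows "x \<in> lin_span R A w n \<Longrightarrow> y \<in> lin_span R A w n \<Longrightarrow> x \<oplus> y \<in> lin_span R A w n"
proof (induction n arbitrary: x y)
  case (Suc n)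
  then obtain v a v' a' where *: "v \<in> lin_span R A w n" "a \<in> A" "x = v \<oplus> a \<otimes> w n"
    "v' \<in> lin_span R A w n" "a' \<in> A" "y = v' \<oplus> a' \<otimes> w n" by auto
  moreover have "v \<in> carrier R" "v' \<in> carrier R" using * lin_span_closed[of w n] w by auto
  ultimately have "x \<oplus> y = (v \<oplus> v') \<oplus> (a \<oplus> a') \<otimes> w n"
    using w A_in by (simp add: l_distr a_ac)
  then show ?case using Suc.IH[of v v'] * A_closed lin_span_SucI by metis
qed auto

lemma lin_span_smult:
  assumes w: "\<And>i. w i \<in> carrier R" and c: "c \<in> A"
  shows "x \<in> lin_span R A w n \<Longrightarrow> c \<otimes> x \<in> lin_span R A w n"
proof (induction n arbitrary: x)
  case 0
  then show ?case using A_in[OF c] by simp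
next
  case (Suc n)
  then obtain v a where *: "v \<in> lin_span R A w n" "a \<in> A" "x = v \<oplus> a \<otimes> w n" by auto
  moreover have "v \<in> carrier R" using * lin_span_closed[of w n] w by auto
  ultimately have "c \<otimes> x = c \<otimes> v \<oplus> (c \<otimes> a) \<otimes> w n"
    using w A_in c by (simp add: r_distr m_assoc)
  then show ?case using Suc.IH[of v] * A_closed c lin_span_SucI by metis
qed

lemma lin_span_uminus:
  assumes w: "\<And>i. w i \<in> carrier R" and x: "x \<in> lin_span R A w n"
  shows "\<ominus> x \<in> lin_span R A w n"
proof -
  have "x \<in> carrier R" using lin_span_closed[of w n] w x by auto
  then have "\<ominus> x = (\<ominus> \<one>) \<otimes> x" by (simp add: l_minus)
  then show ?thesis using lin_span_smult[of w "\<ominus> \<one>" x n] w x A_closed by auto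
qed

lemma lin_span_mono:
  assumes w: "\<And>i. w i \<in> carrier R" and "m \<le> n"
  shows "lin_span R A w m \<subseteq> lin_span R A w n"
  using assms(2)
proof (induction n rule: dec_induct)
  case (step n)
  have "x \<in> lin_span R A w (Suc n)" if "x \<in> lin_span R A w n" for x
  proof -
    have "x = x \<oplus> \<zero> \<otimes> w n" using lin_span_closed[of w n] w that by auto
    then show ?thesis using that A_closed(1) by auto
  qed
  then show ?case using step by blast
qed simp

lemma lin_span_base:
  assumes w: "\<And>i. w i \<in> carrier R" and "i < n"
  shows "w i \<in> lin_span R A w n"
proof -
  have "w i = \<zero> \<oplus> \<one> \<otimes> w i" using w by simp
  then have "w i \<in> lin_span R A w (Suc i)"
    using lin_span_zero[of w i] w A_closed(2) lin_span_SucI by metis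
  then show ?thesis using lin_span_mono[of w "Suc i" n] w assms(2) by auto
qed

lemma lin_span_subsetI:
  assumes "\<zero> \<in> V" "\<And>x y. x \<in> V \<Longrightarrow> y \<in> V \<Longrightarrow> x \<oplus> y \<in> V"
    and "\<And>i a. i < n \<Longrightarrow> a \<in> A \<Longrightarrow> a \<otimes> w i \<in> V"
  shows "lin_span R A w n \<subseteq> V"
  using assms(3)
proof (induction n)
  case (Suc n)
  then have "lin_span R A w n \<subseteq> V" by simp
  then show ?case using Suc.prems assms(2) by auto
qed (use assms(1) in auto)

lemma lin_span_subset_span:
  assumes w: "\<And>i. w i \<in> carrier R" and "\<And>i. i < n \<Longrightarrow> u i \<in> lin_span R A w m"
  shows "lin_span R A u n \<subseteq> lin_span R A w m"
  by (rule lin_span_subsetI)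
    (use assms lin_span_zero lin_span_add lin_span_smult in auto)

text \<open>The recursion is solved for each coefficient separately. Arbitrary choices of
  coefficients suffice, so the generators may satisfy relations.\<close>

lemma lin_span_horner:
  assumes w: "\<And>i. w i \<in> carrier R" and q: "q \<in> A"
    and horner_A: "\<And>d. (\<And>j::nat. d j \<in> A) \<Longrightarrow>
      \<exists>e. (\<forall>j. e j \<in> A) \<and> (\<forall>j. e j = d j \<oplus> q \<otimes> e (Suc j))"
  shows "(\<And>j::nat. d j \<in> lin_span R A w n) \<Longrightarrow>
      \<exists>e. (\<forall>j. e j \<in> lin_span R A w n) \<and> (\<forall>j. e j = d j \<oplus> q \<otimes> e (Suc j))"
proof (induction n arbitrary: d)
  case 0
  then have "d = (\<lambda>_. \<zero>)" by auto
  then show ?case using A_in[OF q] by (intro exI[of _ "\<lambda>_. \<zero>"]) auto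
next
  case (Suc n)
  have "\<exists>v a. v \<in> lin_span R A w n \<and> a \<in> A \<and> d j = v \<oplus> a \<otimes> w n" for j
    using Suc.prems[of j] by auto
  then obtain v a where va: "\<And>j. v j \<in> lin_span R A w n" "\<And>j. a j \<in> A"
    "\<And>j. d j = v j \<oplus> a j \<otimes> w n" by metis
  obtain e where e: "\<And>j. e j \<in> lin_span R A w n" "\<And>j. e j = v j \<oplus> q \<otimes> e (Suc j)"
    using Suc.IH[of v] va(1) by blast
  obtain b where b: "\<And>j. b j \<in> A" "\<And>j. b j = a j \<oplus> q \<otimes> b (Suc j)"
    using horner_A[of a] va(2) by blast
  have "e j \<oplus> b j \<otimes> w n = d j \<oplus> q \<otimes> (e (Suc j) \<oplus> b (Suc j) \<otimes> w n)" for j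
  proof -
    have c: "v j \<in> carrier R" "e (Suc j) \<in> carrier R" using va(1) e(1) lin_span_closed[of w n] w by blast+
    have "e j \<oplus> b j \<otimes> w n = (v j \<oplus> q \<otimes> e (Suc j)) \<oplus> (a j \<oplus> q \<otimes> b (Suc j)) \<otimes> w n"
      by (subst e(2), subst b(2)) (rule refl)
    also have "\<dots> = (v j \<oplus> a j \<otimes> w n) \<oplus> q \<otimes> (e (Suc j) \<oplus> b (Suc j) \<otimes> w n)"
      using c A_in[OF q] A_in[OF va(2)[of j]] A_in[OF b(1)[of "Suc j"]] w[of n] by algebra
    finally show ?thesis using va(3) by simp
  qed
  moreover have "e j \<oplus> b j \<otimes> w n \<in> lin_span R A w (Suc n)" for j using e(1) b(1) by auto
  ultimately show ?case by (intro exI[of _ "\<lambda>j. e j \<oplus> b j \<otimes> w n"]) blast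
qed

lemma lin_span_append:
  assumes w: "\<And>i. w i \<in> carrier R" "\<And>i. u i \<in> carrier R"
    and x: "x \<in> lin_span R A w n" "y \<in> lin_span R A u m"
  shows "x \<oplus> y \<in> lin_span R A (\<lambda>i. if i < n then w i else u (i - n)) (n + m)"
    (is "_ \<in> lin_span R A ?w _")
proof -
  have w': "\<And>i. ?w i \<in> carrier R" using w by auto
  have 1: "lin_span R A w n \<subseteq> lin_span R A ?w (n + m)"
  proof (rule lin_span_subset_span[OF w'])
    fix i assume "i < n" then show "w i \<in> lin_span R A ?w (n + m)"
      using lin_span_base[of ?w i "n + m"] w' by simp
  qed
  have 2: "lin_span R A u m \<subseteq> lin_span R A ?w (n + m)"
  proof (rule lin_span_subset_span[OF w'])
    fix i assume "i < m" then show "u i \<in> lin_span R A ?w (n + m)"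
      using lin_span_base[of ?w "n + i" "n + m"] w' by simp
  qed
  show ?thesis using lin_span_add[of ?w] w' 1 2 x by blast
qed

lemma lin_span_mult_const:
  assumes "\<And>i. w i \<in> carrier R" "c \<in> carrier R" "x \<in> lin_span R A w n"
  shows "x \<otimes> c \<in> lin_span R A (\<lambda>i. w i \<otimes> c) n"
  using assms(3)
proof (induction n arbitrary: x)
  case (Suc n)
  then obtain v a where *: "v \<in> lin_span R A w n" "a \<in> A" "x = v \<oplus> a \<otimes> w n" by auto
  then have "v \<in> carrier R" using lin_span_closed[of w n] assms(1) by auto
  then have "x \<otimes> c = v \<otimes> c \<oplus> a \<otimes> (w n \<otimes> c)" using * assms A_in by (simp add: l_distr m_assoc)
  then show ?case using Suc.IH * by auto
qed (use assms in auto)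

text \<open>Transitivity of finite generation. Each outer generator \<open>w n\<close> contributes
  the block of products \<open>u i \<otimes> w n\<close>.\<close>

lemma lin_span_trans:
  assumes w: "\<And>i. w i \<in> carrier R" and u: "\<And>i. u i \<in> carrier R" and C: "C \<subseteq> lin_span R A u m"
  shows "\<exists>w' N. (\<forall>i. w' i \<in> carrier R) \<and> lin_span R C w n \<subseteq> lin_span R A w' N"
proof (induction n)
  case 0
  show ?case using w by (intro exI[of _ w] exI[of _ 0]) auto
next
  case (Suc n)
  then obtain w' N where w': "\<And>i. w' i \<in> carrier R" "lin_span R C w n \<subseteq> lin_span R A w' N" by blast
  let ?w = "\<lambda>i. if i < N then w' i else u (i - N) \<otimes> w n"
  have "lin_span R C w (Suc n) \<subseteq> lin_span R A ?w (N + m)"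
  proof
    fix x assume "x \<in> lin_span R C w (Suc n)"
    then obtain v c where *: "v \<in> lin_span R C w n" "c \<in> C" "x = v \<oplus> c \<otimes> w n" by auto
    have "c \<otimes> w n \<in> lin_span R A (\<lambda>i. u i \<otimes> w n) m"
      by (rule lin_span_mult_const) (use u w C * in auto)
    then have "v \<oplus> c \<otimes> w n \<in> lin_span R A ?w (N + m)"
      by (intro lin_span_append) (use w' u w * in auto)
    then show "x \<in> lin_span R A ?w (N + m)" using * by simp
  qed
  moreover have "\<forall>i. ?w i \<in> carrier R" using w' u w by auto
  ultimately show ?case by (intro exI[of _ ?w] exI[of _ "N + m"] conjI)
qed

lemma eval_in_lin_span:
  assumes x: "x \<in> carrier R" and "set l \<subseteq> A"
  shows "eval l x \<in> lin_span R A (\<lambda>i. x [^] i) (length l)"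
  using assms(2)
proof (induction l)
  case (Cons a l)
  then have "eval l x \<oplus> a \<otimes> x [^] length l \<in> lin_span R A (\<lambda>i. x [^] i) (length (a # l))" by auto
  moreover have "eval l x \<in> carrier R" "a \<in> carrier R"
    using Cons A_in x eval_closed_A by auto
  ultimately show ?case using x by (simp add: a_comm)
qed simp

lemma lin_span_pow_eval:
  assumes x: "x \<in> carrier R"
  shows "v \<in> lin_span R A (\<lambda>i. x [^] i) n \<Longrightarrow> \<exists>l. set l \<subseteq> A \<and> length l = n \<and> eval l x = v"
proof (induction n arbitrary: v)
  case (Suc n)
  then obtain u a where *: "u \<in> lin_span R A (\<lambda>i. x [^] i) n" "a \<in> A" "v = u \<oplus> a \<otimes> x [^] n" by auto
  then obtain l where l: "set l \<subseteq> A" "length l = n" "eval l x = u" using Suc.IH by blast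
  have "u \<in> carrier R" using l x eval_closed_A by auto
  then show ?case using * l x A_in by (intro exI[of _ "a # l"]) (auto simp: a_comm)
qed auto

text \<open>A monic relation of degree \<open>n\<close> is solved for \<open>x [^] n\<close>. The
  finiteness arguments below use this form in place of polynomials.\<close>

lemma integral_iff_lin_span:
  assumes x: "x \<in> carrier R" and one: "\<one> \<noteq> \<zero>"
  shows "integral_over R A x \<longleftrightarrow> (\<exists>n. x [^] n \<in> lin_span R A (\<lambda>i. x [^] i) n)"
proof
  assume "integral_over R A x"
  then obtain l where l: "set l \<subseteq> A" "l \<noteq> []" "hd l = \<one>" "eval l x = \<zero>"
    unfolding integral_over_def polynomial_def by auto
  then obtain t where t: "l = \<one> # t" by (cases l) auto
  have c: "eval t x \<in> carrier R" using l t x eval_closed_A by auto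
  have "x [^] length t \<oplus> eval t x = \<zero>" using l t x by simp
  then have "x [^] length t = \<ominus> eval t x" using c x by (simp add: add.inv_equality minus_equality)
  then show "\<exists>n. x [^] n \<in> lin_span R A (\<lambda>i. x [^] i) n"
    using lin_span_uminus[of "\<lambda>i. x [^] i" "eval t x" "length t"] eval_in_lin_span[OF x, of t] x l t
    by (metis insert_subset list.simps(15) nat_pow_closed)
next
  assume "\<exists>n. x [^] n \<in> lin_span R A (\<lambda>i. x [^] i) n"
  then obtain n where n: "x [^] n \<in> lin_span R A (\<lambda>i. x [^] i) n" by blast
  then have "\<ominus> (x [^] n) \<in> lin_span R A (\<lambda>i. x [^] i) n" using x by (intro lin_span_uminus) auto
  then obtain l where l: "set l \<subseteq> A" "length l = n" "eval l x = \<ominus> (x [^] n)" using lin_span_pow_eval[OF x] by blast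
  then have "eval (\<one> # l) x = \<zero>" using x by (simp add: r_neg)
  then show "integral_over R A x" using l one A_closed unfolding integral_over_def polynomial_def
    by (intro exI[of _ "\<one> # l"]) auto
qed

text \<open>Multiplication by \<open>x\<close> sends each generator to the next one, except that the
  last goes to \<open>x [^] n\<close>, which is back in the span by assumption. Closure under all
  products follows from closure under multiplication by \<open>x\<close>.\<close>

lemma lin_span_pow_is_subring:
  assumes x: "x \<in> carrier R" and n: "x [^] n \<in> lin_span R A (\<lambda>i. x [^] i) n"
  shows "subring (lin_span R A (\<lambda>i. x [^] i) n) R" (is "subring ?V R")
    and "A \<subseteq> lin_span R A (\<lambda>i. x [^] i) n" and "x \<in> lin_span R A (\<lambda>i. x [^] i) n"
proof -
  have pc: "\<And>i::nat. x [^] i \<in> carrier R" using x by simp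
  have Vc: "\<And>v. v \<in> ?V \<Longrightarrow> v \<in> carrier R" using lin_span_closed[of "\<lambda>i. x [^] i" n] pc by blast
  have mult_x: "x \<otimes> v \<in> ?V" if "v \<in> ?V" for v
  proof -
    have "lin_span R A (\<lambda>i. x [^] i) n \<subseteq> {v \<in> carrier R. x \<otimes> v \<in> ?V}"
    proof (rule lin_span_subsetI)
      fix i a assume i: "i < n" "a \<in> A"
      have "x [^] Suc i \<in> ?V" using n lin_span_base[of "\<lambda>i. x [^] i" "Suc i" n] pc i
        by (cases "Suc i = n") auto
      then have "a \<otimes> x [^] Suc i \<in> ?V" using lin_span_smult[of "\<lambda>i. x [^] i" a] pc i by blast
      moreover have "x \<otimes> (a \<otimes> x [^] i) = a \<otimes> x [^] Suc i" using x A_in i by (simp add: m_ac)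
      ultimately show "a \<otimes> x [^] i \<in> {v \<in> carrier R. x \<otimes> v \<in> ?V}" using x A_in i by auto
    qed (use x lin_span_zero[of "\<lambda>i. x [^] i" n] lin_span_add[of "\<lambda>i. x [^] i"] in \<open>auto simp: r_distr\<close>)
    then show ?thesis using that by auto
  qed
  have pow_mem: "x [^] i \<in> ?V" for i :: nat
  proof (cases "i < n")
    case True then show ?thesis using lin_span_base[of "\<lambda>i. x [^] i"] pc by auto
  next
    case False
    then have "n \<le> i" by simp
    then show ?thesis
    proof (induction i rule: dec_induct)
      case base then show ?case using n by simp
    next
      case (step i) then show ?case using mult_x[of "x [^] i"] x by (simp add: m_comm)
    qed
  qed
  have pow_mult: "x [^] i \<otimes> v \<in> ?V" if "v \<in> ?V" for i :: nat and v
  proof (induction i)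
    case 0 then show ?case using that Vc by simp
  next
    case (Suc i)
    have "x [^] Suc i \<otimes> v = x \<otimes> (x [^] i \<otimes> v)" using x Vc[OF that] by (simp add: m_ac)
    then show ?case using mult_x[OF Suc] by simp
  qed
  have mult: "u \<otimes> v \<in> ?V" if "u \<in> ?V" "v \<in> ?V" for u v
  proof -
    have "lin_span R A (\<lambda>i. x [^] i) n \<subseteq> {u \<in> carrier R. u \<otimes> v \<in> ?V}"
    proof (rule lin_span_subsetI)
      fix i a assume i: "i < n" "a \<in> A"
      have "a \<otimes> (x [^] i \<otimes> v) \<in> ?V" using pow_mult[OF that(2)] lin_span_smult[of "\<lambda>i. x [^] i" a] pc i by blast
      then show "a \<otimes> x [^] i \<in> {u \<in> carrier R. u \<otimes> v \<in> ?V}"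
        using x A_in i Vc[OF that(2)] by (simp add: m_assoc)
    qed (use Vc[OF that(2)] lin_span_zero[of "\<lambda>i. x [^] i" n] pc lin_span_add[of "\<lambda>i. x [^] i"] in \<open>auto simp: l_distr\<close>)
    then show ?thesis using that by auto
  qed
  have A: "a \<in> ?V" if "a \<in> A" for a
  proof -
    have "a \<otimes> x [^] (0::nat) \<in> ?V" using lin_span_smult[of "\<lambda>i. x [^] i" a "x [^] (0::nat)"] pc pow_mem that by blast
    then show ?thesis using A_in[OF that] by simp
  qed
  then show "A \<subseteq> ?V" by blast
  show "x \<in> ?V" using pow_mem[of 1] x by simp
  show "subring ?V R"
  proof (rule subringI)
    show "?V \<subseteq> carrier R" using Vc by blast
    show "\<one> \<in> ?V" using A A_closed by blast
    show "\<ominus> v \<in> ?V" if "v \<in> ?V" for v by (rule lin_span_uminus[OF pc that])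
    show "u \<otimes> v \<in> ?V" if "u \<in> ?V" "v \<in> ?V" for u v by (rule mult[OF that])
    show "u \<oplus> v \<in> ?V" if "u \<in> ?V" "v \<in> ?V" for u v by (rule lin_span_add[OF pc that])
  qed
qed

lemma generate_ring_eq_lin_span:
  assumes x: "x \<in> carrier R" and n: "x [^] n \<in> lin_span R A (\<lambda>i. x [^] i) n"
  shows "generate_ring R (A \<union> {x}) = lin_span R A (\<lambda>i. x [^] i) n"
proof
  have AR: "A \<union> {x} \<subseteq> carrier R" using A_in x by auto
  show "generate_ring R (A \<union> {x}) \<subseteq> lin_span R A (\<lambda>i. x [^] i) n"
    using lin_span_pow_is_subring[OF x n] by (intro generate_ring_min_subring1[OF AR]) auto
  have sr: "subring (generate_ring R (A \<union> {x})) R" by (rule generate_ring_is_subring[OF AR])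
  have p: "x [^] i \<in> generate_ring R (A \<union> {x})" for i :: nat
    by (induction i) (auto intro: generate_ring.intros)
  show "lin_span R A (\<lambda>i. x [^] i) n \<subseteq> generate_ring R (A \<union> {x})"
  proof (rule lin_span_subsetI)
    fix i :: nat and a assume "a \<in> A"
    then have "a \<in> generate_ring R (A \<union> {x})" by (simp add: generate_ring.incl)
    then show "a \<otimes> x [^] i \<in> generate_ring R (A \<union> {x})" using p[of i] by (rule generate_ring.eng_mult)
  qed (use subringE(2,7)[OF sr] in blast)+
qed

end

text \<open>The subring \<open>A\<close> of the domain \<open>R\<close> is a complete discrete valuation ring with uniformizer \<open>p\<close>, or a
  field if \<open>p = 0\<close>.\<close>

locale cdvr = domain R + over_subring R A for R (structure) and A +
  fixes p
  assumes p_in: "p \<in> A"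
    and p_nonunit: "a \<in> A \<Longrightarrow> p \<otimes> a \<noteq> \<one>"
    and valuation: "a \<in> A \<Longrightarrow> a \<noteq> \<zero> \<Longrightarrow>
      \<exists>(k::nat) u v. u \<in> A \<and> v \<in> A \<and> u \<otimes> v = \<one> \<and> a = p [^] k \<otimes> u"
    and horner_A: "(\<And>j::nat. d j \<in> A) \<Longrightarrow>
      \<exists>e. (\<forall>j. e j \<in> A) \<and> (\<forall>j. e j = d j \<oplus> p \<otimes> e (Suc j))"
begin

lemma p_closed [simp]: "p \<in> carrier R"
  using A_in[OF p_in] .

lemma pow_p_in: "p [^] (k::nat) \<in> A"
  by (induction k) (use A_closed p_in in auto)

text \<open>Valuations are natural numbers, so some nonzero term has least valuation. It divides
  every other term and serves as pivot in the elimination that follows.\<close>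

lemma least_divisor:
  assumes c: "\<And>j::nat. c j \<in> A"
  shows "\<exists>i. \<forall>j. \<exists>t\<in>A. c j = t \<otimes> c i"
proof (cases "\<forall>j. c j = \<zero>")
  case True
  then show ?thesis using A_closed(2) by (intro exI[of _ 0]) (auto intro!: bexI[of _ \<one>])
next
  case False
  define P where "P k \<longleftrightarrow> (\<exists>j u v. u \<in> A \<and> v \<in> A \<and> u \<otimes> v = \<one> \<and> c j = p [^] k \<otimes> u)" for k :: nat
  have "\<exists>k. P k" using False valuation[OF c] unfolding P_def by metis
  then have least: "P (Least P)" by (metis LeastI)
  then obtain i u v where i: "u \<in> A" "v \<in> A" "u \<otimes> v = \<one>" "c i = p [^] (Least P) \<otimes> u"
    unfolding P_def by auto
  have "\<exists>t\<in>A. c j = t \<otimes> c i" for j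
  proof (cases "c j = \<zero>")
    case True then show ?thesis using A_in[OF c] A_closed(1) by (intro bexI[of _ \<zero>]) auto
  next
    case False
    then obtain k :: nat and u' v' where k: "u' \<in> A" "v' \<in> A" "u' \<otimes> v' = \<one>" "c j = p [^] k \<otimes> u'"
      using valuation[OF c] by blast
    then have "P k" unfolding P_def by blast
    then have "Least P \<le> k" by (rule Least_le)
    then have pk: "p [^] k = p [^] (k - Least P) \<otimes> p [^] (Least P)" by (simp add: nat_pow_mult)
    have "p [^] (k - Least P) \<otimes> u' \<otimes> v \<otimes> c i = p [^] (k - Least P) \<otimes> p [^] (Least P) \<otimes> u' \<otimes> (u \<otimes> v)"
      unfolding i(4) using A_in[OF i(1)] A_in[OF i(2)] A_in[OF k(1)] by (simp add: m_ac)
    also have "\<dots> = c j" unfolding i(3) k(4) pk using A_in[OF k(1)] by simp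
    finally show ?thesis using A_closed pow_p_in k(1) i(2)
      by (intro bexI[of _ "p [^] (k - Least P) \<otimes> u' \<otimes> v"]) auto
  qed
  then show ?thesis by blast
qed

text \<open>Gaussian elimination over a valuation ring, in place of a Noetherian or determinant
  argument. Among the coefficients of \<open>w n\<close> one, at index \<open>i\<close>, divides all
  others; subtracting multiples of \<open>u i\<close> from the later terms removes
  \<open>w n\<close>, and induction applies. A dependency among the reduced terms is one among the
  terms of \<open>u\<close>, because \<open>i\<close> precedes all indices involved.\<close>

lemma sequence_in_span_dependent:
  assumes w: "\<And>i. w i \<in> carrier R"
  shows "(\<And>j. u j \<in> lin_span R A w n) \<Longrightarrow> \<exists>j. u j \<in> lin_span R A u j"
proof (induction n arbitrary: u)
  case 0
  then show ?case by (intro exI[of _ 0]) auto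
next
  case (Suc n)
  have "\<exists>v a. v \<in> lin_span R A w n \<and> a \<in> A \<and> u j = v \<oplus> a \<otimes> w n" for j
    using Suc.prems[of j] by auto
  then obtain v a where va: "\<And>j. v j \<in> lin_span R A w n" "\<And>j. a j \<in> A"
    "\<And>j. u j = v j \<oplus> a j \<otimes> w n" by metis
  have vc: "\<And>j. v j \<in> carrier R" using va(1) lin_span_closed[of w n] w by blast
  have uc: "\<And>j. u j \<in> carrier R" using Suc.prems lin_span_closed[of w "Suc n"] w by blast
  obtain i where "\<forall>j. \<exists>t\<in>A. a j = t \<otimes> a i" using least_divisor[of a] va(2) by blast
  then obtain t where t: "\<And>j. t j \<in> A" "\<And>j. a j = t j \<otimes> a i" by metis
  define u' where "u' j = u (Suc i + j) \<ominus> t (Suc i + j) \<otimes> u i" for j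
  have "u' j \<in> lin_span R A w n" for j
  proof -
    let ?k = "Suc i + j"
    have "u' j = (v ?k \<oplus> a ?k \<otimes> w n) \<ominus> t ?k \<otimes> (v i \<oplus> a i \<otimes> w n)"
      unfolding u'_def va(3)[of ?k] va(3)[of i] ..
    also have "\<dots> = v ?k \<ominus> t ?k \<otimes> v i \<oplus> (a ?k \<ominus> t ?k \<otimes> a i) \<otimes> w n"
      using vc[of ?k] vc[of i] A_in[OF va(2)[of ?k]] A_in[OF va(2)[of i]] A_in[OF t(1)[of ?k]] w[of n] by algebra
    also have "a ?k \<ominus> t ?k \<otimes> a i = \<zero>" using t(2)[of ?k] A_in[OF va(2)] A_in[OF t(1)]
      by (metis m_closed r_right_minus_eq)
    finally have "u' j = v ?k \<oplus> \<ominus> (t ?k \<otimes> v i)" using vc A_in[OF t(1)] w by (simp add: a_minus_def)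
    then show ?thesis using va(1) t(1) by (simp add: lin_span_add lin_span_uminus lin_span_smult w)
  qed
  then obtain j where j: "u' j \<in> lin_span R A u' j" using Suc.IH[of u'] by blast
  let ?k = "Suc i + j"
  have base: "u l \<in> lin_span R A u ?k" if "l < ?k" for l using lin_span_base[OF uc that] .
  have "lin_span R A u' j \<subseteq> lin_span R A u ?k"
  proof (rule lin_span_subset_span[OF uc])
    fix l assume "l < j"
    then show "u' l \<in> lin_span R A u ?k" unfolding u'_def a_minus_def
      by (intro lin_span_add lin_span_uminus lin_span_smult uc t(1) base) auto
  qed
  then have "u' j \<oplus> t ?k \<otimes> u i \<in> lin_span R A u ?k"
    using j by (intro lin_span_add lin_span_smult uc t(1) base) auto
  moreover have "u' j \<oplus> t ?k \<otimes> u i = u ?k" unfolding u'_def using uc[of ?k] uc[of i] A_in[OF t(1)[of ?k]] by algebra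
  ultimately have "u ?k \<in> lin_span R A u ?k" by simp
  then show ?case by blast
qed

text \<open>The powers of \<open>x\<close> form a sequence in a finite span, so one of them depends
  on the earlier ones.\<close>

lemma integral_overI_powers:
  assumes w: "\<And>i. w i \<in> carrier R" and x: "x \<in> carrier R"
    and "\<And>j::nat. x [^] j \<in> lin_span R A w n"
  shows "integral_over R A x"
  using sequence_in_span_dependent[of w "\<lambda>j. x [^] j" n] assms integral_iff_lin_span[OF x one_not_zero] by blast

text \<open>Adjoining \<open>y\<close> to \<open>A\<close> and then \<open>x\<close> to the result
  gives a ring inside a finite \<open>A\<close>-span. It contains sum, product and negatives
  together with all their powers, which makes these integral.\<close>

lemma integral_closure_is_subring:
  "subring {x \<in> carrier R. integral_over R A x} R"
proof -
  have key: "\<exists>w N. (\<forall>i. w i \<in> carrier R) \<and> (\<exists>C. subring C R \<and> x \<in> C \<and> y \<in> C \<and> C \<subseteq> lin_span R A w N)"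
    if x: "x \<in> carrier R" "integral_over R A x" and y: "y \<in> carrier R" "integral_over R A y" for x y
  proof -
    obtain m where m: "y [^] m \<in> lin_span R A (\<lambda>i. y [^] i) m"
      using y integral_iff_lin_span[OF y(1) one_not_zero] by blast
    define C where "C = lin_span R A (\<lambda>i. y [^] i) m"
    have C: "subring C R" "A \<subseteq> C" "y \<in> C" unfolding C_def using lin_span_pow_is_subring[OF y(1) m] by auto
    interpret C: over_subring R C by (intro over_subring.intro over_subring_axioms.intro cring_axioms C(1))
    have "integral_over R C x" using x(2) C(2) unfolding integral_over_def polynomial_def by blast
    then obtain n where n: "x [^] n \<in> lin_span R C (\<lambda>i. x [^] i) n"
      using C.integral_iff_lin_span[OF x(1) one_not_zero] by blast
    define E where "E = lin_span R C (\<lambda>i. x [^] i) n"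
    have E: "subring E R" "C \<subseteq> E" "x \<in> E" unfolding E_def using C.lin_span_pow_is_subring[OF x(1) n] by auto
    have "\<exists>w' N. (\<forall>i. w' i \<in> carrier R) \<and> lin_span R C (\<lambda>i. x [^] i) n \<subseteq> lin_span R A w' N"
      by (rule lin_span_trans[of _ "\<lambda>i. y [^] i"]) (use x y in \<open>auto simp: C_def\<close>)
    then show ?thesis using E C unfolding E_def by blast
  qed
  have op: "integral_over R A z" if "C \<subseteq> lin_span R A w N" "subring C R" "z \<in> C" "\<forall>i. w i \<in> carrier R" for z C w N
  proof (rule integral_overI_powers[of w])
    show "z \<in> carrier R" using that subringE(1) by blast
    have "z [^] j \<in> C" for j :: nat by (induction j) (use subringE[OF that(2)] that(3) in auto)
    then show "z [^] j \<in> lin_span R A w N" for j :: nat using that by blast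
  qed (use that in auto)
  have A_int: "integral_over R A a" if "a \<in> A" for a
  proof (rule integral_overI_powers[of "\<lambda>_. \<one>" a 1])
    fix j :: nat
    have "a [^] j \<in> A" by (induction j) (use A_closed that in auto)
    moreover from this have "a [^] j = \<zero> \<oplus> a [^] j \<otimes> \<one>" using A_in by simp
    ultimately show "a [^] j \<in> lin_span R A (\<lambda>_. \<one>) 1" by auto
  qed (use A_in that in auto)
  show ?thesis
  proof (rule subringI)
    show "\<one> \<in> {x \<in> carrier R. integral_over R A x}" using A_int A_closed by auto
    fix x y assume "x \<in> {x \<in> carrier R. integral_over R A x}" "y \<in> {x \<in> carrier R. integral_over R A x}"
    then have xy: "x \<in> carrier R" "integral_over R A x" "y \<in> carrier R" "integral_over R A y" by auto
    obtain w N C where *: "\<forall>i. w i \<in> carrier R" "subring C R" "x \<in> C" "y \<in> C" "C \<subseteq> lin_span R A w N"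
      using key[OF xy] by blast
    show "x \<otimes> y \<in> {x \<in> carrier R. integral_over R A x}"
      using op[OF *(5,2) _ *(1)] subringE(6)[OF *(2) *(3,4)] xy by auto
    show "x \<oplus> y \<in> {x \<in> carrier R. integral_over R A x}"
      using op[OF *(5,2) _ *(1)] subringE(7)[OF *(2) *(3,4)] xy by auto
  next
    fix x assume "x \<in> {x \<in> carrier R. integral_over R A x}"
    then have xy: "x \<in> carrier R" "integral_over R A x" by auto
    obtain w N C where *: "\<forall>i. w i \<in> carrier R" "subring C R" "x \<in> C" "C \<subseteq> lin_span R A w N"
      using key[OF xy xy] by blast
    show "\<ominus> x \<in> {x \<in> carrier R. integral_over R A x}"
      using op[OF *(4,2) _ *(1)] subringE(5)[OF *(2) *(3)] xy by auto
  qed auto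
qed

lemma mem_integral_over:
  assumes "a \<in> A" shows "integral_over R A a"
proof -
  have "polynomial A [\<one>, \<ominus> a]" using A_closed assms one_not_zero by (auto simp: polynomial_def)
  moreover have "eval [\<one>, \<ominus> a] a = \<zero>" using A_in[OF assms] by (simp add: r_neg)
  ultimately show ?thesis unfolding integral_over_def by (intro exI[of _ "[\<one>, \<ominus> a]"]) simp
qed

text \<open>Multiply an expression of \<open>b [^] n\<close> through lower powers by
  \<open>p [^] n\<close>. If \<open>p\<close> inverted \<open>b\<close>, each term would keep a
  factor \<open>p\<close> and a coefficient from \<open>A\<close>, so \<open>\<one>\<close> would be
  a multiple of \<open>p\<close> within \<open>A\<close>.\<close>

lemma p_not_unit_over_integral:
  assumes b: "b \<in> carrier R" "integral_over R A b"
  shows "p \<otimes> b \<noteq> \<one>"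
proof
  assume pb: "p \<otimes> b = \<one>"
  obtain n where n: "b [^] n \<in> lin_span R A (\<lambda>i. b [^] i) n"
    using b integral_iff_lin_span[OF b(1) one_not_zero] by blast
  have "lin_span R A (\<lambda>i. b [^] i) n \<subseteq> {v \<in> carrier R. \<exists>a\<in>A. p [^] n \<otimes> v = p \<otimes> a}"
  proof (rule lin_span_subsetI)
    show "\<zero> \<in> {v \<in> carrier R. \<exists>a\<in>A. p [^] n \<otimes> v = p \<otimes> a}" using A_closed(1) by (auto intro!: bexI[of _ \<zero>])
  next
    fix x y assume "x \<in> {v \<in> carrier R. \<exists>a\<in>A. p [^] n \<otimes> v = p \<otimes> a}" "y \<in> {v \<in> carrier R. \<exists>a\<in>A. p [^] n \<otimes> v = p \<otimes> a}"
    then obtain a a' where "x \<in> carrier R" "y \<in> carrier R" "a \<in> A" "a' \<in> A"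
      "p [^] n \<otimes> x = p \<otimes> a" "p [^] n \<otimes> y = p \<otimes> a'" by auto
    moreover from this have "p [^] n \<otimes> (x \<oplus> y) = p \<otimes> (a \<oplus> a')"
      using A_in by (simp add: r_distr)
    ultimately show "x \<oplus> y \<in> {v \<in> carrier R. \<exists>a\<in>A. p [^] n \<otimes> v = p \<otimes> a}"
      by (intro CollectI conjI bexI[of _ "a \<oplus> a'"] a_closed A_closed(5))
  next
    fix i :: nat and a assume i: "i < n" "a \<in> A"
    have "p [^] n = p [^] (Suc (n - Suc i) + i)" using i by simp
    also have "\<dots> = p \<otimes> p [^] (n - Suc i) \<otimes> p [^] i"
      by (simp only: nat_pow_mult[symmetric] p_closed nat_pow_Suc m_comm[OF nat_pow_closed[OF p_closed] p_closed])
    finally have "p [^] n = p \<otimes> p [^] (n - Suc i) \<otimes> p [^] i" .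
    then have "p [^] n \<otimes> (a \<otimes> b [^] i) = p \<otimes> p [^] (n - Suc i) \<otimes> a \<otimes> (p [^] i \<otimes> b [^] i)"
      using A_in[OF i(2)] b(1) by (simp add: m_ac)
    also have "p [^] i \<otimes> b [^] i = \<one>" using pb b(1) by (metis nat_pow_distrib nat_pow_one p_closed)
    finally have "p [^] n \<otimes> (a \<otimes> b [^] i) = p \<otimes> (p [^] (n - Suc i) \<otimes> a)" using A_in[OF i(2)] by (simp add: m_assoc)
    then show "a \<otimes> b [^] i \<in> {v \<in> carrier R. \<exists>a\<in>A. p [^] n \<otimes> v = p \<otimes> a}"
      using A_closed(4)[OF pow_p_in i(2)] A_in[OF i(2)] b(1) by blast
  qed
  then obtain a where "a \<in> A" "p [^] n \<otimes> b [^] n = p \<otimes> a" using n by auto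
  moreover have "p [^] n \<otimes> b [^] n = \<one>" using pb b(1) by (metis nat_pow_distrib nat_pow_one p_closed)
  ultimately show False using p_nonunit by metis
qed

text \<open>The witness is the constant term of a monic relation for \<open>z\<close>. If that term
  vanishes, \<open>z\<close> can be cancelled in the domain and the degree drops.\<close>

lemma integral_divides_base:
  assumes B: "subring B R" "A \<subseteq> B" and z: "z \<in> B" "z \<noteq> \<zero>" "integral_over R A z"
  shows "\<exists>c\<in>A. c \<noteq> \<zero> \<and> (\<exists>y\<in>B. c = z \<otimes> y)"
proof -
  have zc: "z \<in> carrier R" using subringE(1)[OF B(1)] z(1) by auto
  have main: "set l \<subseteq> A \<Longrightarrow> eval (\<one> # l) z = \<zero> \<Longrightarrow> \<exists>c\<in>A. c \<noteq> \<zero> \<and> (\<exists>y\<in>B. c = z \<otimes> y)" for l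
  \<comment> \<open>Coefficients are listed from the highest degree down, so the constant term is
    the last entry.\<close>
  proof (induction l rule: rev_induct)
    case (snoc c l)
    have l: "set l \<subseteq> A" "c \<in> A" using snoc.prems by auto
    have "set (\<one> # l) \<subseteq> A" using l A_closed by auto
    then have sB: "set (\<one> # l) \<subseteq> B" using B(2) by blast
    have eB: "eval k z \<in> B" if "set k \<subseteq> B" for k using that
    proof (induction k)
      case (Cons a k)
      have "z [^] i \<in> B" for i :: nat by (induction i) (use subringE[OF B(1)] z(1) in auto)
      then show ?case using Cons subringE(6,7)[OF B(1)] by simp
    qed (use subringE[OF B(1)] in auto)
    have ec: "eval (\<one> # l) z \<in> carrier R" using eB[OF sB] subringE(1)[OF B(1)] by blast
    have "eval ((\<one> # l) @ [c]) z = eval (\<one> # l) z \<otimes> z \<oplus> c"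
      by (rule eval_append_aux) (use \<open>set (\<one> # l) \<subseteq> A\<close> A_subset l zc in auto)
    then have e0: "eval (\<one> # l) z \<otimes> z \<oplus> c = \<zero>" using snoc.prems by simp
    show ?case
    proof (cases "c = \<zero>")
      case True
      then have "eval (\<one> # l) z \<otimes> z = \<zero>" using e0 ec zc by (metis m_closed r_zero)
      then have "eval (\<one> # l) z = \<zero>" using integral[OF _ ec zc] z(2) by blast
      then show ?thesis using snoc.IH l by blast
    next
      case False
      have "c = \<ominus> (eval (\<one> # l) z \<otimes> z)" using e0 ec zc A_in[OF l(2)] by (simp add: a_comm add.inv_equality minus_equality)
      then have "c = z \<otimes> (\<ominus> eval (\<one> # l) z)" using ec zc by (simp only: r_minus m_comm)
      moreover have "\<ominus> eval (\<one> # l) z \<in> B" using eB[OF sB] subringE(5)[OF B(1)] by blast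
      ultimately show ?thesis using False l(2) by blast
    qed
  qed (use one_not_zero in auto)
  obtain l where l: "set l \<subseteq> A" "l \<noteq> []" "hd l = \<one>" "eval l z = \<zero>"
    using z(3) unfolding integral_over_def polynomial_def by auto
  then show ?thesis using main[of "tl l"] by (cases l) auto
qed

text \<open>A nonzero element of the base is a power of \<open>p\<close> up to a unit, so the
  multiple of \<open>z\<close> found there can be taken to be such a power.\<close>

lemma integral_divides_pow:
  assumes B: "subring B R" "A \<subseteq> B" and z: "z \<in> B" "z \<noteq> \<zero>" "integral_over R A z"
  shows "\<exists>k::nat. \<exists>y\<in>B. p [^] k = z \<otimes> y"
proof -
  obtain c y where c: "c \<in> A" "c \<noteq> \<zero>" "y \<in> B" "c = z \<otimes> y" using integral_divides_base[OF B z] by blast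
  obtain k :: nat and u v where k: "u \<in> A" "v \<in> A" "u \<otimes> v = \<one>" "c = p [^] k \<otimes> u" using valuation[OF c(1,2)] by blast
  have BR: "B \<subseteq> carrier R" using subringE(1)[OF B(1)] .
  have "p [^] k = p [^] k \<otimes> (u \<otimes> v)" using k by simp
  also have "\<dots> = c \<otimes> v" unfolding k(4) using A_in k(1,2) by (simp add: m_assoc)
  also have "\<dots> = z \<otimes> (y \<otimes> v)" unfolding c(4) using A_in[OF k(2)] c(3) z(1) BR by (simp add: m_assoc subset_iff)
  finally show ?thesis using subringE(6)[OF B(1) c(3)] k(2) B(2) by blast
qed

text \<open>Separatedness: a nonzero \<open>x\<close> divides some \<open>p [^] k\<close> times a
  unit, so if \<open>p [^] Suc k\<close> divided \<open>x\<close>, then \<open>p\<close> would be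
  invertible among integral elements. The Horner form passes from \<open>A\<close> to
  \<open>B\<close> through the generators.\<close>

lemma finite_extension_adic:
  assumes B: "subring B R" "A \<subseteq> B" and w: "\<And>i. w i \<in> carrier R" and Bw: "B = lin_span R A w n"
    and int: "\<And>b. b \<in> B \<Longrightarrow> integral_over R A b"
  shows "adic (R\<lparr>carrier := B\<rparr>) p"
proof -
  have BR: "B \<subseteq> carrier R" using subringE(1)[OF B(1)] .
  interpret B: domain "R\<lparr>carrier := B\<rparr>" by (rule subring_is_domain[OF B(1)])
  show ?thesis
  proof unfold_locales
    show "p \<in> carrier (R\<lparr>carrier := B\<rparr>)" using p_in B(2) by auto
  next
    fix x assume x: "x \<in> carrier (R\<lparr>carrier := B\<rparr>)"
      and div: "\<And>n::nat. p [^]\<^bsub>R\<lparr>carrier := B\<rparr>\<^esub> n divides\<^bsub>R\<lparr>carrier := B\<rparr>\<^esub> x"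
    have xB: "x \<in> B" using x by simp
    show "x = \<zero>\<^bsub>R\<lparr>carrier := B\<rparr>\<^esub>"
    proof (rule ccontr)
      assume "x \<noteq> \<zero>\<^bsub>R\<lparr>carrier := B\<rparr>\<^esub>"
      then have x0: "x \<noteq> \<zero>" by simp
      obtain c y where c: "c \<in> A" "c \<noteq> \<zero>" "y \<in> B" "c = x \<otimes> y"
        using integral_divides_base[OF B xB x0 int[OF xB]] by blast
      obtain k :: nat and u v where k: "u \<in> A" "v \<in> A" "u \<otimes> v = \<one>" "c = p [^] k \<otimes> u" using valuation[OF c(1,2)] by blast
      obtain b where b: "b \<in> B" "x = p [^] Suc k \<otimes> b"
        using div[of "Suc k"] unfolding factor_def nat_pow_consistent[symmetric] by auto
      have cl: "b \<in> carrier R" "y \<in> carrier R" "u \<in> carrier R" "v \<in> carrier R"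
        using b c(3) BR A_in k by auto
      have "p [^] k \<otimes> u = p [^] k \<otimes> (p \<otimes> (b \<otimes> y))" using c(4) k(4) b(2) cl by (simp add: m_assoc)
      moreover have "p [^] k \<noteq> \<zero>" using c(2) k(4) cl by auto
      ultimately have "u = p \<otimes> (b \<otimes> y)" using cl by (simp add: m_lcancel)
      then have "\<one> = p \<otimes> (b \<otimes> y \<otimes> v)" using k(3) cl by (simp add: m_assoc)
      moreover have "b \<otimes> y \<otimes> v \<in> B" using subringE(6)[OF B(1)] b(1) c(3) k(2) B(2) by blast
      ultimately show False using p_not_unit_over_integral int BR by (metis subsetD)
    qed
  next
    fix d :: "nat \<Rightarrow> 'a" assume "\<And>j. d j \<in> carrier (R\<lparr>carrier := B\<rparr>)"
    then have d: "\<And>j. d j \<in> lin_span R A w n" unfolding Bw by simp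
    have "\<exists>e. (\<forall>j. e j \<in> lin_span R A w n) \<and> (\<forall>j. e j = d j \<oplus> p \<otimes> e (Suc j))"
    proof (rule lin_span_horner[where w=w and q=p and n=n and d=d, OF w p_in _ d])
      fix d' :: "nat \<Rightarrow> 'a" assume "\<And>j. d' j \<in> A"
      then show "\<exists>e. (\<forall>j. e j \<in> A) \<and> (\<forall>j. e j = d' j \<oplus> p \<otimes> e (Suc j))" by (rule horner_A)
    qed
    then obtain e where e: "\<And>j. e j \<in> B" "\<And>j. e j = d j \<oplus> p \<otimes> e (Suc j)" unfolding Bw by blast
    show "\<exists>e. (\<forall>j. e j \<in> carrier (R\<lparr>carrier := B\<rparr>)) \<and>
        (\<forall>j. e j = d j \<oplus>\<^bsub>R\<lparr>carrier := B\<rparr>\<^esub> p \<otimes>\<^bsub>R\<lparr>carrier := B\<rparr>\<^esub> e (Suc j))"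
    proof (intro exI[of _ e] conjI allI)
      fix j show "e j \<in> carrier (R\<lparr>carrier := B\<rparr>)" using e(1) by simp
      show "e j = d j \<oplus>\<^bsub>R\<lparr>carrier := B\<rparr>\<^esub> p \<otimes>\<^bsub>R\<lparr>carrier := B\<rparr>\<^esub> e (Suc j)"
        using e(2)[of j] by simp
    qed
  qed
qed

end

section \<open>The completion of a principal ideal domain at a maximal ideal\<close>

context cring
begin

lemma mem_cgenideal_iff: "a \<in> carrier R \<Longrightarrow> x \<in> PIdl a \<longleftrightarrow> a divides x"
  unfolding cgenideal_def factor_def using m_comm by auto

lemma divides_one_unit:
  assumes "a \<in> carrier R" "a divides \<one>" shows "a \<in> Units R"
proof -
  obtain c where "c \<in> carrier R" "\<one> = a \<otimes> c" using assms unfolding factor_def by blast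
  then have "c \<in> carrier R" "a \<otimes> c = \<one>" "c \<otimes> a = \<one>" using assms(1) by (auto simp: m_comm)
  then show ?thesis using assms(1) unfolding Units_def by blast
qed

lemma ideal_pow_cgenideal:
  assumes p: "p \<in> carrier R"
  shows "ideal_pow R (PIdl p) n = PIdl (p [^] n)"
proof (induction n)
  case 0
  have "PIdl \<one> = carrier R" by (auto simp: cgenideal_def intro!: r_one[symmetric])
  then show ?case by simp
next
  case (Suc n)
  have id: "ideal (PIdl (p [^] Suc n)) R" using p cgenideal_ideal by simp
  have "x \<in> PIdl (p [^] Suc n)" if "x \<in> ideal_prod R (PIdl p) (PIdl (p [^] n))" for x
    using that
  proof (induction rule: ideal_prod.induct)
    case (prod i j)
    then obtain a b where "a \<in> carrier R" "b \<in> carrier R" "i = a \<otimes> p" "j = b \<otimes> p [^] n"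
      unfolding cgenideal_def by auto
    then have "i \<otimes> j = (a \<otimes> b) \<otimes> p [^] Suc n" "a \<otimes> b \<in> carrier R" using p by (auto simp: m_ac)
    then show ?case unfolding cgenideal_def by blast
  next
    case (sum s t)
    show ?case by (rule additive_subgroup.a_closed[OF ideal.axioms(1)[OF id] sum.IH])
  qed
  moreover have "x \<in> ideal_prod R (PIdl p) (PIdl (p [^] n))" if x: "x \<in> PIdl (p [^] Suc n)" for x
  proof -
    from x have "\<exists>a. x = a \<otimes> p [^] Suc n \<and> a \<in> carrier R" by (simp only: cgenideal_def mem_Collect_eq)
    then obtain a where a: "x = a \<otimes> p [^] Suc n" "a \<in> carrier R" by (elim exE conjE)
    have x': "x = (a \<otimes> p) \<otimes> p [^] n" unfolding a(1) using a(2) p by (simp add: m_ac)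
    have "a \<otimes> p \<in> PIdl p" unfolding cgenideal_def using a(2) by (intro CollectI exI[of _ a] conjI refl)
    then show ?thesis unfolding x' by (rule ideal_prod.prod) (rule cgenideal_self, simp add: p)
  qed
  ultimately show ?case using Suc by auto
qed

end

context ideal
begin

lemma FactRing_carrier: "carrier (R Quot I) = (+>) I ` carrier R"
  by (auto simp: FactRing_simps)

lemma FactRing_ops:
  "x \<in> carrier R \<Longrightarrow> y \<in> carrier R \<Longrightarrow> (I +> x) \<oplus>\<^bsub>R Quot I\<^esub> (I +> y) = I +> (x \<oplus> y)"
  "x \<in> carrier R \<Longrightarrow> y \<in> carrier R \<Longrightarrow> (I +> x) \<otimes>\<^bsub>R Quot I\<^esub> (I +> y) = I +> (x \<otimes> y)"
  "\<one>\<^bsub>R Quot I\<^esub> = I +> \<one>" "\<zero>\<^bsub>R Quot I\<^esub> = I +> \<zero>"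
proof -
  have "I +> \<zero> = I" by (rule a_rcos_const) simp
  then show "\<zero>\<^bsub>R Quot I\<^esub> = I +> \<zero>" by (simp add: FactRing_def)
qed (simp_all add: FactRing_def a_rcos_sum rcoset_mult_add)

end

text \<open>\<open>p\<close> is zero if \<open>R\<close> is a field. The completion is then
  \<open>R\<close> itself, so fields go through the same lemmas.\<close>

locale pid_maximal = principal_domain R for R (structure) +
  fixes p
  assumes p_closed [simp]: "p \<in> carrier R"
    and maximal: "maximalideal (PIdl p) R"
begin

abbreviation "S \<equiv> adic_completion R (PIdl p)"

text \<open>Elements of the completion are handled through representatives: \<open>r n\<close>
  stands for its coset modulo \<open>p [^] n\<close>. In particular \<open>r 0\<close> carries no
  information.\<close>

definition coherent :: "(nat \<Rightarrow> 'a) \<Rightarrow> bool" where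
  "coherent r \<longleftrightarrow> (\<forall>n. r n \<in> carrier R) \<and> (\<forall>n. p [^] n divides (r (Suc n) \<ominus> r n))"

definition cls :: "(nat \<Rightarrow> 'a) \<Rightarrow> nat \<Rightarrow> 'a set" where
  "cls r n = PIdl (p [^] n) +> r n"

definition incl :: "'a \<Rightarrow> nat \<Rightarrow> 'a set" where
  "incl x = cls (\<lambda>_. x)"

lemma I_ideal: "ideal (PIdl (p [^] (n::nat))) R"
  using cgenideal_ideal by simp

lemma coherentD: "coherent r \<Longrightarrow> r n \<in> carrier R" "coherent r \<Longrightarrow> p [^] n divides (r (Suc n) \<ominus> r n)"
  unfolding coherent_def by auto

lemma coherent_const: "x \<in> carrier R \<Longrightarrow> coherent (\<lambda>_. x)"
  unfolding coherent_def by (simp add: r_neg a_minus_def divides_zero_r)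

lemma coherent_divides: "coherent r \<Longrightarrow> p [^] m divides (r (m + k) \<ominus> r m)"
  by (rule cauchy_divides) (auto dest: coherentD)

lemma coherent_ops:
  assumes "coherent r" "coherent s"
  shows "coherent (\<lambda>n. r n \<oplus> s n)" "coherent (\<lambda>n. r n \<otimes> s n)" "coherent (\<lambda>n. \<ominus> r n)"
proof -
  note c = coherentD[OF assms(1)] coherentD[OF assms(2)]
  have "p [^] n divides ((r (Suc n) \<ominus> r n) \<oplus> (s (Suc n) \<ominus> s n))" for n by (rule divides_sum) (use c in auto)
  moreover have "(r (Suc n) \<ominus> r n) \<oplus> (s (Suc n) \<ominus> s n) = (r (Suc n) \<oplus> s (Suc n)) \<ominus> (r n \<oplus> s n)" for n
    using c(1)[of n] c(1)[of "Suc n"] c(3)[of n] c(3)[of "Suc n"] by algebra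
  ultimately show "coherent (\<lambda>n. r n \<oplus> s n)" unfolding coherent_def using c by simp
  have "p [^] n divides ((r (Suc n) \<ominus> r n) \<otimes> s (Suc n) \<oplus> r n \<otimes> (s (Suc n) \<ominus> s n))" for n
    by (intro divides_sum divides_prod_r) (use c in auto)
  moreover have "(r (Suc n) \<ominus> r n) \<otimes> s (Suc n) \<oplus> r n \<otimes> (s (Suc n) \<ominus> s n)
      = (r (Suc n) \<otimes> s (Suc n)) \<ominus> (r n \<otimes> s n)" for n
    using c(1)[of n] c(1)[of "Suc n"] c(3)[of n] c(3)[of "Suc n"] by algebra
  ultimately show "coherent (\<lambda>n. r n \<otimes> s n)" unfolding coherent_def using c by simp
  have "p [^] n divides (\<ominus> (r (Suc n) \<ominus> r n))" for n by (rule divides_uminus) (use c in auto)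
  moreover have "\<ominus> (r (Suc n) \<ominus> r n) = \<ominus> r (Suc n) \<ominus> \<ominus> r n" for n
    using c(1)[of n] c(1)[of "Suc n"] by algebra
  ultimately show "coherent (\<lambda>n. \<ominus> r n)" unfolding coherent_def using c by simp
qed

lemma cls_eq_iff:
  assumes "\<And>n. r n \<in> carrier R" "\<And>n. s n \<in> carrier R"
  shows "cls r = cls s \<longleftrightarrow> (\<forall>n. p [^] n divides (r n \<ominus> s n))"
  using quotient_eq_iff_same_a_r_cos[OF I_ideal] assms mem_cgenideal_iff
  unfolding cls_def fun_eq_iff by simp

text \<open>A coset modulo \<open>p [^] Suc n\<close> is contained in one modulo
  \<open>p [^] n\<close> exactly if their representatives agree modulo
  \<open>p [^] n\<close>.\<close>

lemma carrier_S: "carrier S = cls ` {r. coherent r}"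
proof (intro equalityI subsetI)
  fix f assume "f \<in> carrier S"
  then have f: "\<And>n. f n \<in> carrier (R Quot PIdl (p [^] n))" "\<And>n. f (Suc n) \<subseteq> f n"
    unfolding adic_completion_def ideal_pow_cgenideal[OF p_closed] by auto
  have "\<exists>x. x \<in> carrier R \<and> f n = PIdl (p [^] n) +> x" for n
    using f(1)[of n] ideal.FactRing_carrier[OF I_ideal, of n] by auto
  then obtain r where r: "\<And>n. r n \<in> carrier R" "\<And>n. f n = PIdl (p [^] n) +> r n" by metis
  have "coherent r" unfolding coherent_def
  proof (intro conjI allI)
    fix n
    have "\<zero> \<in> PIdl (p [^] Suc n)" using additive_subgroup.zero_closed[OF ideal.axioms(1)[OF I_ideal]] .
    moreover have "r (Suc n) = \<zero> \<oplus> r (Suc n)" using r by simp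
    ultimately have "r (Suc n) \<in> f (Suc n)" unfolding r(2) a_r_coset_def' by blast
    then have "r (Suc n) \<in> f n" using f(2) by blast
    then obtain i where i: "i \<in> PIdl (p [^] n)" "r (Suc n) = i \<oplus> r n" unfolding r(2)[of n] a_r_coset_def' by blast
    then have "i \<in> carrier R" using ideal.Icarr[OF I_ideal] by blast
    then have "r (Suc n) \<ominus> r n = i" unfolding i(2) using r(1)[of n] by algebra
    then show "p [^] n divides (r (Suc n) \<ominus> r n)" using i(1) mem_cgenideal_iff by simp
  qed (rule r)
  moreover have "f = cls r" using r(2) unfolding cls_def fun_eq_iff by simp
  ultimately show "f \<in> cls ` {r. coherent r}" by blast
next
  fix f assume "f \<in> cls ` {r. coherent r}"
  then obtain r where r: "coherent r" "f = cls r" by blast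
  have "cls r (Suc n) \<subseteq> cls r n" for n
  proof
    fix x assume "x \<in> cls r (Suc n)"
    then obtain i where i: "i \<in> PIdl (p [^] Suc n)" "x = i \<oplus> r (Suc n)" unfolding cls_def a_r_coset_def' by blast
    have ic: "i \<in> carrier R" using i ideal.Icarr[OF I_ideal] by blast
    have "p [^] Suc n divides i" using i mem_cgenideal_iff by simp
    then have "p [^] n divides i" using divides_trans[OF divides_pow_mono[OF p_closed, of n "Suc n"]] by simp
    then have "p [^] n divides (i \<oplus> (r (Suc n) \<ominus> r n))" using coherentD(2)[OF r(1)] by (intro divides_sum) auto
    then have "i \<oplus> (r (Suc n) \<ominus> r n) \<in> PIdl (p [^] n)" using mem_cgenideal_iff by simp
    moreover have "x = (i \<oplus> (r (Suc n) \<ominus> r n)) \<oplus> r n"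
      unfolding i(2) using ic coherentD(1)[OF r(1), of n] coherentD(1)[OF r(1), of "Suc n"] by algebra
    ultimately show "x \<in> cls r n" unfolding cls_def a_r_coset_def' by blast
  qed
  moreover have "cls r n \<in> carrier (R Quot PIdl (p [^] n))" for n
    unfolding cls_def ideal.FactRing_carrier[OF I_ideal] using coherentD(1)[OF r(1)] by blast
  ultimately show "f \<in> carrier S"
    unfolding r(2) adic_completion_def ideal_pow_cgenideal[OF p_closed] by simp
qed

lemma S_repr:
  assumes "f \<in> carrier S" obtains r where "coherent r" "f = cls r"
  using assms unfolding carrier_S by blast

lemma cls_closed: "coherent r \<Longrightarrow> cls r \<in> carrier S"
  unfolding carrier_S by blast

lemma cls_ops:
  assumes "coherent r" "coherent s"
  shows "cls r \<oplus>\<^bsub>S\<^esub> cls s = cls (\<lambda>n. r n \<oplus> s n)" "cls r \<otimes>\<^bsub>S\<^esub> cls s = cls (\<lambda>n. r n \<otimes> s n)"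
  using coherentD(1)[OF assms(1)] coherentD(1)[OF assms(2)]
  unfolding adic_completion_def ideal_pow_cgenideal[OF p_closed] cls_def
  by (simp_all add: ideal.FactRing_ops[OF I_ideal])

lemma S_one: "\<one>\<^bsub>S\<^esub> = incl \<one>" and S_zero: "\<zero>\<^bsub>S\<^esub> = incl \<zero>"
  unfolding adic_completion_def ideal_pow_cgenideal[OF p_closed] cls_def incl_def
  by (simp_all add: ideal.FactRing_ops[OF I_ideal])

lemma completion_cring: "cring S"
proof (rule cringI)
  show "abelian_group S"
  proof (rule abelian_groupI)
    fix x y z assume "x \<in> carrier S" "y \<in> carrier S" "z \<in> carrier S"
    then obtain r s t where *: "coherent r" "coherent s" "coherent t" "x = cls r" "y = cls s" "z = cls t"
      by (metis S_repr)
    note c = *(1-3)[THEN coherentD(1)]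
    show "(x \<oplus>\<^bsub>S\<^esub> y) \<oplus>\<^bsub>S\<^esub> z = x \<oplus>\<^bsub>S\<^esub> (y \<oplus>\<^bsub>S\<^esub> z)"
      using * c by (simp add: cls_ops coherent_ops a_assoc)
  next
    fix x y assume "x \<in> carrier S" "y \<in> carrier S"
    then obtain r s where *: "coherent r" "coherent s" "x = cls r" "y = cls s" by (metis S_repr)
    note c = *(1-2)[THEN coherentD(1)]
    show "x \<oplus>\<^bsub>S\<^esub> y \<in> carrier S" using * by (simp add: cls_ops cls_closed coherent_ops)
    show "x \<oplus>\<^bsub>S\<^esub> y = y \<oplus>\<^bsub>S\<^esub> x" using * c by (simp add: cls_ops a_comm)
  next
    show "\<zero>\<^bsub>S\<^esub> \<in> carrier S" unfolding S_zero incl_def by (intro cls_closed coherent_const) simp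
  next
    fix x assume "x \<in> carrier S"
    then obtain r where *: "coherent r" "x = cls r" by (metis S_repr)
    note c = *(1)[THEN coherentD(1)]
    show "\<zero>\<^bsub>S\<^esub> \<oplus>\<^bsub>S\<^esub> x = x" unfolding S_zero incl_def using * c by (simp add: cls_ops coherent_const)
    have "cls (\<lambda>n. \<ominus> r n) \<oplus>\<^bsub>S\<^esub> x = \<zero>\<^bsub>S\<^esub>"
      unfolding S_zero incl_def using * c by (simp add: cls_ops coherent_ops l_neg)
    then show "\<exists>y\<in>carrier S. y \<oplus>\<^bsub>S\<^esub> x = \<zero>\<^bsub>S\<^esub>" using cls_closed coherent_ops(3)[OF *(1) *(1)] by blast
  qed
  show "comm_monoid S"
  proof (rule comm_monoidI)
    fix x y z assume "x \<in> carrier S" "y \<in> carrier S" "z \<in> carrier S"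
    then obtain r s t where *: "coherent r" "coherent s" "coherent t" "x = cls r" "y = cls s" "z = cls t"
      by (metis S_repr)
    note c = *(1-3)[THEN coherentD(1)]
    show "(x \<otimes>\<^bsub>S\<^esub> y) \<otimes>\<^bsub>S\<^esub> z = x \<otimes>\<^bsub>S\<^esub> (y \<otimes>\<^bsub>S\<^esub> z)"
      using * c by (simp add: cls_ops coherent_ops m_assoc)
  next
    fix x y assume "x \<in> carrier S" "y \<in> carrier S"
    then obtain r s where *: "coherent r" "coherent s" "x = cls r" "y = cls s" by (metis S_repr)
    note c = *(1-2)[THEN coherentD(1)]
    show "x \<otimes>\<^bsub>S\<^esub> y \<in> carrier S" using * by (simp add: cls_ops cls_closed coherent_ops)
    show "x \<otimes>\<^bsub>S\<^esub> y = y \<otimes>\<^bsub>S\<^esub> x" using * c by (simp add: cls_ops m_comm)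
  next
    show "\<one>\<^bsub>S\<^esub> \<in> carrier S" unfolding S_one incl_def by (intro cls_closed coherent_const) simp
  next
    fix x assume "x \<in> carrier S"
    then obtain r where *: "coherent r" "x = cls r" by (metis S_repr)
    note c = *(1)[THEN coherentD(1)]
    show "\<one>\<^bsub>S\<^esub> \<otimes>\<^bsub>S\<^esub> x = x" unfolding S_one incl_def using * c by (simp add: cls_ops coherent_const)
  qed
  fix x y z assume "x \<in> carrier S" "y \<in> carrier S" "z \<in> carrier S"
  then obtain r s t where *: "coherent r" "coherent s" "coherent t" "x = cls r" "y = cls s" "z = cls t"
    by (metis S_repr)
  note c = *(1-3)[THEN coherentD(1)]
  show "(x \<oplus>\<^bsub>S\<^esub> y) \<otimes>\<^bsub>S\<^esub> z = x \<otimes>\<^bsub>S\<^esub> z \<oplus>\<^bsub>S\<^esub> y \<otimes>\<^bsub>S\<^esub> z"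
    using * c by (simp add: cls_ops coherent_ops l_distr)
qed

interpretation S: cring S by (rule completion_cring)

lemma S_minus:
  assumes "coherent r" "coherent s"
  shows "cls r \<ominus>\<^bsub>S\<^esub> cls s = cls (\<lambda>n. r n \<ominus> s n)"
proof -
  note c = coherentD(1)[OF assms(1)] coherentD(1)[OF assms(2)]
  have "cls (\<lambda>n. \<ominus> s n) \<oplus>\<^bsub>S\<^esub> cls s = \<zero>\<^bsub>S\<^esub>"
    unfolding S_zero incl_def using assms c by (simp add: cls_ops coherent_ops l_neg)
  then have "\<ominus>\<^bsub>S\<^esub> cls s = cls (\<lambda>n. \<ominus> s n)"
    using assms cls_closed coherent_ops(3) S.minus_equality by metis
  then show ?thesis unfolding a_minus_def[of S] using assms c
    by (simp add: cls_ops coherent_ops a_minus_def)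
qed

lemma incl_closed: "x \<in> carrier R \<Longrightarrow> incl x \<in> carrier S"
  unfolding incl_def by (intro cls_closed coherent_const)

lemma incl_hom: "incl \<in> ring_hom R S"
  by (rule ring_hom_memI, auto simp: incl_closed S_one) (auto simp: incl_def cls_ops coherent_const)

lemma incl_pow: "x \<in> carrier R \<Longrightarrow> incl x [^]\<^bsub>S\<^esub> (n::nat) = incl (x [^] n)"
  by (induction n) (auto simp: S_one incl_def cls_ops coherent_const)

text \<open>If \<open>p [^] k\<close> divides \<open>r k\<close>, it divides all later terms, and
  the quotient is represented by \<open>r (k + n)\<close> divided by \<open>p [^] k\<close>. The
  index is shifted because division by \<open>p [^] k\<close> loses \<open>k\<close> levels of
  precision. If \<open>p [^] k = \<zero>\<close>, the later terms vanish and there is nothing to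
  cancel.\<close>

lemma divides_cls_iff:
  assumes r: "coherent r"
  shows "incl p [^]\<^bsub>S\<^esub> (k::nat) divides\<^bsub>S\<^esub> cls r \<longleftrightarrow> p [^] k divides (r k)"
proof
  assume "incl p [^]\<^bsub>S\<^esub> k divides\<^bsub>S\<^esub> cls r"
  then obtain s where s: "coherent s" "cls r = incl (p [^] k) \<otimes>\<^bsub>S\<^esub> cls s"
    unfolding factor_def incl_pow[OF p_closed] using S_repr by metis
  then have "cls r = cls (\<lambda>n. p [^] k \<otimes> s n)" by (simp add: incl_def cls_ops coherent_const)
  then have "p [^] k divides (r k \<ominus> p [^] k \<otimes> s k)"
    using cls_eq_iff[of r "\<lambda>n. p [^] k \<otimes> s n"] coherentD(1)[OF r] coherentD(1)[OF s(1)] by simp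
  then have "p [^] k divides ((r k \<ominus> p [^] k \<otimes> s k) \<oplus> p [^] k \<otimes> s k)"
    using coherentD(1)[OF s(1)] by (intro divides_sum) (auto simp: factor_def)
  moreover have "(r k \<ominus> p [^] k \<otimes> s k) \<oplus> p [^] k \<otimes> s k = r k"
    using coherentD(1)[OF s(1), of k] coherentD(1)[OF r, of k] nat_pow_closed[OF p_closed, of k] by algebra
  ultimately show "p [^] k divides (r k)" by simp
next
  assume k: "p [^] k divides (r k)"
  note rc = coherentD(1)[OF r]
  have rk: "p [^] k divides (r (k + n))" for n
  proof -
    have "p [^] k divides ((r (k + n) \<ominus> r k) \<oplus> r k)" using coherent_divides[OF r, of k n] k by (intro divides_sum) auto
    moreover have "(r (k + n) \<ominus> r k) \<oplus> r k = r (k + n)" using rc[of k] rc[of "k + n"] by algebra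
    ultimately show ?thesis by simp
  qed
  have "\<exists>t. coherent t \<and> (\<forall>n. r (k + n) = p [^] k \<otimes> t n)"
  proof (cases "p [^] k = \<zero>")
    case True
    then have "r (k + n) = p [^] k \<otimes> \<zero>" for n using rk[of n] by (auto simp: factor_def)
    then show ?thesis by (intro exI[of _ "\<lambda>_. \<zero>"]) (auto simp: coherent_const)
  next
    case False
    obtain t where t: "\<And>n. t n \<in> carrier R" "\<And>n. r (k + n) = p [^] k \<otimes> t n" using rk unfolding factor_def by metis
    have "p [^] n divides (t (Suc n) \<ominus> t n)" for n
    proof -
      have "p [^] (k + n) divides (r (k + Suc n) \<ominus> r (k + n))" using coherentD(2)[OF r, of "k + n"] by simp
      then obtain x where x: "x \<in> carrier R" "r (k + Suc n) \<ominus> r (k + n) = p [^] (k + n) \<otimes> x" unfolding factor_def by auto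
      have "p [^] k \<otimes> (t (Suc n) \<ominus> t n) = r (k + Suc n) \<ominus> r (k + n)"
        unfolding t(2) using t(1)[of n] t(1)[of "Suc n"] nat_pow_closed[OF p_closed, of k] by algebra
      also have "\<dots> = p [^] k \<otimes> (p [^] n \<otimes> x)" unfolding x(2) using x(1) by (simp add: nat_pow_mult[symmetric] m_assoc)
      finally have "t (Suc n) \<ominus> t n = p [^] n \<otimes> x" using False m_lcancel t(1) x(1) by simp
      then show ?thesis using x(1) unfolding factor_def by blast
    qed
    then show ?thesis using t unfolding coherent_def by blast
  qed
  then obtain t where t: "coherent t" "\<And>n. r (k + n) = p [^] k \<otimes> t n" by blast
  have "cls r = cls (\<lambda>n. p [^] k \<otimes> t n)"
  proof (subst cls_eq_iff)
    show "\<forall>n. p [^] n divides (r n \<ominus> p [^] k \<otimes> t n)"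
    proof
      fix n
      have "p [^] n divides (\<ominus> (r (n + k) \<ominus> r n))" by (intro divides_uminus coherent_divides r) simp
      moreover have "\<ominus> (r (n + k) \<ominus> r n) = r n \<ominus> r (k + n)" unfolding add.commute[of n k] using rc[of n] rc[of "k + n"] by algebra
      ultimately show "p [^] n divides (r n \<ominus> p [^] k \<otimes> t n)" using t(2) by simp
    qed
  qed (use rc coherentD(1)[OF t(1)] in auto)
  also have "\<dots> = incl p [^]\<^bsub>S\<^esub> k \<otimes>\<^bsub>S\<^esub> cls t" unfolding incl_pow[OF p_closed] using t(1) by (simp add: incl_def cls_ops coherent_const)
  finally show "incl p [^]\<^bsub>S\<^esub> k divides\<^bsub>S\<^esub> cls r" using cls_closed[OF t(1)] unfolding factor_def by blast
qed

lemma completion_adic: "adic S (incl p)"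
proof (rule S.adic_cauchyI)
  show "incl p \<in> carrier S" using incl_closed by simp
next
  fix x assume x: "x \<in> carrier S" "\<And>n::nat. incl p [^]\<^bsub>S\<^esub> n divides\<^bsub>S\<^esub> x"
  then obtain r where r: "coherent r" "x = cls r" using S_repr by blast
  then have "p [^] n divides (r n)" for n using x(2)[of n] divides_cls_iff[OF r(1), of n] by simp
  then show "x = \<zero>\<^bsub>S\<^esub>" unfolding r(2) S_zero incl_def
    using coherentD(1)[OF r(1)] by (subst cls_eq_iff) (auto simp: a_minus_def)
next
  fix s assume s: "\<And>n. s n \<in> carrier S" and step: "\<And>n::nat. incl p [^]\<^bsub>S\<^esub> n divides\<^bsub>S\<^esub> (s (Suc n) \<ominus>\<^bsub>S\<^esub> s n)"
  have "\<exists>r. coherent r \<and> s n = cls r" for n using s[of n] unfolding carrier_S by blast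
  then obtain r where r: "\<And>n. coherent (r n)" "\<And>n. s n = cls (r n)" by metis
  note rc = coherentD(1)[OF r(1)]
  \<comment> \<open>The diagonal represents the limit: from its \<open>n\<close>-th term on, the
    sequence is constant modulo \<open>p [^] n\<close>.\<close>
  have "coherent (\<lambda>n. r n n)" unfolding coherent_def
  proof (intro conjI allI)
    fix n
    have "incl p [^]\<^bsub>S\<^esub> n divides\<^bsub>S\<^esub> cls (\<lambda>k. r (Suc n) k \<ominus> r n k)" using step[of n] unfolding r(2) S_minus[OF r(1) r(1)] .
    moreover have "coherent (\<lambda>k. r (Suc n) k \<ominus> r n k)"
      using coherent_ops(1)[OF r(1) coherent_ops(3)[OF r(1) r(1)]] by (simp add: a_minus_def)
    ultimately have "p [^] n divides (r (Suc n) n \<ominus> r n n)" using divides_cls_iff by blast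
    then have "p [^] n divides ((r (Suc n) (Suc n) \<ominus> r (Suc n) n) \<oplus> (r (Suc n) n \<ominus> r n n))"
      using coherentD(2)[OF r(1), of n "Suc n"] by (intro divides_sum) auto
    moreover have "(r (Suc n) (Suc n) \<ominus> r (Suc n) n) \<oplus> (r (Suc n) n \<ominus> r n n) = r (Suc n) (Suc n) \<ominus> r n n"
      using rc[of "Suc n" "Suc n"] rc[of "Suc n" n] rc[of n n] by algebra
    ultimately show "p [^] n divides (r (Suc n) (Suc n) \<ominus> r n n)" by simp
  qed (rule rc)
  then have l: "coherent (\<lambda>n. r n n)" .
  have "incl p [^]\<^bsub>S\<^esub> n divides\<^bsub>S\<^esub> (cls (\<lambda>n. r n n) \<ominus>\<^bsub>S\<^esub> s n)" for n
  proof -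
    have "coherent (\<lambda>k. r k k \<ominus> r n k)"
      using coherent_ops(1)[OF l coherent_ops(3)[OF r(1) r(1)]] by (simp add: a_minus_def)
    then show ?thesis unfolding r(2) S_minus[OF l r(1)]
      by (subst divides_cls_iff) (use rc in \<open>auto simp: r_neg a_minus_def divides_zero_r\<close>)
  qed
  then show "\<exists>l\<in>carrier S. \<forall>n. incl p [^]\<^bsub>S\<^esub> n divides\<^bsub>S\<^esub> (l \<ominus>\<^bsub>S\<^esub> s n)" using cls_closed[OF l] by blast
qed

text \<open>\<open>R\<close> is dense in the completion: the \<open>k\<close>-th representative of
  \<open>f\<close> approximates it modulo the \<open>k\<close>-th power.\<close>

lemma completion_gen_pow:
  assumes "f \<in> carrier S"
  obtains a where "a \<in> carrier R" "incl p [^]\<^bsub>S\<^esub> (k::nat) divides\<^bsub>S\<^esub> (f \<ominus>\<^bsub>S\<^esub> incl a)"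
proof -
  obtain r where r: "coherent r" "f = cls r" using assms S_repr by blast
  have rc: "r k \<in> carrier R" using coherentD(1)[OF r(1)] .
  have "coherent (\<lambda>n. r n \<ominus> r k)"
    using coherent_ops(1)[OF r(1) coherent_ops(3)[OF coherent_const coherent_const]] rc by (simp add: a_minus_def)
  then have "incl p [^]\<^bsub>S\<^esub> k divides\<^bsub>S\<^esub> cls (\<lambda>n. r n \<ominus> r k)"
    by (subst divides_cls_iff) (use rc in \<open>auto simp: r_neg a_minus_def divides_zero_r\<close>)
  then have "incl p [^]\<^bsub>S\<^esub> k divides\<^bsub>S\<^esub> (f \<ominus>\<^bsub>S\<^esub> incl (r k))"
    unfolding r(2) S_minus[OF r(1) coherent_const[OF rc]] incl_def[of "r k"] .
  then show thesis using that rc by blast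
qed

lemma completion_gen:
  assumes "f \<in> carrier S"
  obtains a where "a \<in> carrier R" "incl p divides\<^bsub>S\<^esub> (f \<ominus>\<^bsub>S\<^esub> incl a)"
proof -
  obtain a where a: "a \<in> carrier R" "incl p [^]\<^bsub>S\<^esub> (1::nat) divides\<^bsub>S\<^esub> (f \<ominus>\<^bsub>S\<^esub> incl a)"
    using completion_gen_pow[OF assms] .
  have "incl p [^]\<^bsub>S\<^esub> (1::nat) = incl p" unfolding incl_pow[OF p_closed] by simp
  then show thesis using that a by simp
qed

lemma p_not_unit: "\<not> p divides \<one>"
proof
  assume "p divides \<one>"
  then have "\<one> \<in> PIdl p" using mem_cgenideal_iff by simp
  then have "PIdl p = carrier R" using ideal.one_imp_carrier[OF cgenideal_ideal[OF p_closed]] by blast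
  then show False using maximalideal.I_notcarr[OF maximal] by blast
qed

lemma invertible_mod_p:
  assumes a: "a \<in> carrier R" "\<not> p divides a"
  obtains b c where "b \<in> carrier R" "c \<in> carrier R" "a \<otimes> b \<oplus> p \<otimes> c = \<one>"
proof -
  have id: "ideal (PIdl a <+> PIdl p) R" by (intro add_ideals cgenideal_ideal a) simp
  have "PIdl p \<subseteq> PIdl a <+> PIdl p"
  proof
    fix x assume x: "x \<in> PIdl p"
    then have "x = \<zero> \<oplus> x" using ideal.Icarr[OF cgenideal_ideal[OF p_closed]] by simp
    moreover have "\<zero> \<in> PIdl a" using additive_subgroup.zero_closed[OF ideal.axioms(1)[OF cgenideal_ideal[OF a(1)]]] .
    ultimately show "x \<in> PIdl a <+> PIdl p" using x unfolding set_add_def' by blast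
  qed
  moreover have "a \<in> PIdl a <+> PIdl p"
  proof -
    have "a = a \<oplus> \<zero>" using a by simp
    moreover have "\<zero> \<in> PIdl p" using additive_subgroup.zero_closed[OF ideal.axioms(1)[OF cgenideal_ideal[OF p_closed]]] .
    ultimately show ?thesis using cgenideal_self[OF a(1)] unfolding set_add_def' by blast
  qed
  moreover have "a \<notin> PIdl p" using a mem_cgenideal_iff by simp
  ultimately have "PIdl a <+> PIdl p = carrier R"
    using maximalideal.I_maximal[OF maximal id] ideal.Icarr[OF id] by blast
  then have "\<one> \<in> PIdl a <+> PIdl p" by simp
  then obtain x y where "x \<in> PIdl a" "y \<in> PIdl p" "\<one> = x \<oplus> y" unfolding set_add_def' by blast
  then obtain b c where "b \<in> carrier R" "c \<in> carrier R" "\<one> = b \<otimes> a \<oplus> c \<otimes> p" unfolding cgenideal_def by blast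
  then show thesis using that a m_comm p_closed by metis
qed

lemma completion_p_nonunit:
  assumes "f \<in> carrier S" shows "incl p \<otimes>\<^bsub>S\<^esub> f \<noteq> \<one>\<^bsub>S\<^esub>"
proof
  assume "incl p \<otimes>\<^bsub>S\<^esub> f = \<one>\<^bsub>S\<^esub>"
  then have "incl p [^]\<^bsub>S\<^esub> (1::nat) divides\<^bsub>S\<^esub> cls (\<lambda>_. \<one>)"
    using assms incl_pow[OF p_closed, of 1] unfolding factor_def S_one incl_def[of \<one>]
    by (metis One_nat_def l_one nat_pow_0 nat_pow_Suc p_closed)
  then show False using divides_cls_iff[OF coherent_const[OF one_closed], of 1] p_not_unit by simp
qed

text \<open>By separatedness there is a largest power of \<open>p\<close> dividing \<open>f\<close>.
  The cofactor \<open>u\<close> agrees modulo \<open>p\<close> with an \<open>a\<close> from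
  \<open>R\<close> outside the maximal ideal; \<open>a\<close> is invertible modulo
  \<open>p\<close>, and units lift by completeness.\<close>

lemma completion_valuation:
  assumes f: "f \<in> carrier S" "f \<noteq> \<zero>\<^bsub>S\<^esub>"
  shows "\<exists>(k::nat) u v. u \<in> carrier S \<and> v \<in> carrier S \<and> u \<otimes>\<^bsub>S\<^esub> v = \<one>\<^bsub>S\<^esub> \<and> f = incl p [^]\<^bsub>S\<^esub> k \<otimes>\<^bsub>S\<^esub> u"
proof -
  interpret A: adic S "incl p" by (rule completion_adic)
  define P where "P n \<longleftrightarrow> \<not> incl p [^]\<^bsub>S\<^esub> n divides\<^bsub>S\<^esub> f" for n :: nat
  have "\<exists>n. P n" using A.separated[OF f(1)] f(2) unfolding P_def by blast
  then have L: "P (LEAST n. P n)" by (rule LeastI_ex)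
  moreover have "\<not> P 0" unfolding P_def using f(1) by (auto simp: factor_def)
  ultimately obtain k where k: "(LEAST n. P n) = Suc k" by (cases "LEAST n. P n") auto
  then have "\<not> P k" using not_less_Least[of k P] by simp
  then obtain u where u: "u \<in> carrier S" "f = incl p [^]\<^bsub>S\<^esub> k \<otimes>\<^bsub>S\<^esub> u" unfolding P_def factor_def by blast
  have nu: "\<not> incl p divides\<^bsub>S\<^esub> u"
  proof
    assume "incl p divides\<^bsub>S\<^esub> u"
    then obtain x where x: "x \<in> carrier S" "u = incl p \<otimes>\<^bsub>S\<^esub> x" unfolding factor_def by blast
    then have "f = incl p [^]\<^bsub>S\<^esub> Suc k \<otimes>\<^bsub>S\<^esub> x" using u(2) by (simp add: S.m_assoc)
    then have "\<not> P (Suc k)" using x(1) unfolding P_def factor_def by blast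
    then show False using L k by simp
  qed
  obtain a where a: "a \<in> carrier R" "incl p divides\<^bsub>S\<^esub> (u \<ominus>\<^bsub>S\<^esub> incl a)" using completion_gen[OF u(1)] .
  note ic = incl_closed[OF a(1)] incl_closed[OF p_closed]
  have "\<not> p divides a"
  proof
    assume "p divides a"
    then obtain x where x: "x \<in> carrier R" "a = p \<otimes> x" unfolding factor_def by blast
    then have "incl p divides\<^bsub>S\<^esub> incl a" using incl_closed[OF x(1)] ring_hom_mult[OF incl_hom p_closed x(1)] unfolding factor_def by blast
    then have "incl p divides\<^bsub>S\<^esub> ((u \<ominus>\<^bsub>S\<^esub> incl a) \<oplus>\<^bsub>S\<^esub> incl a)" using a by (intro S.divides_sum ic)
    moreover have "(u \<ominus>\<^bsub>S\<^esub> incl a) \<oplus>\<^bsub>S\<^esub> incl a = u" using u(1) ic by (simp add: a_minus_def S.a_assoc S.l_neg)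
    ultimately show False using nu by simp
  qed
  from invertible_mod_p[OF a(1) this]
  obtain b c where b: "b \<in> carrier R" "c \<in> carrier R" "a \<otimes> b \<oplus> p \<otimes> c = \<one>" .
  note ic = ic incl_closed[OF b(1)] incl_closed[OF b(2)]
  have one: "\<one>\<^bsub>S\<^esub> = incl a \<otimes>\<^bsub>S\<^esub> incl b \<oplus>\<^bsub>S\<^esub> incl p \<otimes>\<^bsub>S\<^esub> incl c"
    using b a(1) by (simp add: S_one ring_hom_mult[OF incl_hom, symmetric] ring_hom_add[OF incl_hom, symmetric])
  have "\<one>\<^bsub>S\<^esub> \<ominus>\<^bsub>S\<^esub> u \<otimes>\<^bsub>S\<^esub> incl b = incl p \<otimes>\<^bsub>S\<^esub> incl c \<ominus>\<^bsub>S\<^esub> (u \<ominus>\<^bsub>S\<^esub> incl a) \<otimes>\<^bsub>S\<^esub> incl b"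
    unfolding one using ic u(1) by algebra
  moreover have "incl p divides\<^bsub>S\<^esub> (incl p \<otimes>\<^bsub>S\<^esub> incl c \<ominus>\<^bsub>S\<^esub> (u \<ominus>\<^bsub>S\<^esub> incl a) \<otimes>\<^bsub>S\<^esub> incl b)"
    by (rule S.divides_diff) (use ic a S.divides_prod_r in \<open>auto simp: factor_def\<close>)
  ultimately have "u \<in> Units S" using A.unit_modI[of u "incl b"] u(1) ic by simp
  then obtain v where "v \<in> carrier S" "u \<otimes>\<^bsub>S\<^esub> v = \<one>\<^bsub>S\<^esub>" using S.Units_r_inv_ex by blast
  then show ?thesis using u by (intro exI[of _ k] exI[of _ u] exI[of _ v] conjI)
qed

text \<open>Two nonzero elements with product zero would make a power \<open>p [^] (k + l)\<close>
  zero in the completion, hence divisible in \<open>R\<close> by the next power. Cancelling makes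
  \<open>p\<close> a unit; and if that power is zero in \<open>R\<close>, one of
  \<open>p [^] k\<close> and \<open>p [^] l\<close> vanishes, and with it \<open>f\<close> or
  \<open>g\<close>.\<close>

lemma completion_domain: "domain S"
proof (intro domain.intro domain_axioms.intro completion_cring)
  show "\<one>\<^bsub>S\<^esub> \<noteq> \<zero>\<^bsub>S\<^esub>"
    using completion_p_nonunit[OF S.zero_closed] incl_closed[OF p_closed] by (simp add: S.r_null)
  fix f g assume fg: "f \<otimes>\<^bsub>S\<^esub> g = \<zero>\<^bsub>S\<^esub>" "f \<in> carrier S" "g \<in> carrier S"
  show "f = \<zero>\<^bsub>S\<^esub> \<or> g = \<zero>\<^bsub>S\<^esub>"
  proof (rule ccontr)
    assume "\<not> ?thesis"
    then have ne: "f \<noteq> \<zero>\<^bsub>S\<^esub>" "g \<noteq> \<zero>\<^bsub>S\<^esub>" by auto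
    obtain k :: nat and u v where f: "u \<in> carrier S" "v \<in> carrier S" "u \<otimes>\<^bsub>S\<^esub> v = \<one>\<^bsub>S\<^esub>" "f = incl p [^]\<^bsub>S\<^esub> k \<otimes>\<^bsub>S\<^esub> u"
      using completion_valuation[OF fg(2) ne(1)] by blast
    obtain l :: nat and u' v' where g: "u' \<in> carrier S" "v' \<in> carrier S" "u' \<otimes>\<^bsub>S\<^esub> v' = \<one>\<^bsub>S\<^esub>" "g = incl p [^]\<^bsub>S\<^esub> l \<otimes>\<^bsub>S\<^esub> u'"
      using completion_valuation[OF fg(3) ne(2)] by blast
    let ?q = "incl p"
    have qc: "?q [^]\<^bsub>S\<^esub> k \<in> carrier S" "?q [^]\<^bsub>S\<^esub> l \<in> carrier S" using incl_closed by auto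
    have "f \<otimes>\<^bsub>S\<^esub> g \<otimes>\<^bsub>S\<^esub> (v \<otimes>\<^bsub>S\<^esub> v') = ?q [^]\<^bsub>S\<^esub> k \<otimes>\<^bsub>S\<^esub> ?q [^]\<^bsub>S\<^esub> l \<otimes>\<^bsub>S\<^esub> ((u \<otimes>\<^bsub>S\<^esub> v) \<otimes>\<^bsub>S\<^esub> (u' \<otimes>\<^bsub>S\<^esub> v'))"
      unfolding f(4) g(4) using f(1,2) g(1,2) qc by (simp add: S.m_ac)
    then have "?q [^]\<^bsub>S\<^esub> (k + l) = \<zero>\<^bsub>S\<^esub>"
      unfolding fg(1) f(3) g(3) using f(1,2) g(1,2) qc incl_closed[OF p_closed] by (simp add: S.nat_pow_mult)
    then have z: "cls (\<lambda>_. p [^] (k + l)) = cls (\<lambda>_. \<zero>)" using incl_pow[OF p_closed, of "k + l"] unfolding S_zero incl_def by simp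
    have "p [^] Suc (k + l) divides (p [^] (k + l) \<ominus> \<zero>)"
      using z cls_eq_iff[of "\<lambda>_. p [^] (k + l)" "\<lambda>_. \<zero>"] by (metis nat_pow_closed p_closed zero_closed)
    then obtain x where x: "x \<in> carrier R" "p [^] (k + l) = p [^] (k + l) \<otimes> (p \<otimes> x)"
      unfolding factor_def by (auto simp: a_minus_def m_assoc)
    show False
    proof (cases "p [^] (k + l) = \<zero>")
      case False
      then have "\<one> = p \<otimes> x" using x m_lcancel[of "p [^] (k + l)" \<one> "p \<otimes> x"] by simp
      then show False using x(1) p_not_unit unfolding factor_def by blast
    next
      case True
      then have "p [^] k \<otimes> p [^] l = \<zero>" by (simp add: nat_pow_mult)
      then have "p [^] k = \<zero> \<or> p [^] l = \<zero>" using integral by simp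
      then have "?q [^]\<^bsub>S\<^esub> k = \<zero>\<^bsub>S\<^esub> \<or> ?q [^]\<^bsub>S\<^esub> l = \<zero>\<^bsub>S\<^esub>" unfolding incl_pow[OF p_closed] S_zero by auto
      then show False using ne f g by auto
    qed
  qed
qed

end

section \<open>Power series and their evaluation\<close>

definition fps_shift :: "(nat \<Rightarrow> 'a) \<Rightarrow> nat \<Rightarrow> 'a" where
  "fps_shift f n = f (Suc n)"

definition fps_scalar :: "('a, 'b) ring_scheme \<Rightarrow> 'a \<Rightarrow> nat \<Rightarrow> 'a" where
  "fps_scalar R c n = (if n = 0 then c else \<zero>\<^bsub>R\<^esub>)"

definition fps_var :: "('a, 'b) ring_scheme \<Rightarrow> nat \<Rightarrow> 'a" where
  "fps_var R n = (if n = 1 then \<one>\<^bsub>R\<^esub> else \<zero>\<^bsub>R\<^esub>)"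

context cring
begin

abbreviation "F \<equiv> fps_ring R"

lemma fps_carrier: "f \<in> carrier F \<longleftrightarrow> (\<forall>n. f n \<in> carrier R)"
  unfolding fps_ring_def by simp

lemma fps_coeff_closed: "f \<in> carrier F \<Longrightarrow> f n \<in> carrier R"
  unfolding fps_carrier by simp

lemma fps_shift_closed: "f \<in> carrier F \<Longrightarrow> fps_shift f \<in> carrier F"
  unfolding fps_carrier fps_shift_def by simp

lemma fps_scalar_closed: "c \<in> carrier R \<Longrightarrow> fps_scalar R c \<in> carrier F"
  unfolding fps_carrier fps_scalar_def by simp

lemma fps_var_closed: "fps_var R \<in> carrier F"
  unfolding fps_carrier fps_var_def by simp

lemma fps_add: "(f \<oplus>\<^bsub>F\<^esub> g) n = f n \<oplus> g n"
  unfolding fps_ring_def by simp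

lemma fps_zero: "\<zero>\<^bsub>F\<^esub> n = \<zero>"
  unfolding fps_ring_def by simp

lemma fps_one: "\<one>\<^bsub>F\<^esub> = fps_scalar R \<one>"
  unfolding fps_ring_def fps_scalar_def by auto

lemma fps_mult: "(f \<otimes>\<^bsub>F\<^esub> g) n = (\<Oplus>i\<in>{..n}. f i \<otimes> g (n - i))"
  unfolding fps_ring_def by simp

lemma fps_mult_0:
  assumes "f \<in> carrier F" "g \<in> carrier F"
  shows "(f \<otimes>\<^bsub>F\<^esub> g) 0 = f 0 \<otimes> g 0"
  using assms unfolding fps_mult fps_carrier by simp

lemma fps_mult_Suc:
  assumes "f \<in> carrier F" "g \<in> carrier F"
  shows "(f \<otimes>\<^bsub>F\<^esub> g) (Suc n) = f 0 \<otimes> g (Suc n) \<oplus> (fps_shift f \<otimes>\<^bsub>F\<^esub> g) n"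
proof -
  have "(f \<otimes>\<^bsub>F\<^esub> g) (Suc n) = (\<Oplus>i\<in>{..n}. f (Suc i) \<otimes> g (Suc n - Suc i)) \<oplus> f 0 \<otimes> g (Suc n - 0)"
    unfolding fps_mult by (rule finsum_Suc2) (use assms in \<open>auto simp: fps_carrier\<close>)
  also have "(\<Oplus>i\<in>{..n}. f (Suc i) \<otimes> g (Suc n - Suc i)) = (fps_shift f \<otimes>\<^bsub>F\<^esub> g) n"
    unfolding fps_mult fps_shift_def by simp
  finally show ?thesis using assms unfolding fps_mult fps_carrier fps_shift_def by (simp add: a_comm finsum_closed)
qed

lemma fps_mult_Suc':
  assumes "f \<in> carrier F" "g \<in> carrier F"
  shows "(f \<otimes>\<^bsub>F\<^esub> g) (Suc n) = f (Suc n) \<otimes> g 0 \<oplus> (f \<otimes>\<^bsub>F\<^esub> fps_shift g) n"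
proof -
  have "(f \<otimes>\<^bsub>F\<^esub> g) (Suc n) = f (Suc n) \<otimes> g (Suc n - Suc n) \<oplus> (\<Oplus>i\<in>{..n}. f i \<otimes> g (Suc n - i))"
    unfolding fps_mult by (rule finsum_Suc) (use assms in \<open>auto simp: fps_carrier\<close>)
  also have "(\<Oplus>i\<in>{..n}. f i \<otimes> g (Suc n - i)) = (f \<otimes>\<^bsub>F\<^esub> fps_shift g) n"
    unfolding fps_mult fps_shift_def
    by (rule finsum_cong') (use assms in \<open>auto simp: fps_carrier Suc_diff_le\<close>)
  finally show ?thesis by simp
qed

lemma fps_mult_closed:
  assumes "f \<in> carrier F" "g \<in> carrier F" shows "f \<otimes>\<^bsub>F\<^esub> g \<in> carrier F"
  using assms unfolding fps_carrier fps_mult by (auto intro!: finsum_closed)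

lemma fps_add_closed:
  assumes "f \<in> carrier F" "g \<in> carrier F" shows "f \<oplus>\<^bsub>F\<^esub> g \<in> carrier F"
  using assms unfolding fps_carrier fps_add by auto

text \<open>\<open>fps_mult_Suc\<close> peels off the constant term of the first factor,
  \<open>fps_mult_Suc'\<close> that of the second. Induction on the coefficient index matches the
  two without reindexing a sum.\<close>

lemma fps_mult_comm:
  assumes "f \<in> carrier F" "g \<in> carrier F" shows "f \<otimes>\<^bsub>F\<^esub> g = g \<otimes>\<^bsub>F\<^esub> f"
proof
  fix n show "(f \<otimes>\<^bsub>F\<^esub> g) n = (g \<otimes>\<^bsub>F\<^esub> f) n" using assms
  proof (induction n arbitrary: f g)
    case 0
    then show ?case by (simp add: fps_mult_0 m_comm fps_coeff_closed)
  next
    case (Suc n)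
    have "(f \<otimes>\<^bsub>F\<^esub> g) (Suc n) = f 0 \<otimes> g (Suc n) \<oplus> (fps_shift f \<otimes>\<^bsub>F\<^esub> g) n"
      using Suc.prems by (rule fps_mult_Suc)
    also have "(fps_shift f \<otimes>\<^bsub>F\<^esub> g) n = (g \<otimes>\<^bsub>F\<^esub> fps_shift f) n"
      using Suc fps_shift_closed by blast
    also have "f 0 \<otimes> g (Suc n) = g (Suc n) \<otimes> f 0" using Suc.prems by (simp add: m_comm fps_coeff_closed)
    finally show ?case using fps_mult_Suc'[OF Suc.prems(2,1)] by simp
  qed
qed

lemma fps_shift_mult:
  assumes "f \<in> carrier F" "g \<in> carrier F"
  shows "fps_shift (f \<otimes>\<^bsub>F\<^esub> g) = (\<lambda>n. f 0 \<otimes> g (Suc n)) \<oplus>\<^bsub>F\<^esub> (fps_shift f \<otimes>\<^bsub>F\<^esub> g)"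
  by (rule ext) (simp add: fps_shift_def[of "f \<otimes>\<^bsub>F\<^esub> g"] fps_add fps_mult_Suc[OF assms])

lemma fps_mult_scaled:
  assumes "f \<in> carrier F" "g \<in> carrier F" "c \<in> carrier R"
  shows "((\<lambda>n. c \<otimes> f n) \<otimes>\<^bsub>F\<^esub> g) n = c \<otimes> (f \<otimes>\<^bsub>F\<^esub> g) n"
proof -
  have "c \<otimes> (f \<otimes>\<^bsub>F\<^esub> g) n = (\<Oplus>i\<in>{..n}. c \<otimes> (f i \<otimes> g (n - i)))"
    unfolding fps_mult by (rule finsum_rdistr) (use assms in \<open>auto simp: fps_carrier\<close>)
  also have "\<dots> = (\<Oplus>i\<in>{..n}. c \<otimes> f i \<otimes> g (n - i))"
    by (rule finsum_cong') (use assms in \<open>auto simp: fps_carrier m_assoc\<close>)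
  finally show ?thesis unfolding fps_mult ..
qed

lemma fps_mult_distr:
  assumes "f \<in> carrier F" "g \<in> carrier F" "h \<in> carrier F"
  shows "((f \<oplus>\<^bsub>F\<^esub> g) \<otimes>\<^bsub>F\<^esub> h) n = (f \<otimes>\<^bsub>F\<^esub> h) n \<oplus> (g \<otimes>\<^bsub>F\<^esub> h) n"
proof -
  have "((f \<oplus>\<^bsub>F\<^esub> g) \<otimes>\<^bsub>F\<^esub> h) n = (\<Oplus>i\<in>{..n}. f i \<otimes> h (n - i) \<oplus> g i \<otimes> h (n - i))"
    unfolding fps_mult fps_add by (rule finsum_cong') (use assms in \<open>auto simp: fps_carrier l_distr\<close>)
  also have "\<dots> = (f \<otimes>\<^bsub>F\<^esub> h) n \<oplus> (g \<otimes>\<^bsub>F\<^esub> h) n"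
    unfolding fps_mult by (rule finsum_addf) (use assms in \<open>auto simp: fps_carrier\<close>)
  finally show ?thesis .
qed

text \<open>Peeling constant terms again replaces the exchange of a double sum.\<close>

lemma fps_mult_assoc:
  assumes "f \<in> carrier F" "g \<in> carrier F" "h \<in> carrier F"
  shows "(f \<otimes>\<^bsub>F\<^esub> g) \<otimes>\<^bsub>F\<^esub> h = f \<otimes>\<^bsub>F\<^esub> (g \<otimes>\<^bsub>F\<^esub> h)"
proof
  fix n show "((f \<otimes>\<^bsub>F\<^esub> g) \<otimes>\<^bsub>F\<^esub> h) n = (f \<otimes>\<^bsub>F\<^esub> (g \<otimes>\<^bsub>F\<^esub> h)) n" using assms
  proof (induction n arbitrary: f g h)
    case 0
    then show ?case by (simp add: fps_mult_0 fps_mult_closed m_assoc fps_coeff_closed)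
  next
    case (Suc n)
    note [simp] = fps_mult_closed fps_shift_closed fps_coeff_closed
    have g0: "(\<lambda>n. f 0 \<otimes> g (Suc n)) = (\<lambda>n. f 0 \<otimes> fps_shift g n)" unfolding fps_shift_def ..
    have sc: "(\<lambda>n. f 0 \<otimes> fps_shift g n) \<in> carrier F" using Suc.prems unfolding fps_carrier fps_shift_def by simp
    have "((f \<otimes>\<^bsub>F\<^esub> g) \<otimes>\<^bsub>F\<^esub> h) (Suc n)
        = (f 0 \<otimes> g 0) \<otimes> h (Suc n) \<oplus> (fps_shift (f \<otimes>\<^bsub>F\<^esub> g) \<otimes>\<^bsub>F\<^esub> h) n"
      using Suc.prems by (simp add: fps_mult_Suc fps_mult_0)
    also have "(fps_shift (f \<otimes>\<^bsub>F\<^esub> g) \<otimes>\<^bsub>F\<^esub> h) n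
        = f 0 \<otimes> (fps_shift g \<otimes>\<^bsub>F\<^esub> h) n \<oplus> (fps_shift f \<otimes>\<^bsub>F\<^esub> (g \<otimes>\<^bsub>F\<^esub> h)) n"
      unfolding fps_shift_mult[OF Suc.prems(1,2)] g0 using Suc.prems sc
      by (simp add: fps_mult_distr fps_mult_scaled Suc.IH)
    finally have "((f \<otimes>\<^bsub>F\<^esub> g) \<otimes>\<^bsub>F\<^esub> h) (Suc n) = f 0 \<otimes> (g 0 \<otimes> h (Suc n) \<oplus> (fps_shift g \<otimes>\<^bsub>F\<^esub> h) n)
        \<oplus> (fps_shift f \<otimes>\<^bsub>F\<^esub> (g \<otimes>\<^bsub>F\<^esub> h)) n"
      using Suc.prems by (simp add: r_distr m_assoc a_assoc)
    then show ?case using Suc.prems by (simp add: fps_mult_Suc)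
  qed
qed

lemma fps_scalar_mult:
  assumes "f \<in> carrier F" "c \<in> carrier R"
  shows "fps_scalar R c \<otimes>\<^bsub>F\<^esub> f = (\<lambda>n. c \<otimes> f n)"
proof
  fix n
  have z: "(fps_shift (fps_scalar R c) \<otimes>\<^bsub>F\<^esub> f) k = \<zero>" for k
  proof -
    have "(fps_shift (fps_scalar R c) \<otimes>\<^bsub>F\<^esub> f) k = (\<Oplus>i\<in>{..k}. \<zero>)" unfolding fps_mult
      by (rule finsum_cong') (use assms in \<open>auto simp: fps_carrier fps_shift_def fps_scalar_def\<close>)
    then show ?thesis by simp
  qed
  show "(fps_scalar R c \<otimes>\<^bsub>F\<^esub> f) n = c \<otimes> f n"
    using assms z by (cases n) (auto simp: fps_mult_0 fps_mult_Suc fps_scalar_closed fps_coeff_closed fps_scalar_def)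
qed

lemma fps_cring: "cring F"
proof (rule cringI)
  show "abelian_group F"
  proof (rule abelian_groupI)
    fix f assume f: "f \<in> carrier F"
    have "(\<lambda>n. \<ominus> f n) \<in> carrier F" using f unfolding fps_carrier by simp
    moreover have "(\<lambda>n. \<ominus> f n) \<oplus>\<^bsub>F\<^esub> f = \<zero>\<^bsub>F\<^esub>"
      using f by (intro ext) (simp add: fps_add fps_zero fps_coeff_closed l_neg)
    ultimately show "\<exists>g\<in>carrier F. g \<oplus>\<^bsub>F\<^esub> f = \<zero>\<^bsub>F\<^esub>" by blast
  qed (auto simp: fps_carrier fps_add fps_zero fun_eq_iff a_ac)
  show "comm_monoid F"
  proof (rule comm_monoidI)
    show "\<one>\<^bsub>F\<^esub> \<in> carrier F" unfolding fps_one by (simp add: fps_scalar_closed)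
    show "\<one>\<^bsub>F\<^esub> \<otimes>\<^bsub>F\<^esub> f = f" if "f \<in> carrier F" for f
      unfolding fps_one using that by (simp add: fps_scalar_mult fps_coeff_closed)
  qed (erule (1) fps_mult_closed, erule (2) fps_mult_assoc, erule (1) fps_mult_comm)
  show "(f \<oplus>\<^bsub>F\<^esub> g) \<otimes>\<^bsub>F\<^esub> h = f \<otimes>\<^bsub>F\<^esub> h \<oplus>\<^bsub>F\<^esub> g \<otimes>\<^bsub>F\<^esub> h"
    if "f \<in> carrier F" "g \<in> carrier F" "h \<in> carrier F" for f g h
    by (rule ext) (simp add: fps_mult_distr[OF that] fps_add)
qed

lemma fps_var_mult:
  assumes "f \<in> carrier F"
  shows "(fps_var R \<otimes>\<^bsub>F\<^esub> f) 0 = \<zero>" "(fps_var R \<otimes>\<^bsub>F\<^esub> f) (Suc n) = f n"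
proof -
  have s: "fps_shift (fps_var R) = fps_scalar R \<one>" unfolding fps_shift_def fps_scalar_def fps_var_def by auto
  show "(fps_var R \<otimes>\<^bsub>F\<^esub> f) 0 = \<zero>"
    using assms by (simp add: fps_mult_0 fps_var_closed fps_coeff_closed fps_var_def)
  show "(fps_var R \<otimes>\<^bsub>F\<^esub> f) (Suc n) = f n"
    using assms by (simp add: fps_mult_Suc fps_var_closed s fps_scalar_mult fps_coeff_closed) (simp add: fps_var_def fps_coeff_closed)
qed

lemma fps_decompose:
  assumes "f \<in> carrier F"
  shows "f = fps_scalar R (f 0) \<oplus>\<^bsub>F\<^esub> fps_var R \<otimes>\<^bsub>F\<^esub> fps_shift f"
proof
  fix n show "f n = (fps_scalar R (f 0) \<oplus>\<^bsub>F\<^esub> fps_var R \<otimes>\<^bsub>F\<^esub> fps_shift f) n"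
    using assms fps_coeff_closed[OF assms]
    by (cases n) (auto simp: fps_add fps_var_mult fps_shift_closed fps_scalar_def, simp add: fps_shift_def)
qed

lemma fps_scalar_hom: "fps_scalar R \<in> ring_hom R F"
proof (rule ring_hom_memI)
  fix x y assume "x \<in> carrier R" "y \<in> carrier R"
  then show "fps_scalar R (x \<otimes> y) = fps_scalar R x \<otimes>\<^bsub>F\<^esub> fps_scalar R y"
    by (intro ext) (simp add: fps_scalar_mult fps_scalar_closed, simp add: fps_scalar_def)
  from \<open>x \<in> _\<close> \<open>y \<in> _\<close> show "fps_scalar R (x \<oplus> y) = fps_scalar R x \<oplus>\<^bsub>F\<^esub> fps_scalar R y"
    by (intro ext) (simp add: fps_add, simp add: fps_scalar_def)
qed (simp_all add: fps_scalar_closed fps_one)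

lemma fps_horner:
  assumes d: "\<And>j::nat. d j \<in> carrier F"
  shows "\<exists>e. (\<forall>j. e j \<in> carrier F) \<and> (\<forall>j. e j = d j \<oplus>\<^bsub>F\<^esub> fps_var R \<otimes>\<^bsub>F\<^esub> e (Suc j))"
proof -
  \<comment> \<open>\<open>E n j\<close> is the coefficient with index \<open>n\<close> of the tail
    \<open>e j\<close>: the sum of \<open>d (j + i) (n - i)\<close> over \<open>i \<le> n\<close>.
    It is finite because each factor of the variable lowers the index by one.\<close>
  define E where "E n = rec_nat (\<lambda>j. d j 0) (\<lambda>n t j. d j (Suc n) \<oplus> t (Suc j)) n" for n
  have E0: "E 0 j = d j 0" and ES: "E (Suc n) j = d j (Suc n) \<oplus> E n (Suc j)" for j n by (simp_all add: E_def)
  have Ec: "E n j \<in> carrier R" for n j by (induction n arbitrary: j) (auto simp: E0 ES fps_coeff_closed[OF d])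
  define e where "e j n = E n j" for j n
  have e: "e j \<in> carrier F" for j unfolding fps_carrier e_def using Ec by simp
  have "e j n = (d j \<oplus>\<^bsub>F\<^esub> fps_var R \<otimes>\<^bsub>F\<^esub> e (Suc j)) n" for j n
    by (cases n) (simp_all add: fps_add fps_var_mult e fps_coeff_closed[OF d], simp_all add: e_def E0 ES fps_coeff_closed[OF d])
  then have "e j = d j \<oplus>\<^bsub>F\<^esub> fps_var R \<otimes>\<^bsub>F\<^esub> e (Suc j)" for j by (rule ext)
  then show ?thesis using e by (intro exI[of _ e] conjI allI)
qed

lemma fps_coeff_hom:
  assumes "cring T" and h: "h \<in> ring_hom R T"
  shows "(\<lambda>f n. h (f n)) \<in> ring_hom F (fps_ring T)"
proof -
  interpret T: cring T by fact
  interpret h: ring_hom_cring R T h by (intro ring_hom_cring.intro ring_hom_cring_axioms.intro cring_axioms assms)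
  show ?thesis
  proof (rule ring_hom_memI)
    fix f assume "f \<in> carrier F" then show "(\<lambda>n. h (f n)) \<in> carrier (fps_ring T)"
      by (simp add: T.fps_carrier fps_coeff_closed)
  next
    fix f g assume fg: "f \<in> carrier F" "g \<in> carrier F"
    note c = fps_coeff_closed[OF fg(1)] fps_coeff_closed[OF fg(2)]
    show "(\<lambda>n. h ((f \<otimes>\<^bsub>F\<^esub> g) n)) = (\<lambda>n. h (f n)) \<otimes>\<^bsub>fps_ring T\<^esub> (\<lambda>n. h (g n))"
    proof
      fix n
      have "h (\<Oplus>i\<in>{..n}. f i \<otimes> g (n - i)) = (\<Oplus>\<^bsub>T\<^esub>i\<in>{..n}. (h \<circ> (\<lambda>i. f i \<otimes> g (n - i))) i)"
        by (rule h.hom_finsum) (use c in auto)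
      also have "\<dots> = (\<Oplus>\<^bsub>T\<^esub>i\<in>{..n}. h (f i) \<otimes>\<^bsub>T\<^esub> h (g (n - i)))"
        by (rule T.finsum_cong') (use c in auto)
      finally show "h ((f \<otimes>\<^bsub>F\<^esub> g) n) = ((\<lambda>n. h (f n)) \<otimes>\<^bsub>fps_ring T\<^esub> (\<lambda>n. h (g n))) n"
        unfolding fps_mult T.fps_mult .
    qed
    show "(\<lambda>n. h ((f \<oplus>\<^bsub>F\<^esub> g) n)) = (\<lambda>n. h (f n)) \<oplus>\<^bsub>fps_ring T\<^esub> (\<lambda>n. h (g n))"
      by (rule ext) (use c in \<open>simp add: fps_add T.fps_add\<close>)
  next
    show "(\<lambda>n. h (\<one>\<^bsub>F\<^esub> n)) = \<one>\<^bsub>fps_ring T\<^esub>"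
      by (rule ext) (simp add: fps_one T.fps_one fps_scalar_def)
  qed
qed

lemma fps_constant_coeff_hom: "(\<lambda>f. f 0) \<in> ring_hom F R"
  by (rule ring_hom_memI) (auto simp: fps_coeff_closed fps_mult_0 fps_add fps_one fps_scalar_def)

end

section \<open>Evaluation of power series in a complete algebra\<close>

primrec partial_value :: "('s, 'c) ring_scheme \<Rightarrow> ('a \<Rightarrow> 's) \<Rightarrow> 's \<Rightarrow> nat \<Rightarrow> (nat \<Rightarrow> 'a) \<Rightarrow> 's \<Rightarrow> bool" where
  "partial_value B \<phi> q 0 f b \<longleftrightarrow> b \<in> carrier B"
| "partial_value B \<phi> q (Suc n) f b \<longleftrightarrow>
    (\<exists>c. partial_value B \<phi> q n (fps_shift f) c \<and> b = \<phi> (f 0) \<oplus>\<^bsub>B\<^esub> q \<otimes>\<^bsub>B\<^esub> c)"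

text \<open>Evaluation of power series over \<open>R\<close> at the element \<open>q\<close> of a \<open>q\<close>-adically complete \<open>R\<close>-algebra \<open>B\<close>;
  \<open>partial_value B \<phi> q n f b\<close> says that \<open>b\<close> is a value of \<open>f\<close> modulo \<open>q^n\<close>, in a form suited to
  induction on \<open>n\<close>.\<close>

locale fps_eval = R: cring R + adic B q for R :: "('a, 'c) ring_scheme" and B :: "('s, 'd) ring_scheme" (structure) and q +
  fixes \<phi>
  assumes \<phi>: "\<phi> \<in> ring_hom R B"
begin

lemma \<phi>_closed: "x \<in> carrier R \<Longrightarrow> \<phi> x \<in> carrier B"
  using ring_hom_closed[OF \<phi>] .

lemma pv_closed: "f \<in> carrier (fps_ring R) \<Longrightarrow> partial_value B \<phi> q n f b \<Longrightarrow> b \<in> carrier B"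
proof (induction n arbitrary: f b)
  case (Suc n)
  then obtain c where "partial_value B \<phi> q n (fps_shift f) c" "b = \<phi> (f 0) \<oplus> q \<otimes> c" by auto
  then show ?case using Suc.IH[of "fps_shift f" c] Suc.prems(1) R.fps_shift_closed R.fps_coeff_closed \<phi>_closed by simp
qed auto

lemma pv_unique:
  "f \<in> carrier (fps_ring R) \<Longrightarrow> partial_value B \<phi> q n f b \<Longrightarrow> partial_value B \<phi> q n f b' \<Longrightarrow> q [^] n divides (b \<ominus> b')"
proof (induction n arbitrary: f b b')
  case 0
  then show ?case by (auto simp: factor_def)
next
  case (Suc n)
  then obtain c c' where *: "partial_value B \<phi> q n (fps_shift f) c" "b = \<phi> (f 0) \<oplus> q \<otimes> c"
    "partial_value B \<phi> q n (fps_shift f) c'" "b' = \<phi> (f 0) \<oplus> q \<otimes> c'" by auto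
  have sf: "fps_shift f \<in> carrier (fps_ring R)" using Suc.prems(1) R.fps_shift_closed by blast
  have c: "c \<in> carrier B" "c' \<in> carrier B" "\<phi> (f 0) \<in> carrier B"
    using pv_closed[OF sf *(1)] pv_closed[OF sf *(3)] \<phi>_closed R.fps_coeff_closed[OF Suc.prems(1)] by auto
  obtain x where x: "x \<in> carrier B" "c \<ominus> c' = q [^] n \<otimes> x" using Suc.IH[OF sf *(1,3)] unfolding factor_def by auto
  have "b \<ominus> b' = q \<otimes> (c \<ominus> c')" unfolding *(2,4) using c q_closed by algebra
  also have "\<dots> = q [^] Suc n \<otimes> x" unfolding x(2) using x(1) by (simp add: m_ac)
  finally show ?case using x(1) unfolding factor_def by blast
qed

lemma pv_add:
  "f \<in> carrier (fps_ring R) \<Longrightarrow> g \<in> carrier (fps_ring R) \<Longrightarrow> partial_value B \<phi> q n f b \<Longrightarrow> partial_value B \<phi> q n g c \<Longrightarrow>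
    partial_value B \<phi> q n (f \<oplus>\<^bsub>fps_ring R\<^esub> g) (b \<oplus> c)"
proof (induction n arbitrary: f g b c)
  case 0
  then show ?case by simp
next
  case (Suc n)
  then obtain b' c' where *: "partial_value B \<phi> q n (fps_shift f) b'" "b = \<phi> (f 0) \<oplus> q \<otimes> b'"
    "partial_value B \<phi> q n (fps_shift g) c'" "c = \<phi> (g 0) \<oplus> q \<otimes> c'" by auto
  have s: "fps_shift f \<in> carrier (fps_ring R)" "fps_shift g \<in> carrier (fps_ring R)"
    using Suc.prems R.fps_shift_closed by blast+
  have c0: "b' \<in> carrier B" "c' \<in> carrier B" using pv_closed[OF s(1) *(1)] pv_closed[OF s(2) *(3)] by auto
  have R0: "f 0 \<in> carrier R" "g 0 \<in> carrier R" using Suc.prems R.fps_coeff_closed by auto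
  have "b \<oplus> c = (\<phi> (f 0) \<oplus> \<phi> (g 0)) \<oplus> q \<otimes> (b' \<oplus> c')"
    unfolding *(2,4) using c0 \<phi>_closed[OF R0(1)] \<phi>_closed[OF R0(2)] q_closed by algebra
  moreover have "\<phi> ((f \<oplus>\<^bsub>fps_ring R\<^esub> g) 0) = \<phi> (f 0) \<oplus> \<phi> (g 0)"
    unfolding R.fps_add by (rule ring_hom_add[OF \<phi> R0])
  moreover have "fps_shift (f \<oplus>\<^bsub>fps_ring R\<^esub> g) = fps_shift f \<oplus>\<^bsub>fps_ring R\<^esub> fps_shift g"
    by (rule ext) (simp add: fps_shift_def R.fps_add)
  ultimately show ?case using Suc.IH[OF s *(1,3)] by auto
qed

lemma pv_scale:
  "f \<in> carrier (fps_ring R) \<Longrightarrow> a \<in> carrier R \<Longrightarrow> partial_value B \<phi> q n f b \<Longrightarrow>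
    partial_value B \<phi> q n (\<lambda>n. a \<otimes>\<^bsub>R\<^esub> f n) (\<phi> a \<otimes> b)"
proof (induction n arbitrary: f b)
  case 0
  then show ?case using \<phi>_closed by simp
next
  case (Suc n)
  then obtain b' where *: "partial_value B \<phi> q n (fps_shift f) b'" "b = \<phi> (f 0) \<oplus> q \<otimes> b'" by auto
  have s: "fps_shift f \<in> carrier (fps_ring R)" using Suc.prems R.fps_shift_closed by blast
  have c0: "b' \<in> carrier B" using pv_closed[OF s(1) *(1)] by auto
  have R0: "f 0 \<in> carrier R" using Suc.prems R.fps_coeff_closed by auto
  have "\<phi> a \<otimes> b = \<phi> a \<otimes> \<phi> (f 0) \<oplus> q \<otimes> (\<phi> a \<otimes> b')"
    unfolding *(2) using c0 \<phi>_closed[OF R0(1)] \<phi>_closed[OF Suc.prems(2)] q_closed by algebra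
  moreover have "\<phi> (a \<otimes>\<^bsub>R\<^esub> f 0) = \<phi> a \<otimes> \<phi> (f 0)" by (rule ring_hom_mult[OF \<phi> Suc.prems(2) R0])
  moreover have "fps_shift (\<lambda>n. a \<otimes>\<^bsub>R\<^esub> f n) = (\<lambda>n. a \<otimes>\<^bsub>R\<^esub> fps_shift f n)" by (rule ext) (simp add: fps_shift_def)
  ultimately show ?case using Suc.IH[OF s Suc.prems(2) *(1)] by auto
qed

lemma pv_Suc: "f \<in> carrier (fps_ring R) \<Longrightarrow> partial_value B \<phi> q (Suc n) f b \<Longrightarrow> partial_value B \<phi> q n f b"
proof (induction n arbitrary: f b)
  case 0
  then show ?case using pv_closed[OF 0] by simp
next
  case (Suc n)
  then obtain c where *: "partial_value B \<phi> q (Suc n) (fps_shift f) c" "b = \<phi> (f 0) \<oplus> q \<otimes> c"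
    by (metis partial_value.simps(2))
  then show ?case using Suc.IH[OF R.fps_shift_closed[OF Suc.prems(1)] *(1)] by auto
qed

lemma pv_mult:
  "f \<in> carrier (fps_ring R) \<Longrightarrow> g \<in> carrier (fps_ring R) \<Longrightarrow> partial_value B \<phi> q n f b \<Longrightarrow> partial_value B \<phi> q n g c \<Longrightarrow>
    partial_value B \<phi> q n (f \<otimes>\<^bsub>fps_ring R\<^esub> g) (b \<otimes> c)"
proof (induction n arbitrary: f b)
  case 0
  then show ?case by simp
next
  case (Suc n)
  then obtain b' c' where *: "partial_value B \<phi> q n (fps_shift f) b'" "b = \<phi> (f 0) \<oplus> q \<otimes> b'"
    "partial_value B \<phi> q n (fps_shift g) c'" "c = \<phi> (g 0) \<oplus> q \<otimes> c'" by auto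
  have s: "fps_shift f \<in> carrier (fps_ring R)" "fps_shift g \<in> carrier (fps_ring R)"
    using Suc.prems R.fps_shift_closed by blast+
  have c0: "b' \<in> carrier B" "c' \<in> carrier B" "c \<in> carrier B"
    using pv_closed[OF s(1) *(1)] pv_closed[OF s(2) *(3)] pv_closed[OF Suc.prems(2,4)] by auto
  have R0: "f 0 \<in> carrier R" "g 0 \<in> carrier R" using Suc.prems R.fps_coeff_closed by auto
  have "partial_value B \<phi> q n (\<lambda>n. f 0 \<otimes>\<^bsub>R\<^esub> fps_shift g n) (\<phi> (f 0) \<otimes> c')"
    by (rule pv_scale[OF s(2) R0(1) *(3)])
  \<comment> \<open>The shift of \<open>f\<close> has its value known one level lower, so the value
    of \<open>g\<close> is weakened to that level by \<open>pv_Suc\<close>.\<close>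
  moreover have "partial_value B \<phi> q n (fps_shift f \<otimes>\<^bsub>fps_ring R\<^esub> g) (b' \<otimes> c)"
    by (rule Suc.IH[OF s(1) Suc.prems(2) *(1) pv_Suc[OF Suc.prems(2,4)]])
  ultimately have "partial_value B \<phi> q n ((\<lambda>n. f 0 \<otimes>\<^bsub>R\<^esub> fps_shift g n) \<oplus>\<^bsub>fps_ring R\<^esub> (fps_shift f \<otimes>\<^bsub>fps_ring R\<^esub> g))
      (\<phi> (f 0) \<otimes> c' \<oplus> b' \<otimes> c)"
    by (rule pv_add[rotated 2]) (use s R0 Suc.prems R.fps_mult_closed in \<open>auto simp: R.fps_carrier\<close>)
  moreover have "fps_shift (f \<otimes>\<^bsub>fps_ring R\<^esub> g) = (\<lambda>n. f 0 \<otimes>\<^bsub>R\<^esub> fps_shift g n) \<oplus>\<^bsub>fps_ring R\<^esub> (fps_shift f \<otimes>\<^bsub>fps_ring R\<^esub> g)"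
    unfolding R.fps_shift_mult[OF Suc.prems(1,2)] by (simp add: fps_shift_def[of g])
  moreover have "b \<otimes> c = \<phi> ((f \<otimes>\<^bsub>fps_ring R\<^esub> g) 0) \<oplus> q \<otimes> (\<phi> (f 0) \<otimes> c' \<oplus> b' \<otimes> c)"
  proof -
    have "b \<otimes> c = \<phi> (f 0) \<otimes> (\<phi> (g 0) \<oplus> q \<otimes> c') \<oplus> q \<otimes> (b' \<otimes> c)"
      unfolding *(4)[symmetric] unfolding *(2) using c0 \<phi>_closed[OF R0(1)] q_closed by algebra
    also have "\<dots> = \<phi> (f 0) \<otimes> \<phi> (g 0) \<oplus> q \<otimes> (\<phi> (f 0) \<otimes> c' \<oplus> b' \<otimes> c)"
      using c0 \<phi>_closed[OF R0(1)] \<phi>_closed[OF R0(2)] q_closed by algebra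
    finally show ?thesis using ring_hom_mult[OF \<phi> R0] R.fps_mult_0[OF Suc.prems(1,2)] by simp
  qed
  ultimately show ?case by auto
qed

text \<open>The Horner tail \<open>e j\<close> of the coefficient sequence is a value of the
  \<open>j\<close>-fold shift of \<open>f\<close>, at all levels at once.\<close>

lemma pv_exists:
  assumes f: "f \<in> carrier (fps_ring R)"
  shows "\<exists>b \<in> carrier B. \<forall>n. partial_value B \<phi> q n f b"
proof -
  obtain e where e: "\<And>j. e j \<in> carrier B" "\<And>j. e j = \<phi> (f j) \<oplus> q \<otimes> e (Suc j)"
    using horner[of "\<lambda>j. \<phi> (f j)"] \<phi>_closed R.fps_coeff_closed[OF f] by blast
  have "partial_value B \<phi> q n ((fps_shift ^^ j) f) (e j)" for n j
  proof (induction n arbitrary: j)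
    case 0
    show ?case using e(1) by simp
  next
    case (Suc n)
    have "(fps_shift ^^ j) f k = f (k + j)" for k
      by (induction j arbitrary: k) (auto simp: fps_shift_def)
    then have "e j = \<phi> ((fps_shift ^^ j) f 0) \<oplus> q \<otimes> e (Suc j)" using e(2)[of j] by (metis add_0)
    then show ?case using Suc[of "Suc j"] unfolding partial_value.simps funpow.simps o_def by blast
  qed
  from this[of _ 0] show ?thesis using e(1) by (intro bexI[of _ "e 0"]) auto
qed

definition eval_fps :: "(nat \<Rightarrow> 'a) \<Rightarrow> 's" where
  "eval_fps f = (SOME b. b \<in> carrier B \<and> (\<forall>n. partial_value B \<phi> q n f b))"

lemma eval_fps:
  assumes "f \<in> carrier (fps_ring R)"
  shows "eval_fps f \<in> carrier B" "partial_value B \<phi> q n f (eval_fps f)"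
  using someI_ex[of "\<lambda>b. b \<in> carrier B \<and> (\<forall>n. partial_value B \<phi> q n f b)"] pv_exists[OF assms]
  unfolding eval_fps_def by blast+

lemma eval_fps_eqI:
  assumes f: "f \<in> carrier (fps_ring R)" and b: "b \<in> carrier B" "\<And>n. partial_value B \<phi> q n f b"
  shows "eval_fps f = b"
proof -
  have "eval_fps f \<ominus> b = \<zero>"
    using separated[of "eval_fps f \<ominus> b"] pv_unique[OF f eval_fps(2)[OF f] b(2)] eval_fps(1)[OF f] b(1) by simp
  then show ?thesis using eval_fps(1)[OF f] b(1) by simp
qed

lemma eval_fps_hom: "eval_fps \<in> ring_hom (fps_ring R) B"
proof (rule ring_hom_memI)
  fix f assume "f \<in> carrier (fps_ring R)" then show "eval_fps f \<in> carrier B" by (rule eval_fps)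
next
  fix f g assume fg: "f \<in> carrier (fps_ring R)" "g \<in> carrier (fps_ring R)"
  show "eval_fps (f \<otimes>\<^bsub>fps_ring R\<^esub> g) = eval_fps f \<otimes> eval_fps g"
    by (rule eval_fps_eqI) (use fg eval_fps R.fps_mult_closed pv_mult in auto)
  show "eval_fps (f \<oplus>\<^bsub>fps_ring R\<^esub> g) = eval_fps f \<oplus> eval_fps g"
    by (rule eval_fps_eqI) (use fg eval_fps R.fps_add_closed pv_add in auto)
next
  have z: "partial_value B \<phi> q n (\<lambda>_. \<zero>\<^bsub>R\<^esub>) \<zero>" for n
  proof (induction n)
    case (Suc n)
    have "fps_shift (\<lambda>_. \<zero>\<^bsub>R\<^esub>) = (\<lambda>_. \<zero>\<^bsub>R\<^esub>)" by (rule ext) (simp add: fps_shift_def)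
    then show ?case using Suc ring_hom_zero[OF \<phi> R.ring_axioms ring_axioms] by (auto intro!: exI[of _ \<zero>])
  qed simp
  show "eval_fps \<one>\<^bsub>fps_ring R\<^esub> = \<one>" unfolding R.fps_one
  proof (rule eval_fps_eqI)
    fix n
    have s: "fps_shift (fps_scalar R \<one>\<^bsub>R\<^esub>) = (\<lambda>_. \<zero>\<^bsub>R\<^esub>)" by (rule ext) (simp add: fps_shift_def fps_scalar_def)
    have "\<phi> (fps_scalar R \<one>\<^bsub>R\<^esub> 0) = \<one>" using ring_hom_one[OF \<phi>] by (simp add: fps_scalar_def)
    then show "partial_value B \<phi> q n (fps_scalar R \<one>\<^bsub>R\<^esub>) \<one>" using z s
      by (cases n) (auto intro!: exI[of _ \<zero>])
  qed (auto intro: R.fps_scalar_closed)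
qed

text \<open>Digit expansion: \<open>b\<close> is a constant from \<open>R\<close> plus
  \<open>q\<close> times a remainder, and the remainders are expanded in turn. The digits are the
  coefficients of a preimage.\<close>

lemma eval_fps_surj:
  assumes gen: "\<And>b. b \<in> carrier B \<Longrightarrow> \<exists>a\<in>carrier R. q divides (b \<ominus> \<phi> a)"
  shows "eval_fps ` carrier (fps_ring R) = carrier B"
proof (intro equalityI subsetI)
  fix b assume b: "b \<in> carrier B"
  have "\<exists>a c. a \<in> carrier R \<and> c \<in> carrier B \<and> b = \<phi> a \<oplus> q \<otimes> c" if bB: "b \<in> carrier B" for b
  proof -
    obtain a where a: "a \<in> carrier R" "q divides (b \<ominus> \<phi> a)" using gen[OF bB] by blast
    then obtain c where c: "c \<in> carrier B" "b \<ominus> \<phi> a = q \<otimes> c" unfolding factor_def by blast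
    have "b = \<phi> a \<oplus> (b \<ominus> \<phi> a)" using bB \<phi>_closed[OF a(1)] by algebra
    then show ?thesis using a(1) c by metis
  qed
  then obtain \<alpha> \<gamma> where step: "\<And>b. b \<in> carrier B \<Longrightarrow> \<alpha> b \<in> carrier R \<and> \<gamma> b \<in> carrier B \<and> b = \<phi> (\<alpha> b) \<oplus> q \<otimes> \<gamma> b" by metis
  define f where "f j = \<alpha> ((\<gamma> ^^ j) b)" for j
  have c: "(\<gamma> ^^ j) b \<in> carrier B" for j by (induction j) (use step b in auto)
  have f: "f \<in> carrier (fps_ring R)" unfolding R.fps_carrier f_def using step c by blast
  have "partial_value B \<phi> q n ((fps_shift ^^ j) f) ((\<gamma> ^^ j) b)" for n j
  proof (induction n arbitrary: j)
    case 0
    show ?case using c by simp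
  next
    case (Suc n)
    have "(fps_shift ^^ j) f k = f (k + j)" for k
      by (induction j arbitrary: k) (auto simp: fps_shift_def)
    then have "(\<gamma> ^^ j) b = \<phi> ((fps_shift ^^ j) f 0) \<oplus> q \<otimes> (\<gamma> ^^ Suc j) b"
      using step[OF c[of j]] unfolding f_def funpow.simps o_def by (metis add_0)
    then show ?case using Suc[of "Suc j"] unfolding partial_value.simps funpow.simps o_def by blast
  qed
  from this[of _ 0] have "eval_fps f = b" using eval_fps_eqI[OF f b] by simp
  then show "b \<in> eval_fps ` carrier (fps_ring R)" using f by blast
qed (use eval_fps in auto)

end

lemma quotient_of_surjection:
  assumes "ring A" "ring B" and h: "h \<in> ring_hom A B" "h ` carrier A = carrier B" and D: "D \<simeq> B"
  shows "\<exists>I. ideal I A \<and> D \<simeq> (A Quot I)"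
proof -
  interpret h: ring_hom_ring A B h using ring_hom_ringI2[OF assms(1-3)] .
  have "A Quot (a_kernel A B h) \<simeq> B" using h.FactRing_iso h(2) by simp
  then have "B \<simeq> A Quot (a_kernel A B h)"
    using ring_iso_sym ideal.quotient_is_ring[OF h.kernel_is_ideal] by blast
  then show ?thesis using h.kernel_is_ideal ring_iso_trans[OF D] by blast
qed

section \<open>Rings generated by one topologically nilpotent element\<close>

context cdvr
begin

lemma unit_or_divisible:
  assumes a: "a \<in> A"
  shows "(\<exists>v\<in>A. a \<otimes> v = \<one>) \<or> (\<exists>b\<in>A. a = p \<otimes> b)"
proof (cases "a = \<zero>")
  case True
  then show ?thesis using A_closed(1) by (intro disjI2 bexI[of _ \<zero>]) auto
next
  case False
  obtain k :: nat and u v where k: "u \<in> A" "v \<in> A" "u \<otimes> v = \<one>" "a = p [^] k \<otimes> u" using valuation[OF a False] by blast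
  show ?thesis
  proof (cases k)
    case 0
    then have "a = u" using k A_in by simp
    then show ?thesis using k by blast
  next
    case (Suc i)
    have "a = p \<otimes> (p [^] i \<otimes> u)" unfolding k(4) Suc using A_in[OF k(1)] by (simp add: m_ac)
    then show ?thesis using A_closed(4)[OF pow_p_in k(1)] by blast
  qed
qed

text \<open>\<open>m\<close> is the lowest degree with a unit coefficient, and \<open>u\<close> is
  that coefficient. Coefficients below it are multiples of \<open>p\<close> and go into
  \<open>p \<otimes> e\<close>, those above it into \<open>v\<close>.\<close>

lemma eval_mod_p:
  assumes x: "x \<in> carrier R"
  shows "set c \<subseteq> A \<Longrightarrow> \<exists>a\<in>set c. \<exists>v\<in>A. a \<otimes> v = \<one> \<Longrightarrow>
    \<exists>(m::nat) u w v e. u \<in> A \<and> w \<in> A \<and> u \<otimes> w = \<one> \<and> v \<in> carrier R \<and> e \<in> carrier R \<and>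
      eval c x = x [^] m \<otimes> (u \<oplus> x \<otimes> v) \<oplus> p \<otimes> e"
proof (induction c rule: rev_induct)
  case (snoc a c)
  have sA: "set c \<subseteq> A" "a \<in> A" using snoc.prems by auto
  have ec: "eval c x \<in> carrier R" using sA(1) x by (rule eval_closed_A)
  have ev: "eval (c @ [a]) x = eval c x \<otimes> x \<oplus> a"
    by (rule eval_append_aux) (use sA A_subset x in auto)
  show ?case
  proof (cases "\<exists>v\<in>A. a \<otimes> v = \<one>")
    case True
    then obtain w where w: "w \<in> A" "a \<otimes> w = \<one>" by blast
    have "eval (c @ [a]) x = x [^] (0::nat) \<otimes> (a \<oplus> x \<otimes> eval c x) \<oplus> p \<otimes> \<zero>"
      unfolding ev using ec x A_in[OF sA(2)] by (simp add: m_comm a_comm)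
    then show ?thesis using w sA(2) ec zero_closed by blast
  next
    case False
    then obtain b where b: "b \<in> A" "a = p \<otimes> b" using unit_or_divisible[OF sA(2)] by blast
    have "\<exists>a\<in>set c. \<exists>v\<in>A. a \<otimes> v = \<one>" using snoc.prems(2) False by auto
    then obtain m :: nat and u w v e where *: "u \<in> A" "w \<in> A" "u \<otimes> w = \<one>" "v \<in> carrier R" "e \<in> carrier R"
      "eval c x = x [^] m \<otimes> (u \<oplus> x \<otimes> v) \<oplus> p \<otimes> e" using snoc.IH[OF sA(1)] by blast
    have "eval (c @ [a]) x = (x [^] m \<otimes> (u \<oplus> x \<otimes> v) \<oplus> p \<otimes> e) \<otimes> x \<oplus> p \<otimes> b"
      unfolding ev *(6) using b(2) by simp
    also have "\<dots> = x [^] Suc m \<otimes> (u \<oplus> x \<otimes> v) \<oplus> p \<otimes> (e \<otimes> x \<oplus> b)"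
      unfolding nat_pow_Suc
      using A_in[OF *(1)] *(4,5) x A_in[OF b(1)] nat_pow_closed[OF x, of m] p_closed by algebra
    finally have "eval (c @ [a]) x = x [^] Suc m \<otimes> (u \<oplus> x \<otimes> v) \<oplus> p \<otimes> (e \<otimes> x \<oplus> b)" .
    moreover have "e \<otimes> x \<oplus> b \<in> carrier R" using *(5) x A_in[OF b(1)] by simp
    ultimately show ?thesis using * by blast
  qed
qed auto

text \<open>A monic relation makes \<open>x [^] m \<otimes> y\<close> vanish modulo
  \<open>p\<close>, with \<open>y\<close> congruent to 1 modulo \<open>x\<close>. So
  \<open>x [^] m\<close> and \<open>y\<close> are comaximal, and they provide complementary elements
  with product divisible by \<open>p\<close>. One of these is then divisible by \<open>p\<close>; if
  it were the one from \<open>y\<close>, then \<open>x\<close> would be a unit.\<close>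

lemma nonunit_power_divisible:
  assumes "adic R p" and x: "x \<in> carrier R" "integral_over R A x" "x \<notin> Units R"
  shows "\<exists>n::nat. p divides (x [^] n)"
proof -
  interpret ad: adic R p by fact
  obtain l where l: "set l \<subseteq> A" "l \<noteq> []" "hd l = \<one>" "eval l x = \<zero>"
    using x(2) unfolding integral_over_def polynomial_def by auto
  have "\<exists>a\<in>set l. \<exists>v\<in>A. a \<otimes> v = \<one>" using hd_in_set[OF l(2)] A_closed(2) unfolding l(3)
    by (intro bexI[of _ \<one>]) auto
  then obtain m :: nat and u w v e where *: "u \<in> A" "w \<in> A" "u \<otimes> w = \<one>" "v \<in> carrier R" "e \<in> carrier R"
    "\<zero> = x [^] m \<otimes> (u \<oplus> x \<otimes> v) \<oplus> p \<otimes> e" using eval_mod_p[OF x(1) l(1)] unfolding l(4) by blast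
  have uw: "u \<in> carrier R" "w \<in> carrier R" using A_in * by auto
  define y where "y = \<one> \<oplus> x \<otimes> (w \<otimes> v)"
  have yc: "y \<in> carrier R" unfolding y_def using x uw * by simp
  have "x [^] m \<otimes> y = x [^] m \<otimes> (u \<otimes> w \<oplus> x \<otimes> (w \<otimes> v))" unfolding y_def *(3) ..
  also have "\<dots> = w \<otimes> (x [^] m \<otimes> (u \<oplus> x \<otimes> v) \<oplus> p \<otimes> e) \<ominus> p \<otimes> (w \<otimes> e)"
    using x(1) uw *(4,5) nat_pow_closed[OF x(1), of m] p_closed by algebra
  also have "\<dots> = p \<otimes> (\<ominus> (w \<otimes> e))" unfolding *(6)[symmetric] using uw *(5) by (simp add: a_minus_def r_minus)
  finally have xy: "x [^] m \<otimes> y = p \<otimes> (\<ominus> (w \<otimes> e))" .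
  have pxy: "p divides (x [^] m \<otimes> y)" unfolding xy using uw *(5) by (auto simp: factor_def)
  have nu: "\<not> p divides (\<one> \<ominus> x \<otimes> a)" if "a \<in> carrier R" for a
    using ad.unit_modI[OF _ x(1) that] x(3) by blast
  have "\<exists>s\<in>carrier R. \<exists>t\<in>carrier R. x [^] k \<otimes> s \<oplus> y \<otimes> t = \<one>" for k :: nat
  proof (induction k)
    case 0
    show ?case using yc by (intro bexI[of _ \<one>] bexI[of _ \<zero>]) auto
  next
    case (Suc k)
    then obtain s t where st: "s \<in> carrier R" "t \<in> carrier R" "x [^] k \<otimes> s \<oplus> y \<otimes> t = \<one>" by blast
    \<comment> \<open>\<open>y \<otimes> (x [^] k \<otimes> s)\<close> differs from
      \<open>x [^] k \<otimes> s\<close> by a multiple of \<open>x [^] Suc k\<close>, which raises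
      the power in the relation by one.\<close>
    have "x [^] Suc k \<otimes> (\<ominus> (s \<otimes> (w \<otimes> v))) \<oplus> y \<otimes> (x [^] k \<otimes> s \<oplus> t) = x [^] k \<otimes> s \<oplus> y \<otimes> t"
      unfolding y_def nat_pow_Suc using st x(1) uw *(4) nat_pow_closed[OF x(1), of k] by algebra
    then show ?case using st x(1) uw *(4)
      by (intro bexI[of _ "\<ominus> (s \<otimes> (w \<otimes> v))"] bexI[of _ "x [^] k \<otimes> s \<oplus> t"]) auto
  qed
  then obtain s t where st: "s \<in> carrier R" "t \<in> carrier R" "x [^] m \<otimes> s \<oplus> y \<otimes> t = \<one>" by blast
  have xm: "x [^] m \<in> carrier R" using x(1) by simp
  have "p divides ((x [^] m \<otimes> y) \<otimes> (s \<otimes> t))" using pxy st by (intro divides_prod_r(1)[OF p_closed pxy]) auto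
  then have "p divides ((x [^] m \<otimes> s) \<otimes> (y \<otimes> t))" using st xm yc by (simp add: m_ac)
  then have "p divides (x [^] m \<otimes> s) \<or> p divides (y \<otimes> t)"
    by (intro ad.complementary_mod_q domain_axioms) (use st xm yc in auto)
  then show ?thesis
  proof
    assume 1: "p divides (x [^] m \<otimes> s)"
    \<comment> \<open>Multiplying the decomposition of 1 by \<open>x [^] m\<close> makes both
      summands divisible by \<open>p\<close>.\<close>
    have "p divides (x [^] m \<otimes> (x [^] m \<otimes> s) \<oplus> (x [^] m \<otimes> y) \<otimes> t)"
      by (rule divides_sum) (use 1 pxy xm st yc divides_prod_r in auto)
    moreover have "x [^] m \<otimes> (x [^] m \<otimes> s) \<oplus> (x [^] m \<otimes> y) \<otimes> t = x [^] m \<otimes> (x [^] m \<otimes> s \<oplus> y \<otimes> t)"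
      using xm st(1,2) yc by algebra
    ultimately show ?thesis unfolding st(3) using xm by (intro exI[of _ m]) simp
  next
    assume 2: "p divides (y \<otimes> t)"
    \<comment> \<open>Either way \<open>p\<close> divides 1 - xa for some \<open>a\<close>, so
      \<open>x\<close> is a unit modulo \<open>p\<close> and hence a unit. For \<open>m = 0\<close>
      this is read off from \<open>y\<close> itself.\<close>
    have False
    proof (cases m)
      case 0
      then have "p divides y" using pxy yc by simp
      moreover have "y = \<one> \<ominus> x \<otimes> (\<ominus> (w \<otimes> v))" unfolding y_def using x(1) uw *(4) by algebra
      ultimately show False using nu[of "\<ominus> (w \<otimes> v)"] uw *(4) by simp
    next
      case (Suc k)
      have "y \<otimes> t = (x [^] m \<otimes> s \<oplus> y \<otimes> t) \<ominus> x [^] m \<otimes> s" using xm st(1,2) yc by algebra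
      also have "\<dots> = \<one> \<ominus> x [^] m \<otimes> s" unfolding st(3) ..
      also have "x [^] m = x \<otimes> x [^] k" unfolding Suc nat_pow_Suc by (rule m_comm) (use x(1) in auto)
      also have "x \<otimes> x [^] k \<otimes> s = x \<otimes> (x [^] k \<otimes> s)" by (rule m_assoc) (use x(1) st(1) in auto)
      finally have *: "y \<otimes> t = \<one> \<ominus> x \<otimes> (x [^] k \<otimes> s)" .
      have "x [^] k \<otimes> s \<in> carrier R" using x(1) st(1) by simp
      then show False using 2 nu unfolding * by blast
    qed
    then show ?thesis ..
  qed
qed

end

context pid_maximal
begin

text \<open>Integrality is formulated for subrings of a larger domain, so the completion is used
  through its embedded copies.\<close>

lemma cdvr_image:
  assumes L: "domain L" and h: "h \<in> ring_hom S L" "inj_on h (carrier S)"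
  shows "cdvr L (h ` carrier S) (h (incl p))"
proof -
  interpret L: domain L by fact
  interpret S: domain S by (rule completion_domain)
  interpret h: ring_hom_ring S L h by (rule ring_hom_ringI2[OF S.ring_axioms L.ring_axioms h(1)])
  interpret A: adic S "incl p" by (rule completion_adic)
  note pc = incl_closed[OF p_closed]
  show ?thesis
  proof (intro cdvr.intro over_subring.intro over_subring_axioms.intro cdvr_axioms.intro L L.cring_axioms)
    show "subring (h ` carrier S) L" by (rule h.img_is_subring[OF S.carrier_is_subring])
    show "h (incl p) \<in> h ` carrier S" using pc by blast
  next
    fix a assume "a \<in> h ` carrier S"
    then obtain f where f: "f \<in> carrier S" "a = h f" by blast
    show "h (incl p) \<otimes>\<^bsub>L\<^esub> a \<noteq> \<one>\<^bsub>L\<^esub>"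
    proof
      assume "h (incl p) \<otimes>\<^bsub>L\<^esub> a = \<one>\<^bsub>L\<^esub>"
      then have "h (incl p \<otimes>\<^bsub>S\<^esub> f) = h \<one>\<^bsub>S\<^esub>" using f pc by simp
      then have "incl p \<otimes>\<^bsub>S\<^esub> f = \<one>\<^bsub>S\<^esub>" by (rule inj_onD[OF h(2)]) (use f pc in auto)
      then show False using completion_p_nonunit[OF f(1)] by simp
    qed
  next
    fix a assume "a \<in> h ` carrier S" "a \<noteq> \<zero>\<^bsub>L\<^esub>"
    then obtain f where f: "f \<in> carrier S" "a = h f" by blast
    with \<open>a \<noteq> \<zero>\<^bsub>L\<^esub>\<close> have f0: "f \<noteq> \<zero>\<^bsub>S\<^esub>" using h.hom_zero by blast
    obtain k :: nat and u v where *: "u \<in> carrier S" "v \<in> carrier S" "u \<otimes>\<^bsub>S\<^esub> v = \<one>\<^bsub>S\<^esub>" "f = incl p [^]\<^bsub>S\<^esub> k \<otimes>\<^bsub>S\<^esub> u"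
      using completion_valuation[OF f(1) f0] by blast
    have "h (incl p [^]\<^bsub>S\<^esub> k) = h (incl p) [^]\<^bsub>L\<^esub> k" by (induction k) (use pc in auto)
    then have "a = h (incl p) [^]\<^bsub>L\<^esub> k \<otimes>\<^bsub>L\<^esub> h u" unfolding f(2) *(4) using * pc by simp
    moreover have "h u \<otimes>\<^bsub>L\<^esub> h v = \<one>\<^bsub>L\<^esub>" using h.hom_mult[OF *(1,2)] *(3) by simp
    ultimately show "\<exists>(k::nat) u v. u \<in> h ` carrier S \<and> v \<in> h ` carrier S \<and> u \<otimes>\<^bsub>L\<^esub> v = \<one>\<^bsub>L\<^esub> \<and>
        a = h (incl p) [^]\<^bsub>L\<^esub> k \<otimes>\<^bsub>L\<^esub> u"
      using *(1,2) by (intro exI[of _ k] exI[of _ "h u"] exI[of _ "h v"] conjI imageI)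
  next
    fix d :: "nat \<Rightarrow> _" assume "\<And>j. d j \<in> h ` carrier S"
    then have "\<exists>f. f \<in> carrier S \<and> d j = h f" for j by blast
    then obtain d' where d': "\<And>j. d' j \<in> carrier S" "\<And>j. d j = h (d' j)" by metis
    obtain e where e: "\<And>j. e j \<in> carrier S" "\<And>j. e j = d' j \<oplus>\<^bsub>S\<^esub> incl p \<otimes>\<^bsub>S\<^esub> e (Suc j)"
      using A.horner[of d'] d'(1) by blast
    have "h (e j) = d j \<oplus>\<^bsub>L\<^esub> h (incl p) \<otimes>\<^bsub>L\<^esub> h (e (Suc j))" for j
    proof -
      have "h (e j) = h (d' j \<oplus>\<^bsub>S\<^esub> incl p \<otimes>\<^bsub>S\<^esub> e (Suc j))" by (rule arg_cong[OF e(2)])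
      then show ?thesis using d' e(1)[of "Suc j"] pc by simp
    qed
    then show "\<exists>e. (\<forall>j. e j \<in> h ` carrier S) \<and> (\<forall>j. e j = d j \<oplus>\<^bsub>L\<^esub> h (incl p) \<otimes>\<^bsub>L\<^esub> e (Suc j))"
      using e(1) by (intro exI[of _ "\<lambda>j. h (e j)"] conjI allI imageI)
  qed
qed

lemma generated_by_nonunit_is_quotient:
  assumes B: "domain B" and h: "h \<in> ring_hom S B" "inj_on h (carrier S)"
    and x: "x \<in> carrier B" "x \<notin> Units B"
    and gen: "carrier B = lin_span B (h ` carrier S) (\<lambda>i. x [^]\<^bsub>B\<^esub> i) n" and D: "D \<simeq> B"
  shows "\<exists>I. ideal I (fps_ring R) \<and> D \<simeq> (fps_ring R Quot I)"
proof -
  interpret S: domain S by (rule completion_domain)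
  interpret B: cdvr B "h ` carrier S" "h (incl p)" by (rule cdvr_image[OF B h])
  interpret h: ring_hom_ring S B h by (rule ring_hom_ringI2[OF S.ring_axioms B.ring_axioms h(1)])
  let ?A = "h ` carrier S" and ?P = "h (incl p)"
  note pc = incl_closed[OF p_closed]
  have xn: "x [^]\<^bsub>B\<^esub> n \<in> lin_span B ?A (\<lambda>i. x [^]\<^bsub>B\<^esub> i) n" using B.nat_pow_closed[OF x(1), of n] gen by blast
  have int: "integral_over B ?A b" if "b \<in> carrier B" for b
    by (rule B.integral_overI_powers[of "\<lambda>i. x [^]\<^bsub>B\<^esub> i" b n]) (use x(1) gen that in auto)
  have "adic (B\<lparr>carrier := carrier B\<rparr>) ?P"
    by (rule B.finite_extension_adic[of "carrier B" "\<lambda>i. x [^]\<^bsub>B\<^esub> i" n])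
      (use B.carrier_is_subring B.nat_pow_closed[OF x(1)] gen int B.A_subset in blast)+
  then have adP: "adic B ?P" by simp
  interpret P: adic B ?P by fact
  define y where "y = (if x = \<zero>\<^bsub>B\<^esub> then ?P else x)"
  have yc: "y \<in> carrier B" unfolding y_def using x by simp
  have "\<exists>k::nat. y divides\<^bsub>B\<^esub> (?P [^]\<^bsub>B\<^esub> k)"
  proof (cases "x = \<zero>\<^bsub>B\<^esub>")
    case True
    then show ?thesis unfolding y_def by (intro exI[of _ 1]) simp
  next
    case False
    obtain k :: nat and z where "z \<in> carrier B" "?P [^]\<^bsub>B\<^esub> k = x \<otimes>\<^bsub>B\<^esub> z"
      using B.integral_divides_pow[OF B.carrier_is_subring B.A_subset x(1) False int[OF x(1)]] by blast
    then show ?thesis unfolding y_def factor_def using False by (intro exI[of _ k]) auto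
  qed
  then obtain k :: nat where k: "y divides\<^bsub>B\<^esub> (?P [^]\<^bsub>B\<^esub> k)" by blast
  have "\<exists>N::nat. ?P divides\<^bsub>B\<^esub> (y [^]\<^bsub>B\<^esub> N)"
  proof (cases "x = \<zero>\<^bsub>B\<^esub>")
    case True
    then show ?thesis unfolding y_def by (intro exI[of _ 1]) simp
  next
    case False
    then show ?thesis unfolding y_def using B.nonunit_power_divisible[OF adP x(1) int[OF x(1)] x(2)] by simp
  qed
  then obtain N :: nat where N: "?P divides\<^bsub>B\<^esub> (y [^]\<^bsub>B\<^esub> N)" by blast
  have ady: "adic B y" by (rule P.change_base[OF yc k N])
  have \<phi>: "h \<circ> incl \<in> ring_hom R B" by (rule ring_hom_trans[OF incl_hom h(1)])
  interpret ev: fps_eval R B y "h \<circ> incl"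
    by (intro fps_eval.intro fps_eval_axioms.intro cring_axioms ady \<phi>)
  have "\<exists>a\<in>carrier R. y divides\<^bsub>B\<^esub> (b \<ominus>\<^bsub>B\<^esub> (h \<circ> incl) a)" if b: "b \<in> carrier B" for b
  proof -
    let ?V = "{b \<in> carrier B. \<exists>s\<in>?A. \<exists>c\<in>carrier B. b = s \<oplus>\<^bsub>B\<^esub> x \<otimes>\<^bsub>B\<^esub> c}"
    have "lin_span B ?A (\<lambda>i. x [^]\<^bsub>B\<^esub> i) n \<subseteq> ?V"
    proof (rule B.lin_span_subsetI)
      have "\<zero>\<^bsub>B\<^esub> = \<zero>\<^bsub>B\<^esub> \<oplus>\<^bsub>B\<^esub> x \<otimes>\<^bsub>B\<^esub> \<zero>\<^bsub>B\<^esub>" using x(1) by simp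
      then show "\<zero>\<^bsub>B\<^esub> \<in> ?V" using B.zero_closed B.A_closed(1) by blast
    next
      fix u v assume "u \<in> ?V" "v \<in> ?V"
      then obtain s c t d where *: "s \<in> ?A" "c \<in> carrier B" "u = s \<oplus>\<^bsub>B\<^esub> x \<otimes>\<^bsub>B\<^esub> c" "t \<in> ?A" "d \<in> carrier B"
        "v = t \<oplus>\<^bsub>B\<^esub> x \<otimes>\<^bsub>B\<^esub> d" by blast
      then have "u \<oplus>\<^bsub>B\<^esub> v = (s \<oplus>\<^bsub>B\<^esub> t) \<oplus>\<^bsub>B\<^esub> x \<otimes>\<^bsub>B\<^esub> (c \<oplus>\<^bsub>B\<^esub> d)"
        using B.A_in[OF *(1)] B.A_in[OF *(4)] x(1) by (simp add: B.r_distr B.a_ac)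
      moreover have "u \<oplus>\<^bsub>B\<^esub> v \<in> carrier B" using * B.A_in[OF *(1)] B.A_in[OF *(4)] x(1) by simp
      ultimately show "u \<oplus>\<^bsub>B\<^esub> v \<in> ?V" using B.A_closed(5)[OF *(1,4)] B.a_closed[OF *(2,5)] by blast
    next
      fix i :: nat and a assume a: "a \<in> ?A"
      note ac = B.A_in[OF a]
      have "\<exists>s\<in>?A. \<exists>c\<in>carrier B. a \<otimes>\<^bsub>B\<^esub> x [^]\<^bsub>B\<^esub> i = s \<oplus>\<^bsub>B\<^esub> x \<otimes>\<^bsub>B\<^esub> c"
      proof (cases i)
        case 0
        have "a \<otimes>\<^bsub>B\<^esub> x [^]\<^bsub>B\<^esub> i = a \<oplus>\<^bsub>B\<^esub> x \<otimes>\<^bsub>B\<^esub> \<zero>\<^bsub>B\<^esub>" using ac x(1) by (simp add: 0)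
        then show ?thesis using a B.zero_closed by blast
      next
        case (Suc j)
        have "a \<otimes>\<^bsub>B\<^esub> x [^]\<^bsub>B\<^esub> i = \<zero>\<^bsub>B\<^esub> \<oplus>\<^bsub>B\<^esub> x \<otimes>\<^bsub>B\<^esub> (a \<otimes>\<^bsub>B\<^esub> x [^]\<^bsub>B\<^esub> j)"
          using ac x(1) by (simp add: Suc B.m_ac)
        then show ?thesis using B.A_closed(1) B.m_closed[OF ac B.nat_pow_closed[OF x(1)]] by blast
      qed
      then show "a \<otimes>\<^bsub>B\<^esub> x [^]\<^bsub>B\<^esub> i \<in> ?V" using ac x(1) by simp
    qed
    then obtain f c where b': "f \<in> carrier S" "c \<in> carrier B" "b = h f \<oplus>\<^bsub>B\<^esub> x \<otimes>\<^bsub>B\<^esub> c" using b gen by blast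
    \<comment> \<open>Modulo \<open>x\<close> only a coefficient \<open>f\<close> from the
      completion remains. It is approximated from \<open>R\<close> modulo the \<open>k\<close>-th
      power of \<open>p\<close>, because that power is a multiple of \<open>y\<close>.\<close>
    obtain a where a: "a \<in> carrier R" "incl p [^]\<^bsub>S\<^esub> k divides\<^bsub>S\<^esub> (f \<ominus>\<^bsub>S\<^esub> incl a)" using completion_gen_pow[OF b'(1)] .
    obtain g where g: "g \<in> carrier S" "f \<ominus>\<^bsub>S\<^esub> incl a = incl p [^]\<^bsub>S\<^esub> k \<otimes>\<^bsub>S\<^esub> g" using a(2) unfolding factor_def by blast
    note ic = incl_closed[OF a(1)]
    have hc: "h f \<in> carrier B" "h (incl a) \<in> carrier B" "h g \<in> carrier B" using b'(1) ic g(1) by auto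
    have "h f \<ominus>\<^bsub>B\<^esub> h (incl a) = h (f \<ominus>\<^bsub>S\<^esub> incl a)" using b'(1) ic by (simp add: a_minus_def)
    also have "\<dots> = h (incl p [^]\<^bsub>S\<^esub> k) \<otimes>\<^bsub>B\<^esub> h g" unfolding g(2) using g(1) pc by simp
    also have "h (incl p [^]\<^bsub>S\<^esub> k) = ?P [^]\<^bsub>B\<^esub> k" by (induction k) (use pc in auto)
    finally have "y divides\<^bsub>B\<^esub> (h f \<ominus>\<^bsub>B\<^esub> h (incl a))" using k yc hc B.divides_prod_r(1) by simp
    moreover have "y divides\<^bsub>B\<^esub> (x \<otimes>\<^bsub>B\<^esub> c)"
    proof (cases "x = \<zero>\<^bsub>B\<^esub>")
      case True
      then show ?thesis using b'(2) B.divides_zero_r[OF yc] by simp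
    next
      case False
      then have "y = x" unfolding y_def by simp
      then show ?thesis using b'(2) unfolding factor_def by blast
    qed
    ultimately have "y divides\<^bsub>B\<^esub> ((h f \<ominus>\<^bsub>B\<^esub> h (incl a)) \<oplus>\<^bsub>B\<^esub> x \<otimes>\<^bsub>B\<^esub> c)" by (rule B.divides_sum[OF yc])
    moreover have "(h f \<ominus>\<^bsub>B\<^esub> h (incl a)) \<oplus>\<^bsub>B\<^esub> x \<otimes>\<^bsub>B\<^esub> c = b \<ominus>\<^bsub>B\<^esub> (h \<circ> incl) a"
      unfolding b'(3) o_def using hc x(1) b'(2) by (simp add: a_minus_def B.a_ac)
    ultimately show ?thesis using a(1) by auto
  qed
  then have "ev.eval_fps ` carrier (fps_ring R) = carrier B" by (rule ev.eval_fps_surj)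
  then show ?thesis
    by (rule quotient_of_surjection[OF cring.axioms(1)[OF fps_cring] B.ring_axioms ev.eval_fps_hom _ D])
qed

end

section \<open>Rings generated over the completion inside its absolute integral closure\<close>

context pid_maximal
begin

lemma adjoin_ring_is_quotient:
  assumes L: "alg_closure_of_frac S L h"
    and M: "maximalideal M (L\<lparr>carrier := abs_int_closure S L h\<rparr>)" "x \<in> M"
    and D: "D \<simeq> adjoin_ring S L h x"
  shows "\<exists>I. ideal I (fps_ring R) \<and> D \<simeq> (fps_ring R Quot I)"
proof -
  have h: "h \<in> ring_hom S L" "inj_on h (carrier S)"
    and cl: "algebraic_closure L (generate_field L (h ` carrier S))"
    using L unfolding alg_closure_of_frac_def by auto
  interpret L: field L using cl by (rule algebraic_closure.axioms(1))
  interpret S: domain S by (rule completion_domain)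
  let ?A = "h ` carrier S" and ?T = "abs_int_closure S L h"
  interpret C: cdvr L ?A "h (incl p)" by (rule cdvr_image[OF L.domain_axioms h])
  interpret M: maximalideal M "L\<lparr>carrier := ?T\<rparr>" by fact
  have T: "subring ?T L" unfolding abs_int_closure_def by (rule C.integral_closure_is_subring)
  have xT: "x \<in> ?T" using M.Icarr[OF M(2)] by simp
  then have xL: "x \<in> carrier L" and xint: "integral_over L ?A x" unfolding abs_int_closure_def by auto
  obtain n where n: "x [^]\<^bsub>L\<^esub> n \<in> lin_span L ?A (\<lambda>i. x [^]\<^bsub>L\<^esub> i) n"
    using xint C.integral_iff_lin_span[OF xL L.one_not_zero] by blast
  let ?C = "generate_ring L (?A \<union> {x})"
  let ?B = "L\<lparr>carrier := ?C\<rparr>"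
  have AC: "?A \<union> {x} \<subseteq> carrier L" using C.A_subset xL by auto
  have C: "subring ?C L" by (rule L.generate_ring_is_subring[OF AC])
  have "?A \<subseteq> ?T" using C.A_in C.mem_integral_over unfolding abs_int_closure_def by blast
  then have CT: "?C \<subseteq> ?T" using xT by (intro L.generate_ring_min_subring1[OF AC T]) auto
  have "domain ?B" by (rule L.subring_is_domain[OF C])
  then interpret B: domain ?B .
  have hB: "h \<in> ring_hom S ?B"
  proof (rule ring_hom_memI)
    show "h f \<in> carrier ?B" if "f \<in> carrier S" for f using that by (simp add: generate_ring.incl)
  qed (use ring_hom_mult[OF h(1)] ring_hom_add[OF h(1)] ring_hom_one[OF h(1)] in auto)
  show ?thesis
  proof (rule generated_by_nonunit_is_quotient)
    show "domain ?B" by fact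
    show "h \<in> ring_hom S ?B" by (rule hB)
    show "inj_on h (carrier S)" by (rule h)
    show "x \<in> carrier ?B" by (simp add: generate_ring.incl)
    \<comment> \<open>An inverse in \<open>?C\<close> would also lie in the integral closure, which
      contains \<open>?C\<close>, and would put \<open>\<one>\<close> into \<open>M\<close>.\<close>
    show "x \<notin> Units ?B"
    proof
      assume "x \<in> Units ?B"
      then obtain z where z: "z \<in> ?C" "x \<otimes>\<^bsub>L\<^esub> z = \<one>\<^bsub>L\<^esub>" unfolding Units_def by auto
      have "x \<otimes>\<^bsub>L\<^esub> z \<in> M" using M.I_r_closed[OF M(2), of z] z(1) CT by auto
      then have "\<one>\<^bsub>L\<lparr>carrier := ?T\<rparr>\<^esub> \<in> M" unfolding z(2) by simp
      then have "carrier (L\<lparr>carrier := ?T\<rparr>) = M" using M.one_imp_carrier by simp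
      then show False using M.I_notcarr by blast
    qed
    \<comment> \<open>\<open>lin_span\<close> refers to the operations only, so changing the carrier
      does not affect it.\<close>
    have sp: "lin_span ?B ?A w k = lin_span L ?A w k" for w k by (induction k) auto
    show "carrier ?B = lin_span ?B ?A (\<lambda>i. x [^]\<^bsub>?B\<^esub> i) n"
      unfolding sp L.nat_pow_consistent[symmetric] using C.generate_ring_eq_lin_span[OF xL n] by simp
    show "D \<simeq> ?B" using D unfolding adjoin_ring_def .
  qed
qed

end

section \<open>The quotients that do not involve a completion, and units of the power series
  ring\<close>

context cring
begin

lemma fps_scalar_coeff_0: "c \<in> carrier R \<Longrightarrow> fps_scalar R c 0 = c"
  unfolding fps_scalar_def by simp

lemma quotient_constant_coeff:
  assumes "D \<simeq> R" shows "\<exists>I. ideal I F \<and> D \<simeq> (F Quot I)"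
proof (rule quotient_of_surjection[OF _ ring_axioms fps_constant_coeff_hom _ assms])
  show "ring F" using fps_cring cring.axioms(1) by blast
  show "(\<lambda>f. f 0) ` carrier F = carrier R"
  proof (intro equalityI subsetI)
    fix c assume "c \<in> carrier R"
    then show "c \<in> (\<lambda>f. f 0) ` carrier F"
      by (intro image_eqI[of _ _ "fps_scalar R c"]) (auto simp: fps_scalar_closed fps_scalar_coeff_0)
  qed (auto simp: fps_coeff_closed)
qed

lemma fps_coeff_surj:
  assumes "h ` carrier R = carrier T"
  shows "(\<lambda>f n. h (f n)) ` carrier F = carrier (fps_ring T)"
proof (intro equalityI subsetI)
  fix g assume "g \<in> carrier (fps_ring T)"
  then have "\<exists>a. a \<in> carrier R \<and> g n = h a" for n using assms unfolding fps_ring_def by auto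
  then obtain f where "\<And>n. f n \<in> carrier R" "\<And>n. g n = h (f n)" by metis
  then show "g \<in> (\<lambda>f n. h (f n)) ` carrier F"
    by (intro image_eqI[of _ _ f]) (auto simp: fps_carrier)
qed (use assms in \<open>auto simp: fps_ring_def\<close>)

lemma quotient_fps_mod:
  assumes m: "ideal m R"
  shows "D \<simeq> fps_ring (R Quot m) \<Longrightarrow> \<exists>I. ideal I F \<and> D \<simeq> (F Quot I)"
    and "D \<simeq> (R Quot m) \<Longrightarrow> \<exists>I. ideal I F \<and> D \<simeq> (F Quot I)"
proof -
  interpret m: ideal m R by fact
  have Q: "cring (R Quot m)" by (rule m.quotient_is_cring[OF cring_axioms])
  have s: "(+>) m ` carrier R = carrier (R Quot m)" by (simp add: m.FactRing_carrier)
  have F: "ring F" using fps_cring cring.axioms(1) by blast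
  show "\<exists>I. ideal I F \<and> D \<simeq> (F Quot I)" if "D \<simeq> fps_ring (R Quot m)"
    by (rule quotient_of_surjection[OF F _ fps_coeff_hom[OF Q m.rcos_ring_hom] fps_coeff_surj[OF s] that])
      (use cring.fps_cring[OF Q] cring.axioms(1) in blast)
  show "\<exists>I. ideal I F \<and> D \<simeq> (F Quot I)" if D: "D \<simeq> (R Quot m)"
  proof (rule quotient_of_surjection[OF F m.quotient_is_ring
        ring_hom_trans[OF fps_constant_coeff_hom m.rcos_ring_hom] _ D])
    have "(\<lambda>f. f 0) ` carrier F = carrier R"
      by (auto simp: fps_coeff_closed intro!: image_eqI[of _ _ "fps_scalar R _"] fps_scalar_closed fps_scalar_coeff_0[symmetric])
    then show "((+>) m \<circ> (\<lambda>f. f 0)) ` carrier F = carrier (R Quot m)" unfolding image_comp[symmetric] s[symmetric] by simp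
  qed
qed

lemma quotient_trivial:
  assumes "D \<simeq> F" shows "\<exists>I. ideal I F \<and> D \<simeq> (F Quot I)"
proof -
  interpret F: cring F by (rule fps_cring)
  show ?thesis using ring_iso_trans[OF assms F.FactRing_zeroideal(2)] F.zeroideal by blast
qed

lemma fps_var_pow_divides_iff:
  assumes f: "f \<in> carrier F"
  shows "fps_var R [^]\<^bsub>F\<^esub> (n::nat) divides\<^bsub>F\<^esub> f \<longleftrightarrow> (\<forall>i<n. f i = \<zero>)"
proof -
  interpret F: cring F by (rule fps_cring)
  note [simp] = fps_var_closed
  show ?thesis using f
  proof (induction n arbitrary: f)
    case 0
    then show ?case by (auto simp: factor_def)
  next
    case (Suc n)
    have pw: "fps_var R [^]\<^bsub>F\<^esub> Suc n \<otimes>\<^bsub>F\<^esub> g = fps_var R \<otimes>\<^bsub>F\<^esub> (fps_var R [^]\<^bsub>F\<^esub> n \<otimes>\<^bsub>F\<^esub> g)" if "g \<in> carrier F" for g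
      using that by (simp add: F.m_ac)
    show ?case
    proof
      assume "fps_var R [^]\<^bsub>F\<^esub> Suc n divides\<^bsub>F\<^esub> f"
      then obtain g where g: "g \<in> carrier F" "f = fps_var R \<otimes>\<^bsub>F\<^esub> (fps_var R [^]\<^bsub>F\<^esub> n \<otimes>\<^bsub>F\<^esub> g)"
        unfolding factor_def using pw by auto
      let ?g = "fps_var R [^]\<^bsub>F\<^esub> n \<otimes>\<^bsub>F\<^esub> g"
      have gc: "?g \<in> carrier F" using g by simp
      have "\<forall>i<n. ?g i = \<zero>" using Suc.IH[OF gc] g(1) by (auto simp: factor_def)
      then show "\<forall>i<Suc n. f i = \<zero>" unfolding g(2) using fps_var_mult[OF gc]
        by (auto simp: less_Suc_eq_0_disj)
    next
      assume z: "\<forall>i<Suc n. f i = \<zero>"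
      have sc: "fps_shift f \<in> carrier F" by (rule fps_shift_closed[OF Suc.prems])
      have "fps_var R [^]\<^bsub>F\<^esub> n divides\<^bsub>F\<^esub> fps_shift f"
        using Suc.IH[OF sc] z unfolding fps_shift_def by auto
      then obtain g where g: "g \<in> carrier F" "fps_shift f = fps_var R [^]\<^bsub>F\<^esub> n \<otimes>\<^bsub>F\<^esub> g" unfolding factor_def by blast
      have "f = fps_var R \<otimes>\<^bsub>F\<^esub> fps_shift f"
      proof
        fix i show "f i = (fps_var R \<otimes>\<^bsub>F\<^esub> fps_shift f) i"
          using z fps_var_mult[OF sc] by (cases i) (auto simp: fps_shift_def)
      qed
      then have "f = fps_var R [^]\<^bsub>F\<^esub> Suc n \<otimes>\<^bsub>F\<^esub> g" using pw[OF g(1)] g(2) by simp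
      then show "fps_var R [^]\<^bsub>F\<^esub> Suc n divides\<^bsub>F\<^esub> f" using g(1) unfolding factor_def by blast
    qed
  qed
qed

lemma fps_var_pow_mult_coeff:
  assumes "u \<in> carrier F"
  shows "(fps_var R [^]\<^bsub>F\<^esub> (k::nat) \<otimes>\<^bsub>F\<^esub> u) k = u 0"
proof (induction k)
  interpret F: cring F by (rule fps_cring)
  case 0
  then show ?case using assms by simp
next
  interpret F: cring F by (rule fps_cring)
  case (Suc k)
  have c: "fps_var R [^]\<^bsub>F\<^esub> k \<otimes>\<^bsub>F\<^esub> u \<in> carrier F" using assms fps_var_closed by simp
  have "fps_var R [^]\<^bsub>F\<^esub> Suc k \<otimes>\<^bsub>F\<^esub> u = fps_var R \<otimes>\<^bsub>F\<^esub> (fps_var R [^]\<^bsub>F\<^esub> k \<otimes>\<^bsub>F\<^esub> u)"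
    using assms fps_var_closed by (simp add: F.m_ac)
  then show ?case using fps_var_mult(2)[OF c] Suc by simp
qed

lemma fps_adic: "adic F (fps_var R)"
proof -
  interpret F: cring F by (rule fps_cring)
  show ?thesis
  proof unfold_locales
    show "fps_var R \<in> carrier F" by (rule fps_var_closed)
  next
    fix f assume f: "f \<in> carrier F" "\<And>n::nat. fps_var R [^]\<^bsub>F\<^esub> n divides\<^bsub>F\<^esub> f"
    have "f i = \<zero>" for i using f(2)[of "Suc i"] fps_var_pow_divides_iff[OF f(1), of "Suc i"] by simp
    then show "f = \<zero>\<^bsub>F\<^esub>" by (intro ext) (simp add: fps_zero)
  next
    fix d :: "nat \<Rightarrow> _" assume "\<And>j. d j \<in> carrier F"
    then show "\<exists>e. (\<forall>j. e j \<in> carrier F) \<and> (\<forall>j. e j = d j \<oplus>\<^bsub>F\<^esub> fps_var R \<otimes>\<^bsub>F\<^esub> e (Suc j))" by (rule fps_horner)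
  qed
qed

text \<open>\<open>f\<close> is 1 minus a multiple of the variable, and the power series ring is
  complete for the variable.\<close>

lemma fps_unit:
  assumes f: "f \<in> carrier F" "f 0 = \<one>" shows "f \<in> Units F"
proof -
  interpret F: adic F "fps_var R" by (rule fps_adic)
  have sc: "fps_shift f \<in> carrier F" by (rule fps_shift_closed[OF f(1)])
  have "f = \<one>\<^bsub>F\<^esub> \<oplus>\<^bsub>F\<^esub> fps_var R \<otimes>\<^bsub>F\<^esub> fps_shift f" using fps_decompose[OF f(1)] unfolding f(2) fps_one .
  also have "\<dots> = \<one>\<^bsub>F\<^esub> \<ominus>\<^bsub>F\<^esub> fps_var R \<otimes>\<^bsub>F\<^esub> (\<ominus>\<^bsub>F\<^esub> fps_shift f)"
    using sc fps_var_closed by (simp add: a_minus_def F.r_minus)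
  finally show ?thesis using F.one_minus_unit[of "\<ominus>\<^bsub>F\<^esub> fps_shift f"] sc by simp
qed

end

text \<open>The transferred domain has \<open>h \<zero>\<close> as its zero. Between rings
  \<open>h\<close> preserves zero, so this is \<open>B\<close> itself.\<close>

lemma domain_of_iso:
  assumes "domain D" "D \<simeq> B" "ring B" shows "domain B"
proof -
  obtain h where h: "h \<in> ring_iso D B" using assms(2) unfolding is_ring_iso_def by blast
  have "h \<in> ring_hom D B" using h unfolding ring_iso_def by simp
  then have "h \<zero>\<^bsub>D\<^esub> = \<zero>\<^bsub>B\<^esub>" using ring_hom_zero[of h D B] assms(1,3) domain.axioms(1) cring.axioms(1) by blast
  moreover have "domain (B\<lparr>zero := h \<zero>\<^bsub>D\<^esub>\<rparr>)" by (rule domain.ring_iso_imp_img_domain[OF assms(1) h])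
  ultimately show ?thesis by simp
qed

text \<open>If the ideal of \<open>c\<close> contains that of \<open>p\<close>, then
  \<open>p\<close> is a multiple of \<open>c\<close>, and primality puts \<open>c\<close> or the
  cofactor into \<open>J\<close>. In the first case the ideals agree; in the second, cancelling
  \<open>p\<close> makes \<open>c\<close> a unit.\<close>

lemma (in principal_domain) nonzero_prime_maximal:
  assumes J: "primeideal J R" "J \<noteq> {\<zero>}"
  obtains p where "p \<in> carrier R" "p \<noteq> \<zero>" "J = PIdl p" "maximalideal J R"
proof -
  interpret J: primeideal J R by fact
  obtain p where p: "p \<in> carrier R" "J = PIdl p" using exists_gen[OF J.is_ideal] by blast
  have p0: "p \<noteq> \<zero>"
  proof
    assume "p = \<zero>"
    then have "J = {\<zero>}" unfolding p(2) cgenideal_def by (auto intro!: exI[of _ \<zero>])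
    then show False using J(2) by simp
  qed
  have "maximalideal J R"
  proof (rule maximalidealI[OF J.is_ideal J.I_notcarr])
    fix K assume K: "ideal K R" "J \<subseteq> K" "K \<subseteq> carrier R"
    obtain c where c: "c \<in> carrier R" "K = PIdl c" using exists_gen[OF K(1)] by blast
    have "p \<in> K" using K(2) cgenideal_self[OF p(1)] p(2) by blast
    then obtain u where u: "u \<in> carrier R" "p = c \<otimes> u" using c mem_cgenideal_iff unfolding factor_def by blast
    have "c \<otimes> u \<in> J" using u(2) cgenideal_self[OF p(1)] p(2) by simp
    then consider "c \<in> J" | "u \<in> J" using J.I_prime[OF c(1) u(1)] by blast
    then show "K = J \<or> K = carrier R"
    proof cases
      case 1
      then have "K \<subseteq> J" unfolding c(2) using cgenideal_minimal[OF J.is_ideal] by simp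
      then show ?thesis using K(2) by blast
    next
      case 2
      then obtain v where v: "v \<in> carrier R" "u = p \<otimes> v" using p mem_cgenideal_iff unfolding factor_def by blast
      have "p \<otimes> \<one> = p \<otimes> (v \<otimes> c)" using u(2) v c(1) p(1) by (metis m_assoc m_comm m_closed r_one)
      then have "v \<otimes> c = \<one>" using m_lcancel[OF p0 p(1), of \<one> "v \<otimes> c"] v(1) c(1) by simp
      then have "\<one> \<in> K" unfolding c(2) cgenideal_def using v(1) by (intro CollectI exI[of _ v]) simp
      then show ?thesis using ideal.one_imp_carrier[OF K(1)] by blast
    qed
  qed
  then show thesis using that p p0 by blast
qed

section \<open>Domain quotients of the power series ring\<close>

lemma (in domain) pow_nonzero: "x \<in> carrier R \<Longrightarrow> x \<noteq> \<zero> \<Longrightarrow> x [^] (n::nat) \<noteq> \<zero>"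
  by (induction n) (auto simp: integral_iff)

locale fps_prime_quotient = principal_domain R + I: primeideal I "fps_ring R" for R (structure) and I
begin

abbreviation "B \<equiv> F Quot I"
abbreviation "\<pi> \<equiv> (+>\<^bsub>F\<^esub>) I"
abbreviation "\<xi> \<equiv> \<pi> (fps_var R)"

interpretation B: domain B by (rule I.quotient_is_domain)
interpretation \<pi>: ring_hom_ring F B \<pi> by (rule I.rcos_ring_hom_ring)

lemma \<pi>_zero_iff:
  assumes "f \<in> carrier F" shows "\<pi> f = \<zero>\<^bsub>B\<^esub> \<longleftrightarrow> f \<in> I"
proof -
  have "f \<ominus>\<^bsub>F\<^esub> \<zero>\<^bsub>F\<^esub> = f" using assms by (simp add: a_minus_def)
  then show ?thesis
    using I.quotient_eq_iff_same_a_r_cos[OF I.is_ideal assms I.zero_closed]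
    unfolding I.FactRing_ops(4) by metis
qed

lemma \<pi>_surj: "carrier B = \<pi> ` carrier F"
  by (rule I.FactRing_carrier)

definition \<phi> :: "'a \<Rightarrow> (nat \<Rightarrow> 'a) set" where
  "\<phi> c = \<pi> (fps_scalar R c)"

lemma \<phi>_hom: "\<phi> \<in> ring_hom R B"
  using ring_hom_trans[OF fps_scalar_hom I.rcos_ring_hom] unfolding \<phi>_def comp_def .

interpretation \<phi>: ring_hom_ring R B \<phi>
  by (rule ring_hom_ringI2[OF ring_axioms B.ring_axioms \<phi>_hom])

lemma x_closed: "\<xi> \<in> carrier B"
  using fps_var_closed by simp

lemma \<pi>_decompose:
  assumes "f \<in> carrier F"
  shows "\<pi> f = \<phi> (f 0) \<oplus>\<^bsub>B\<^esub> \<xi> \<otimes>\<^bsub>B\<^esub> \<pi> (fps_shift f)"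
proof -
  have "\<pi> f = \<pi> (fps_scalar R (f 0) \<oplus>\<^bsub>F\<^esub> fps_var R \<otimes>\<^bsub>F\<^esub> fps_shift f)"
    by (rule arg_cong[OF fps_decompose[OF assms]])
  also have "\<dots> = \<phi> (f 0) \<oplus>\<^bsub>B\<^esub> \<xi> \<otimes>\<^bsub>B\<^esub> \<pi> (fps_shift f)"
    unfolding \<phi>_def using assms by (simp add: fps_scalar_closed fps_coeff_closed fps_var_closed fps_shift_closed)
  finally show ?thesis .
qed

definition J :: "'a set" where
  "J = {c \<in> carrier R. fps_scalar R c \<in> I}"

lemma J_iff: "c \<in> carrier R \<Longrightarrow> c \<in> J \<longleftrightarrow> \<phi> c = \<zero>\<^bsub>B\<^esub>"
  unfolding J_def \<phi>_def using \<pi>_zero_iff[OF fps_scalar_closed] by simp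

lemma J_kernel: "J = a_kernel R B \<phi>"
  unfolding a_kernel_def' using J_iff J_def by auto

lemma J_prime: "primeideal J R"
proof (rule primeidealI)
  show "ideal J R" unfolding J_kernel by (rule \<phi>.kernel_is_ideal)
  show "cring R" by (rule cring_axioms)
  show "carrier R \<noteq> J"
  proof
    assume "carrier R = J"
    then have "\<one> \<in> J" using one_closed by blast
    then have "\<phi> \<one> = \<zero>\<^bsub>B\<^esub>" using J_iff[OF one_closed] by blast
    then show False using B.one_not_zero \<phi>.hom_one by simp
  qed
  fix a b assume ab: "a \<in> carrier R" "b \<in> carrier R" "a \<otimes> b \<in> J"
  then have "\<phi> a \<otimes>\<^bsub>B\<^esub> \<phi> b = \<zero>\<^bsub>B\<^esub>" using J_iff[of "a \<otimes> b"] by simp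
  then show "a \<in> J \<or> b \<in> J" using B.integral ab J_iff by simp
qed

text \<open>Once the variable is killed, each class is the class of its constant term, so constants
  already exhaust the quotient.\<close>

lemma quotient_if_var_mem:
  assumes X: "fps_var R \<in> I"
  shows "R Quot J \<simeq> B"
proof -
  have "\<phi> ` carrier R = carrier B"
  proof (intro equalityI subsetI)
    fix b assume "b \<in> carrier B"
    then obtain f where f: "f \<in> carrier F" "b = \<pi> f" unfolding \<pi>_surj by blast
    have "\<xi> = \<zero>\<^bsub>B\<^esub>" using X \<pi>_zero_iff[OF fps_var_closed] by simp
    then have "b = \<phi> (f 0)" unfolding f(2) \<pi>_decompose[OF f(1)]
      using f(1) by (simp add: fps_shift_closed fps_coeff_closed)
    then show "b \<in> \<phi> ` carrier R" using fps_coeff_closed[OF f(1)] by blast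
  qed auto
  then show ?thesis unfolding J_kernel by (rule \<phi>.FactRing_iso)
qed

text \<open>A weak substitute for Weierstrass preparation: modulo \<open>K\<close> the series
  becomes a power of the variable times a series whose constant term survives. For \<open>K\<close>
  maximal that constant term is invertible modulo \<open>K\<close>.\<close>

lemma least_coeff_outside:
  assumes K: "ideal K R" and f: "f \<in> carrier F" "\<not> (\<forall>n. f n \<in> K)"
  obtains n g u where "g \<in> carrier F" "u \<in> carrier F" "\<And>i. g i \<in> K" "u 0 \<notin> K"
    "f = g \<oplus>\<^bsub>F\<^esub> fps_var R [^]\<^bsub>F\<^esub> (n::nat) \<otimes>\<^bsub>F\<^esub> u"
proof -
  interpret K: ideal K R by fact
  define n where "n = (LEAST n. f n \<notin> K)"
  have n: "f n \<notin> K" unfolding n_def using f(2) by (metis (mono_tags, lifting) LeastI)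
  have ln: "f i \<in> K" if "i < n" for i using that not_less_Least unfolding n_def by blast
  define g where "g i = (if i < n then f i else \<zero>)" for i
  define d where "d i = (if i < n then \<zero> else f i)" for i
  have g: "g \<in> carrier F" unfolding fps_carrier g_def using fps_coeff_closed[OF f(1)] by simp
  have d: "d \<in> carrier F" unfolding fps_carrier d_def using fps_coeff_closed[OF f(1)] by simp
  have fgd: "f = g \<oplus>\<^bsub>F\<^esub> d" by (rule ext) (simp add: fps_add g_def d_def fps_coeff_closed[OF f(1)])
  have "fps_var R [^]\<^bsub>F\<^esub> n divides\<^bsub>F\<^esub> d" using fps_var_pow_divides_iff[OF d, of n] by (simp add: d_def)
  then obtain u where u: "u \<in> carrier F" "d = fps_var R [^]\<^bsub>F\<^esub> n \<otimes>\<^bsub>F\<^esub> u" unfolding factor_def by blast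
  have "u 0 = d n" using fps_var_pow_mult_coeff[OF u(1), of n] u(2) by simp
  then have "u 0 = f n" unfolding d_def by simp
  moreover have "g i \<in> K" for i unfolding g_def using ln by simp
  ultimately show thesis using that[OF g u(1), of n] fgd u(2) n by simp
qed

text \<open>The point is that \<open>I\<close> consists of exactly the series with all coefficients
  in \<open>J\<close>, so it is the kernel of coefficientwise reduction.\<close>

lemma quotient_if_constant_mem:
  assumes X: "fps_var R \<notin> I" and J: "J \<noteq> {\<zero>}"
  shows "maximalideal J R" "B \<simeq> fps_ring (R Quot J)"
proof -
  obtain p where p: "p \<in> carrier R" "p \<noteq> \<zero>" "J = PIdl p" and max: "maximalideal J R"
    by (rule nonzero_prime_maximal[OF J_prime J])
  show "maximalideal J R" by fact
  interpret J: primeideal J R by (rule J_prime)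
  interpret pm: pid_maximal R p
    by (intro pid_maximal.intro pid_maximal_axioms.intro principal_domain_axioms p(1)) (use max p(3) in simp)
  have Q: "cring (R Quot J)" by (rule J.quotient_is_cring[OF cring_axioms])
  interpret Q: cring "R Quot J" by (rule Q)
  let ?h = "\<lambda>f n. J +> f n"
  have hom: "?h \<in> ring_hom F (fps_ring (R Quot J))" by (rule fps_coeff_hom[OF Q J.rcos_ring_hom])
  interpret h: ring_hom_ring F "fps_ring (R Quot J)" ?h
    by (rule ring_hom_ringI2[OF I.ring_axioms cring.axioms(1)[OF Q.fps_cring] hom])
  have J0: "J +> c = \<zero>\<^bsub>R Quot J\<^esub> \<longleftrightarrow> c \<in> J" if "c \<in> carrier R" for c
  proof -
    have "c \<ominus> \<zero> = c" using that by (simp add: a_minus_def)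
    then show ?thesis using quotient_eq_iff_same_a_r_cos[OF J.is_ideal that zero_closed]
      unfolding J.FactRing_ops(4) by metis
  qed
  have ker: "a_kernel F (fps_ring (R Quot J)) ?h = {f \<in> carrier F. \<forall>n. f n \<in> J}"
    unfolding a_kernel_def' using J0 fps_coeff_closed by (auto simp: fun_eq_iff Q.fps_zero)
  have in_I: "f \<in> I" if f: "f \<in> carrier F" "\<And>n. f n \<in> J" for f
  proof -
    have "\<exists>c. c \<in> carrier R \<and> f n = p \<otimes> c" for n
      using f(2)[of n] p mem_cgenideal_iff unfolding factor_def by auto
    then obtain g where g: "\<And>n. g n \<in> carrier R" "\<And>n. f n = p \<otimes> g n" by metis
    have gF: "g \<in> carrier F" unfolding fps_carrier using g(1) by simp
    have "f = fps_scalar R p \<otimes>\<^bsub>F\<^esub> g" unfolding fps_scalar_mult[OF gF p(1)] using g(2) by (rule ext)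
    moreover have "p \<in> J" using cgenideal_self[OF p(1)] p(3) by simp
    then have "fps_scalar R p \<in> I" unfolding J_def by simp
    ultimately show ?thesis using I.I_r_closed[of "fps_scalar R p" g] gF by simp
  qed
  \<comment> \<open>A coefficient outside \<open>J\<close> would put a power of the variable times
    \<open>u\<close> into \<open>I\<close>, hence \<open>u\<close> itself. The constant term of
    \<open>u\<close> is invertible modulo \<open>p\<close>, and \<open>p\<close> is zero in the
    quotient, so a multiple of \<open>u\<close> agrees modulo \<open>I\<close> with a series having
    constant term 1, a unit.\<close>
  have "f n \<in> J" if f: "f \<in> I" for f n
  proof (rule ccontr)
    assume "f n \<notin> J"
    then have nf: "\<not> (\<forall>n. f n \<in> J)" by blast
    have fF: "f \<in> carrier F" using f I.Icarr by blast
    obtain n g u where *: "g \<in> carrier F" "u \<in> carrier F" "\<And>i. g i \<in> J" "u 0 \<notin> J"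
      "f = g \<oplus>\<^bsub>F\<^esub> fps_var R [^]\<^bsub>F\<^esub> (n::nat) \<otimes>\<^bsub>F\<^esub> u"
      by (rule least_coeff_outside[OF J.is_ideal fF nf]) (rule that)
    have "\<pi> f = \<zero>\<^bsub>B\<^esub>" "\<pi> g = \<zero>\<^bsub>B\<^esub>" using \<pi>_zero_iff fF f in_I[OF *(1,3)] *(1) by auto
    then have "\<pi> (fps_var R [^]\<^bsub>F\<^esub> n) \<otimes>\<^bsub>B\<^esub> \<pi> u = \<zero>\<^bsub>B\<^esub>" using *(1,2) fps_var_closed unfolding *(5) by simp
    moreover have "\<pi> (fps_var R [^]\<^bsub>F\<^esub> n) = \<xi> [^]\<^bsub>B\<^esub> n" by (induction n) (auto simp: fps_var_closed)
    moreover have "\<xi> \<noteq> \<zero>\<^bsub>B\<^esub>" using X \<pi>_zero_iff[OF fps_var_closed] by simp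
    then have "\<xi> [^]\<^bsub>B\<^esub> n \<noteq> \<zero>\<^bsub>B\<^esub>" using B.pow_nonzero[OF x_closed] by blast
    ultimately have "\<pi> u = \<zero>\<^bsub>B\<^esub>" using B.integral[of "\<xi> [^]\<^bsub>B\<^esub> n" "\<pi> u"] x_closed *(2) by auto
    then have pu: "\<phi> (u 0) \<oplus>\<^bsub>B\<^esub> \<xi> \<otimes>\<^bsub>B\<^esub> \<pi> (fps_shift u) = \<zero>\<^bsub>B\<^esub>" using \<pi>_decompose[OF *(2)] by simp
    have u0: "u 0 \<in> carrier R" using fps_coeff_closed[OF *(2)] .
    have "\<not> p divides (u 0)" using *(4) p mem_cgenideal_iff by simp
    from pm.invertible_mod_p[OF u0 this]
    obtain b c where b: "b \<in> carrier R" "c \<in> carrier R" "u 0 \<otimes> b \<oplus> p \<otimes> c = \<one>" .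
    let ?s = "fps_shift u \<otimes>\<^bsub>F\<^esub> fps_scalar R b"
    let ?g = "fps_scalar R \<one> \<oplus>\<^bsub>F\<^esub> fps_var R \<otimes>\<^bsub>F\<^esub> ?s"
    have sc: "?s \<in> carrier F" using *(2) b(1) by (simp add: fps_shift_closed fps_scalar_closed)
    have gc: "?g \<in> carrier F" using sc by (simp add: fps_scalar_closed fps_var_closed)
    have bc: "\<phi> b \<in> carrier B" "\<phi> (u 0) \<in> carrier B" "\<pi> (fps_shift u) \<in> carrier B"
      using b u0 fps_shift_closed[OF *(2)] by auto
    have "\<phi> p = \<zero>\<^bsub>B\<^esub>" using J_iff[OF p(1)] cgenideal_self[OF p(1)] p(3) by simp
    then have "\<phi> (u 0 \<otimes> b \<oplus> p \<otimes> c) = \<phi> (u 0) \<otimes>\<^bsub>B\<^esub> \<phi> b" using u0 b(1,2) p(1) by simp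
    then have one: "\<phi> (u 0) \<otimes>\<^bsub>B\<^esub> \<phi> b = \<phi> \<one>" unfolding b(3) by simp
    have "\<pi> ?g = \<phi> \<one> \<oplus>\<^bsub>B\<^esub> \<xi> \<otimes>\<^bsub>B\<^esub> (\<pi> (fps_shift u) \<otimes>\<^bsub>B\<^esub> \<phi> b)"
      unfolding \<phi>_def using *(2) b(1) by (simp add: fps_scalar_closed fps_var_closed fps_shift_closed)
    also have "\<dots> = (\<phi> (u 0) \<oplus>\<^bsub>B\<^esub> \<xi> \<otimes>\<^bsub>B\<^esub> \<pi> (fps_shift u)) \<otimes>\<^bsub>B\<^esub> \<phi> b"
      unfolding one[symmetric] using bc x_closed by (simp only: B.l_distr B.m_assoc B.m_closed)
    also have "\<dots> = \<zero>\<^bsub>B\<^esub>" unfolding pu using bc by simp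
    finally have "?g \<in> I" using \<pi>_zero_iff[OF gc] by simp
    moreover have "?g \<in> Units F"
      by (rule fps_unit[OF gc]) (simp add: fps_add fps_var_mult[OF sc] fps_scalar_def)
    ultimately have "\<one>\<^bsub>F\<^esub> \<in> I" using I.I_l_closed I.Units_l_inv_ex by metis
    then show False using I.one_imp_carrier I.I_notcarr by blast
  qed
  then have "I = {f \<in> carrier F. \<forall>n. f n \<in> J}" using in_I I.Icarr by blast
  then have "B = F Quot (a_kernel F (fps_ring (R Quot J)) ?h)" unfolding ker by simp
  also have "\<dots> \<simeq> fps_ring (R Quot J)"
    by (rule h.FactRing_iso) (rule fps_coeff_surj, simp add: J.FactRing_carrier)
  finally show "B \<simeq> fps_ring (R Quot J)" .
qed

end

section \<open>Primes containing neither the variable nor a nonzero constant\<close>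

context domain
begin

text \<open>The lowest coefficient of the product is \<open>g 0\<close> times the lowest coefficient
  of \<open>k\<close>, and in a domain it does not vanish.\<close>

lemma fps_var_pow_cancel:
  assumes g: "g \<in> carrier F" "g 0 \<noteq> \<zero>" and k: "k \<in> carrier F"
  shows "fps_var R [^]\<^bsub>F\<^esub> (n::nat) divides\<^bsub>F\<^esub> (g \<otimes>\<^bsub>F\<^esub> k) \<Longrightarrow> fps_var R [^]\<^bsub>F\<^esub> n divides\<^bsub>F\<^esub> k"
proof (induction n)
  interpret F: cring F by (rule fps_cring)
  case 0
  show ?case using k by (auto simp: factor_def)
next
  interpret F: cring F by (rule fps_cring)
  case (Suc n)
  have gk: "g \<otimes>\<^bsub>F\<^esub> k \<in> carrier F" using g k by simp
  have z: "\<forall>i<Suc n. (g \<otimes>\<^bsub>F\<^esub> k) i = \<zero>" using Suc.prems fps_var_pow_divides_iff[OF gk] by blast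
  then have "\<forall>i<n. (g \<otimes>\<^bsub>F\<^esub> k) i = \<zero>" by simp
  then have "fps_var R [^]\<^bsub>F\<^esub> n divides\<^bsub>F\<^esub> k" using Suc.IH fps_var_pow_divides_iff[OF gk] by blast
  then obtain l where l: "l \<in> carrier F" "k = fps_var R [^]\<^bsub>F\<^esub> n \<otimes>\<^bsub>F\<^esub> l" unfolding factor_def by blast
  have "g \<otimes>\<^bsub>F\<^esub> k = fps_var R [^]\<^bsub>F\<^esub> n \<otimes>\<^bsub>F\<^esub> (g \<otimes>\<^bsub>F\<^esub> l)" unfolding l(2) using g l(1) fps_var_closed by (simp add: F.m_ac)
  then have "(g \<otimes>\<^bsub>F\<^esub> k) n = g 0 \<otimes> l 0"
    using fps_var_pow_mult_coeff[of "g \<otimes>\<^bsub>F\<^esub> l" n] g l(1) by (simp add: fps_mult_0)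
  then have "l 0 = \<zero>" using z g integral fps_coeff_closed[OF g(1)] fps_coeff_closed[OF l(1)] by (metis lessI)
  then have "k n = \<zero>" unfolding l(2) using fps_var_pow_mult_coeff[OF l(1), of n] by simp
  moreover have "\<forall>i<n. k i = \<zero>" using \<open>fps_var R [^]\<^bsub>F\<^esub> n divides\<^bsub>F\<^esub> k\<close> fps_var_pow_divides_iff[OF k] by blast
  ultimately show ?case using fps_var_pow_divides_iff[OF k, of "Suc n"] by (simp add: less_Suc_eq)
qed

end

context fps_prime_quotient
begin

interpretation B: domain B by (rule I.quotient_is_domain)
interpretation \<pi>: ring_hom_ring F B \<pi> by (rule I.rcos_ring_hom_ring)
interpretation \<phi>: ring_hom_ring R B \<phi>
  by (rule ring_hom_ringI2[OF ring_axioms B.ring_axioms \<phi>_hom])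
interpretation FX: adic F "fps_var R" by (rule fps_adic)

text \<open>By \<open>C_repr\<close> and \<open>coeff_0_in_C\<close> this is the ideal of constant
  terms of members of \<open>I\<close>. Defined as the kernel of the map from \<open>R\<close> to
  \<open>B\<close> modulo \<open>\<xi>\<close>, it is visibly an ideal and translates divisibility
  by \<open>\<xi>\<close> into membership.\<close>

definition C :: "'a set" where
  "C = {c \<in> carrier R. \<phi> c \<in> PIdl\<^bsub>B\<^esub> \<xi>}"

lemma C_ideal: "ideal C R"
  unfolding C_def by (rule \<phi>.ideal_vimage[OF B.cgenideal_ideal[OF x_closed]])

lemma C_iff: "c \<in> carrier R \<Longrightarrow> c \<in> C \<longleftrightarrow> \<xi> divides\<^bsub>B\<^esub> \<phi> c"
  unfolding C_def using B.mem_cgenideal_iff[OF x_closed] by simp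

lemma C_repr:
  assumes "c \<in> C" obtains f where "f \<in> I" "f 0 = c"
proof -
  have c: "c \<in> carrier R" using assms ideal.Icarr[OF C_ideal] by blast
  then obtain b where b: "b \<in> carrier B" "\<phi> c = \<xi> \<otimes>\<^bsub>B\<^esub> b" using assms C_iff unfolding factor_def by blast
  obtain k where k: "k \<in> carrier F" "b = \<pi> k" using b(1) unfolding \<pi>_surj by blast
  let ?f = "fps_scalar R c \<oplus>\<^bsub>F\<^esub> fps_var R \<otimes>\<^bsub>F\<^esub> (\<ominus>\<^bsub>F\<^esub> k)"
  have kc: "\<ominus>\<^bsub>F\<^esub> k \<in> carrier F" using k by simp
  have fc: "?f \<in> carrier F" using kc c by (simp add: fps_scalar_closed)
  have "\<pi> ?f = \<phi> c \<oplus>\<^bsub>B\<^esub> \<xi> \<otimes>\<^bsub>B\<^esub> (\<ominus>\<^bsub>B\<^esub> b)"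
    unfolding \<phi>_def using k c by (simp add: fps_scalar_closed)
  also have "\<dots> = \<zero>\<^bsub>B\<^esub>" unfolding b(2) using b(1) x_closed by (simp add: B.r_minus B.r_neg)
  finally have "?f \<in> I" using \<pi>_zero_iff[OF fc] by simp
  moreover have "?f 0 = c" using c by (simp add: fps_add fps_var_mult[OF kc] fps_scalar_def)
  ultimately show thesis using that by blast
qed

lemma coeff_0_in_C:
  assumes "f \<in> I" shows "f 0 \<in> C"
proof -
  have f: "f \<in> carrier F" using assms I.Icarr by blast
  have sc: "\<pi> (fps_shift f) \<in> carrier B" using fps_shift_closed[OF f] by simp
  have fc: "\<phi> (f 0) \<in> carrier B" using fps_coeff_closed[OF f] by simp
  have "\<phi> (f 0) \<oplus>\<^bsub>B\<^esub> \<xi> \<otimes>\<^bsub>B\<^esub> \<pi> (fps_shift f) = \<zero>\<^bsub>B\<^esub>" using \<pi>_decompose[OF f] assms \<pi>_zero_iff[OF f] by simp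
  then have "\<phi> (f 0) = \<ominus>\<^bsub>B\<^esub> (\<xi> \<otimes>\<^bsub>B\<^esub> \<pi> (fps_shift f))"
    using fc sc x_closed by (simp add: B.add.inv_equality B.minus_equality)
  also have "\<dots> = \<xi> \<otimes>\<^bsub>B\<^esub> (\<ominus>\<^bsub>B\<^esub> \<pi> (fps_shift f))" using sc x_closed by (simp add: B.r_minus)
  finally show ?thesis using C_iff[OF fps_coeff_closed[OF f]] sc unfolding factor_def by (metis B.a_inv_closed)
qed

lemma one_not_in_C: "\<one> \<notin> C"
proof
  assume "\<one> \<in> C"
  then obtain f where f: "f \<in> I" "f 0 = \<one>" by (rule C_repr)
  then have "f \<in> Units F" using fps_unit I.Icarr by blast
  then have "\<one>\<^bsub>F\<^esub> \<in> I" using I.I_l_closed[OF f(1)] I.Units_l_inv_ex by metis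
  then show False using I.one_imp_carrier I.I_notcarr by blast
qed

lemma x_nonunit: "\<xi> \<notin> Units B"
proof
  assume "\<xi> \<in> Units B"
  then obtain b where "b \<in> carrier B" "\<xi> \<otimes>\<^bsub>B\<^esub> b = \<one>\<^bsub>B\<^esub>" using B.Units_r_inv_ex by blast
  then have "\<xi> divides\<^bsub>B\<^esub> \<phi> \<one>" unfolding factor_def \<phi>.hom_one by metis
  then show False using one_not_in_C C_iff[OF one_closed] by simp
qed

lemma B_decompose: "b \<in> carrier B \<Longrightarrow> \<exists>a\<in>carrier R. \<exists>c\<in>carrier B. b = \<phi> a \<oplus>\<^bsub>B\<^esub> \<xi> \<otimes>\<^bsub>B\<^esub> c"
proof -
  assume "b \<in> carrier B"
  then obtain f where f: "f \<in> carrier F" "b = \<pi> f" unfolding \<pi>_surj by blast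
  have "\<pi> (fps_shift f) \<in> carrier B" using fps_shift_closed[OF f(1)] by simp
  then show ?thesis unfolding f(2) using \<pi>_decompose[OF f(1)] fps_coeff_closed[OF f(1)] by blast
qed

text \<open>A multiple of \<open>g\<close> cancels the constant term of \<open>f\<close>. What
  remains is the variable times a series that again belongs to \<open>I\<close>, since
  \<open>I\<close> is prime and does not contain the variable. Iteration produces the coefficients
  of the cofactor.\<close>

lemma I_generated:
  assumes X: "fps_var R \<notin> I" and c: "c \<in> carrier R" "C = PIdl c" and g: "g \<in> I" "g 0 = c"
  shows "f \<in> I \<Longrightarrow> \<exists>h\<in>carrier F. f = h \<otimes>\<^bsub>F\<^esub> g"
proof -
  assume fI: "f \<in> I"
  have gF: "g \<in> carrier F" using g I.Icarr by blast
  have "\<exists>a\<in>carrier R. \<exists>f'\<in>I. f = fps_scalar R a \<otimes>\<^bsub>F\<^esub> g \<oplus>\<^bsub>F\<^esub> fps_var R \<otimes>\<^bsub>F\<^esub> f'" if f: "f \<in> I" for f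
  proof -
    have fF: "f \<in> carrier F" using f I.Icarr by blast
    obtain a where a: "a \<in> carrier R" "f 0 = a \<otimes> c"
      using coeff_0_in_C[OF f] unfolding c(2) cgenideal_def by blast
    let ?s = "fps_scalar R a \<otimes>\<^bsub>F\<^esub> g"
    have sI: "?s \<in> I" using I.I_l_closed[OF g(1)] fps_scalar_closed[OF a(1)] by blast
    have sF: "?s \<in> carrier F" using sI I.Icarr by blast
    let ?d = "f \<ominus>\<^bsub>F\<^esub> ?s"
    have dI: "?d \<in> I" using f sI by (simp add: a_minus_def)
    have dF: "?d \<in> carrier F" using dI I.Icarr by blast
    have "f = ?s \<oplus>\<^bsub>F\<^esub> ?d" using fF sF by algebra
    then have "f 0 = ?s 0 \<oplus> ?d 0" using fps_add by metis
    moreover have "?s 0 = a \<otimes> c" using fps_scalar_mult[OF gF a(1)] g(2) by simp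
    ultimately have "a \<otimes> c = a \<otimes> c \<oplus> ?d 0" using a(2) by simp
    then have d0: "?d 0 = \<zero>" using a(1) c(1) fps_coeff_closed[OF dF] by (metis add.l_cancel_one' m_closed)
    have "?d = fps_var R \<otimes>\<^bsub>F\<^esub> fps_shift ?d"
    proof
      fix i show "?d i = (fps_var R \<otimes>\<^bsub>F\<^esub> fps_shift ?d) i"
        using d0 fps_var_mult[OF fps_shift_closed[OF dF]] by (cases i) (auto simp: fps_shift_def)
    qed
    moreover from this have "fps_shift ?d \<in> I"
      using dI X I.I_prime[OF fps_var_closed fps_shift_closed[OF dF]] by simp
    ultimately show ?thesis using \<open>f = ?s \<oplus>\<^bsub>F\<^esub> ?d\<close> a(1) by metis
  qed
  then obtain \<alpha> \<gamma> where step: "\<And>f. f \<in> I \<Longrightarrow> \<alpha> f \<in> carrier R \<and> \<gamma> f \<in> I \<and>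
      f = fps_scalar R (\<alpha> f) \<otimes>\<^bsub>F\<^esub> g \<oplus>\<^bsub>F\<^esub> fps_var R \<otimes>\<^bsub>F\<^esub> \<gamma> f" by metis
  define e where "e j = (\<gamma> ^^ j) f" for j
  have eI: "e j \<in> I" for j unfolding e_def by (induction j) (use fI step in auto)
  have eF: "e j \<in> carrier F" for j using eI I.Icarr by blast
  define h where "h j = \<alpha> (e j)" for j
  have hc: "h j \<in> carrier R" for j unfolding h_def using step[OF eI] by blast
  define H where "H j = (\<lambda>n. h (n + j))" for j
  have HF: "H j \<in> carrier F" for j unfolding fps_carrier H_def using hc by blast
  \<comment> \<open>The successive remainders \<open>e j\<close> and the products
    \<open>H j \<otimes> g\<close>, with \<open>H j\<close> the tails of the cofactor, solve the
    same Horner recursion.\<close>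
  have "e 0 = H 0 \<otimes>\<^bsub>F\<^esub> g"
  proof (rule FX.horner_unique[where e=e and e'="\<lambda>j. H j \<otimes>\<^bsub>F\<^esub> g" and d="\<lambda>j. fps_scalar R (h j) \<otimes>\<^bsub>F\<^esub> g"])
    fix j
    have "e (Suc j) = \<gamma> (e j)" unfolding e_def by simp
    then show "e j = fps_scalar R (h j) \<otimes>\<^bsub>F\<^esub> g \<oplus>\<^bsub>F\<^esub> fps_var R \<otimes>\<^bsub>F\<^esub> e (Suc j)"
      using step[OF eI[of j]] unfolding h_def by metis
    have "H (Suc j) = fps_shift (H j)" unfolding H_def fps_shift_def by simp
    then have "H j = fps_scalar R (h j) \<oplus>\<^bsub>F\<^esub> fps_var R \<otimes>\<^bsub>F\<^esub> H (Suc j)"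
      using fps_decompose[OF HF[of j]] by (simp add: H_def)
    then have "H j \<otimes>\<^bsub>F\<^esub> g = (fps_scalar R (h j) \<oplus>\<^bsub>F\<^esub> fps_var R \<otimes>\<^bsub>F\<^esub> H (Suc j)) \<otimes>\<^bsub>F\<^esub> g" by (rule arg_cong)
    also have "\<dots> = fps_scalar R (h j) \<otimes>\<^bsub>F\<^esub> g \<oplus>\<^bsub>F\<^esub> fps_var R \<otimes>\<^bsub>F\<^esub> (H (Suc j) \<otimes>\<^bsub>F\<^esub> g)"
      using fps_scalar_closed[OF hc[of j]] HF[of "Suc j"] gF fps_var_closed by (simp add: I.l_distr I.m_assoc)
    finally show "H j \<otimes>\<^bsub>F\<^esub> g = fps_scalar R (h j) \<otimes>\<^bsub>F\<^esub> g \<oplus>\<^bsub>F\<^esub> fps_var R \<otimes>\<^bsub>F\<^esub> (H (Suc j) \<otimes>\<^bsub>F\<^esub> g)" .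
  qed (use eF HF gF fps_scalar_closed[OF hc] in auto)
  moreover have "e 0 = f" by (simp add: e_def)
  ultimately show ?thesis using HF by auto
qed

text \<open>The Horner form passes to quotients. Separatedness means that the ideal of
  \<open>g\<close> is closed: cofactors \<open>h n\<close> that reproduce \<open>f\<close> modulo
  the \<open>n\<close>-th power of the variable form a Cauchy sequence, since
  \<open>g 0 \<noteq> \<zero>\<close> permits cancelling \<open>g\<close> in such divisibilities,
  and their limit is an exact cofactor.\<close>

lemma quotient_adic:
  assumes X: "fps_var R \<notin> I" and c: "c \<in> carrier R" "C = PIdl c" "c \<noteq> \<zero>" and g: "g \<in> I" "g 0 = c"
  shows "adic B \<xi>"
proof -
  have gF: "g \<in> carrier F" using g I.Icarr by blast
  have pow: "\<pi> (fps_var R [^]\<^bsub>F\<^esub> n) = \<xi> [^]\<^bsub>B\<^esub> n" for n :: nat by (induction n) (auto simp: fps_var_closed)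
  show ?thesis
  proof unfold_locales
    show "\<xi> \<in> carrier B" by (rule x_closed)
  next
    fix z assume z: "z \<in> carrier B" "\<And>n::nat. \<xi> [^]\<^bsub>B\<^esub> n divides\<^bsub>B\<^esub> z"
    obtain f where f: "f \<in> carrier F" "z = \<pi> f" using z(1) unfolding \<pi>_surj by blast
    have "\<exists>h. h \<in> carrier F \<and> fps_var R [^]\<^bsub>F\<^esub> n divides\<^bsub>F\<^esub> (f \<ominus>\<^bsub>F\<^esub> h \<otimes>\<^bsub>F\<^esub> g)" for n :: nat
    proof -
      obtain b where b: "b \<in> carrier B" "z = \<xi> [^]\<^bsub>B\<^esub> n \<otimes>\<^bsub>B\<^esub> b" using z(2)[of n] unfolding factor_def by blast
      obtain u where u: "u \<in> carrier F" "b = \<pi> u" using b(1) unfolding \<pi>_surj by blast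
      let ?w = "fps_var R [^]\<^bsub>F\<^esub> n \<otimes>\<^bsub>F\<^esub> u"
      have wF: "?w \<in> carrier F" using u(1) fps_var_closed by simp
      have "\<pi> (f \<ominus>\<^bsub>F\<^esub> ?w) = \<zero>\<^bsub>B\<^esub>"
        using f u b wF pow fps_var_closed by (simp add: a_minus_def B.r_neg)
      then have "f \<ominus>\<^bsub>F\<^esub> ?w \<in> I" using \<pi>_zero_iff f(1) wF by simp
      then obtain h where h: "h \<in> carrier F" "f \<ominus>\<^bsub>F\<^esub> ?w = h \<otimes>\<^bsub>F\<^esub> g" using I_generated[OF X c(1,2) g] by blast
      have "f \<ominus>\<^bsub>F\<^esub> h \<otimes>\<^bsub>F\<^esub> g = ?w" unfolding h(2)[symmetric] using f(1) wF by algebra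
      then show ?thesis using h(1) u(1) unfolding factor_def by blast
    qed
    then obtain h where h: "\<And>n. h n \<in> carrier F" "\<And>n::nat. fps_var R [^]\<^bsub>F\<^esub> n divides\<^bsub>F\<^esub> (f \<ominus>\<^bsub>F\<^esub> h n \<otimes>\<^bsub>F\<^esub> g)" by metis
    have "fps_var R [^]\<^bsub>F\<^esub> n divides\<^bsub>F\<^esub> (h (Suc n) \<ominus>\<^bsub>F\<^esub> h n)" for n
    proof (rule fps_var_pow_cancel[OF gF])
      have "fps_var R [^]\<^bsub>F\<^esub> n divides\<^bsub>F\<^esub> (f \<ominus>\<^bsub>F\<^esub> h (Suc n) \<otimes>\<^bsub>F\<^esub> g)"
        using I.divides_trans[OF I.divides_pow_mono h(2)[of "Suc n"]] fps_var_closed by simp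
      then have "fps_var R [^]\<^bsub>F\<^esub> n divides\<^bsub>F\<^esub> ((f \<ominus>\<^bsub>F\<^esub> h n \<otimes>\<^bsub>F\<^esub> g) \<ominus>\<^bsub>F\<^esub> (f \<ominus>\<^bsub>F\<^esub> h (Suc n) \<otimes>\<^bsub>F\<^esub> g))"
        by (rule I.divides_diff[OF I.nat_pow_closed[OF fps_var_closed] h(2)])
      moreover have "(f \<ominus>\<^bsub>F\<^esub> h n \<otimes>\<^bsub>F\<^esub> g) \<ominus>\<^bsub>F\<^esub> (f \<ominus>\<^bsub>F\<^esub> h (Suc n) \<otimes>\<^bsub>F\<^esub> g) = g \<otimes>\<^bsub>F\<^esub> (h (Suc n) \<ominus>\<^bsub>F\<^esub> h n)"
        using f(1) gF h(1)[of n] h(1)[of "Suc n"] by algebra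
      ultimately show "fps_var R [^]\<^bsub>F\<^esub> n divides\<^bsub>F\<^esub> (g \<otimes>\<^bsub>F\<^esub> (h (Suc n) \<ominus>\<^bsub>F\<^esub> h n))" by simp
    qed (use g c h in auto)
    from FX.cauchy[OF h(1) this]
    obtain l where l: "l \<in> carrier F" "\<And>n. fps_var R [^]\<^bsub>F\<^esub> n divides\<^bsub>F\<^esub> (l \<ominus>\<^bsub>F\<^esub> h n)" by blast
    have "f \<ominus>\<^bsub>F\<^esub> l \<otimes>\<^bsub>F\<^esub> g = \<zero>\<^bsub>F\<^esub>"
    proof (rule FX.separated)
      fix n :: nat
      have "fps_var R [^]\<^bsub>F\<^esub> n divides\<^bsub>F\<^esub> (g \<otimes>\<^bsub>F\<^esub> (l \<ominus>\<^bsub>F\<^esub> h n))"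
        by (rule I.divides_prod_r(2)) (use l gF fps_var_closed in auto)
      then have "fps_var R [^]\<^bsub>F\<^esub> n divides\<^bsub>F\<^esub> ((f \<ominus>\<^bsub>F\<^esub> h n \<otimes>\<^bsub>F\<^esub> g) \<ominus>\<^bsub>F\<^esub> g \<otimes>\<^bsub>F\<^esub> (l \<ominus>\<^bsub>F\<^esub> h n))"
        by (rule I.divides_diff[OF I.nat_pow_closed[OF fps_var_closed] h(2)])
      moreover have "(f \<ominus>\<^bsub>F\<^esub> h n \<otimes>\<^bsub>F\<^esub> g) \<ominus>\<^bsub>F\<^esub> g \<otimes>\<^bsub>F\<^esub> (l \<ominus>\<^bsub>F\<^esub> h n) = f \<ominus>\<^bsub>F\<^esub> l \<otimes>\<^bsub>F\<^esub> g"
        using f(1) gF h(1)[of n] l(1) by algebra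
      ultimately show "fps_var R [^]\<^bsub>F\<^esub> n divides\<^bsub>F\<^esub> (f \<ominus>\<^bsub>F\<^esub> l \<otimes>\<^bsub>F\<^esub> g)" by simp
    qed (use f l gF in auto)
    then have "f = l \<otimes>\<^bsub>F\<^esub> g" using f(1) l(1) gF by simp
    then have "f \<in> I" using I.I_l_closed[OF g(1) l(1)] by simp
    then show "z = \<zero>\<^bsub>B\<^esub>" using \<pi>_zero_iff[OF f(1)] f(2) by simp
  next
    fix d :: "nat \<Rightarrow> _" assume "\<And>j. d j \<in> carrier B"
    then have "\<exists>f. f \<in> carrier F \<and> d j = \<pi> f" for j unfolding \<pi>_surj by blast
    then obtain d' where d': "\<And>j. d' j \<in> carrier F" "\<And>j. d j = \<pi> (d' j)" by metis
    obtain e where e: "\<And>j. e j \<in> carrier F" "\<And>j. e j = d' j \<oplus>\<^bsub>F\<^esub> fps_var R \<otimes>\<^bsub>F\<^esub> e (Suc j)"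
      using FX.horner[of d'] d'(1) by blast
    have "\<pi> (e j) = d j \<oplus>\<^bsub>B\<^esub> \<xi> \<otimes>\<^bsub>B\<^esub> \<pi> (e (Suc j))" for j
    proof -
      have "\<pi> (e j) = \<pi> (d' j \<oplus>\<^bsub>F\<^esub> fps_var R \<otimes>\<^bsub>F\<^esub> e (Suc j))" by (rule arg_cong[OF e(2)])
      then show ?thesis using d' e(1)[of "Suc j"] fps_var_closed by simp
    qed
    then show "\<exists>e. (\<forall>j. e j \<in> carrier B) \<and> (\<forall>j. e j = d j \<oplus>\<^bsub>B\<^esub> \<xi> \<otimes>\<^bsub>B\<^esub> e (Suc j))"
      using e(1) by (intro exI[of _ "\<lambda>j. \<pi> (e j)"] conjI allI \<pi>.hom_closed)
  qed
qed

end

section \<open>Powers of the variable against powers of a prime element\<close>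

context fps_prime_quotient
begin

interpretation B: domain B by (rule I.quotient_is_domain)
interpretation \<pi>: ring_hom_ring F B \<pi> by (rule I.rcos_ring_hom_ring)
interpretation \<phi>: ring_hom_ring R B \<phi>
  by (rule ring_hom_ringI2[OF ring_axioms B.ring_axioms \<phi>_hom])

lemma \<pi>_var_pow: "\<pi> (fps_var R [^]\<^bsub>F\<^esub> (n::nat)) = \<xi> [^]\<^bsub>B\<^esub> n"
  by (induction n) (auto simp: fps_var_closed)

text \<open>Modulo \<open>p\<close> the relation given by \<open>g\<close> says that
  \<open>\<xi> [^] n\<close> times the image of \<open>u\<close> vanishes, where \<open>u 0\<close>
  is invertible modulo \<open>p\<close>. Multiplying by that inverse turns the second factor into 1
  plus a multiple of \<open>\<xi>\<close>, a unit by completeness.\<close>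

lemma x_power_divisible:
  assumes ad: "adic B \<xi>" and p: "p \<in> carrier R" "maximalideal (PIdl p) R"
    and g: "g \<in> I" "\<not> (\<forall>n. g n \<in> PIdl p)"
  shows "\<exists>n::nat. \<phi> p divides\<^bsub>B\<^esub> (\<xi> [^]\<^bsub>B\<^esub> n)"
proof -
  interpret ad: adic B \<xi> by fact
  interpret pm: pid_maximal R p
    by (intro pid_maximal.intro pid_maximal_axioms.intro principal_domain_axioms p)
  have gF: "g \<in> carrier F" using g I.Icarr by blast
  obtain n k u where *: "k \<in> carrier F" "u \<in> carrier F" "\<And>i. k i \<in> PIdl p" "u 0 \<notin> PIdl p"
    "g = k \<oplus>\<^bsub>F\<^esub> fps_var R [^]\<^bsub>F\<^esub> (n::nat) \<otimes>\<^bsub>F\<^esub> u"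
    by (rule least_coeff_outside[OF cgenideal_ideal[OF p(1)] gF g(2)]) (rule that)
  have "\<exists>c. c \<in> carrier R \<and> k i = p \<otimes> c" for i
    using *(3)[of i] p mem_cgenideal_iff unfolding factor_def by auto
  then obtain l where l: "\<And>i. l i \<in> carrier R" "\<And>i. k i = p \<otimes> l i" by metis
  have lF: "l \<in> carrier F" unfolding fps_carrier using l(1) by simp
  have kl: "k = fps_scalar R p \<otimes>\<^bsub>F\<^esub> l" unfolding fps_scalar_mult[OF lF p(1)] using l(2) by (rule ext)
  have uF: "\<pi> (fps_shift u) \<in> carrier B" using fps_shift_closed[OF *(2)] by simp
  have u0: "u 0 \<in> carrier R" using fps_coeff_closed[OF *(2)] .
  have "\<not> p divides (u 0)" using *(4) p mem_cgenideal_iff by simp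
  from pm.invertible_mod_p[OF u0 this]
  obtain b c where b: "b \<in> carrier R" "c \<in> carrier R" "u 0 \<otimes> b \<oplus> p \<otimes> c = \<one>" .
  have cl: "\<phi> p \<in> carrier B" "\<phi> b \<in> carrier B" "\<phi> c \<in> carrier B" "\<phi> (u 0) \<in> carrier B" "\<pi> l \<in> carrier B" "\<xi> [^]\<^bsub>B\<^esub> n \<in> carrier B"
    using p b u0 lF x_closed by auto
  have "\<pi> g = \<phi> p \<otimes>\<^bsub>B\<^esub> \<pi> l \<oplus>\<^bsub>B\<^esub> \<xi> [^]\<^bsub>B\<^esub> n \<otimes>\<^bsub>B\<^esub> \<pi> u"
    unfolding *(5) kl \<phi>_def \<pi>_var_pow[symmetric] using p(1) lF *(2) by (simp add: fps_scalar_closed fps_var_closed)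
  then have e: "\<phi> p \<otimes>\<^bsub>B\<^esub> \<pi> l \<oplus>\<^bsub>B\<^esub> \<xi> [^]\<^bsub>B\<^esub> n \<otimes>\<^bsub>B\<^esub> (\<phi> (u 0) \<oplus>\<^bsub>B\<^esub> \<xi> \<otimes>\<^bsub>B\<^esub> \<pi> (fps_shift u)) = \<zero>\<^bsub>B\<^esub>"
    using \<pi>_zero_iff[OF gF] g(1) \<pi>_decompose[OF *(2)] by simp
  have one: "\<phi> (u 0) \<otimes>\<^bsub>B\<^esub> \<phi> b \<oplus>\<^bsub>B\<^esub> \<phi> p \<otimes>\<^bsub>B\<^esub> \<phi> c = \<one>\<^bsub>B\<^esub>"
    using arg_cong[OF b(3), of \<phi>] u0 b(1,2) p(1) by simp
  let ?w = "\<pi> (fps_shift u) \<otimes>\<^bsub>B\<^esub> \<phi> b"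
  let ?y = "\<one>\<^bsub>B\<^esub> \<oplus>\<^bsub>B\<^esub> \<xi> \<otimes>\<^bsub>B\<^esub> ?w"
  have wc: "?w \<in> carrier B" using uF cl by simp
  have "?y = \<one>\<^bsub>B\<^esub> \<ominus>\<^bsub>B\<^esub> \<xi> \<otimes>\<^bsub>B\<^esub> (\<ominus>\<^bsub>B\<^esub> ?w)" using wc x_closed by (simp add: a_minus_def B.r_minus)
  then have "?y \<in> Units B" using ad.one_minus_unit[of "\<ominus>\<^bsub>B\<^esub> ?w"] wc by simp
  then obtain v where v: "v \<in> carrier B" "?y \<otimes>\<^bsub>B\<^esub> v = \<one>\<^bsub>B\<^esub>" using B.Units_r_inv_ex by blast
  have "\<xi> [^]\<^bsub>B\<^esub> n \<otimes>\<^bsub>B\<^esub> ?y = \<xi> [^]\<^bsub>B\<^esub> n \<otimes>\<^bsub>B\<^esub> ((\<phi> (u 0) \<otimes>\<^bsub>B\<^esub> \<phi> b \<oplus>\<^bsub>B\<^esub> \<phi> p \<otimes>\<^bsub>B\<^esub> \<phi> c) \<oplus>\<^bsub>B\<^esub> \<xi> \<otimes>\<^bsub>B\<^esub> ?w)"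
    unfolding one ..
  also have "\<dots> = (\<phi> p \<otimes>\<^bsub>B\<^esub> \<pi> l \<oplus>\<^bsub>B\<^esub> \<xi> [^]\<^bsub>B\<^esub> n \<otimes>\<^bsub>B\<^esub> (\<phi> (u 0) \<oplus>\<^bsub>B\<^esub> \<xi> \<otimes>\<^bsub>B\<^esub> \<pi> (fps_shift u))) \<otimes>\<^bsub>B\<^esub> \<phi> b
      \<oplus>\<^bsub>B\<^esub> \<phi> p \<otimes>\<^bsub>B\<^esub> (\<phi> c \<otimes>\<^bsub>B\<^esub> \<xi> [^]\<^bsub>B\<^esub> n \<ominus>\<^bsub>B\<^esub> \<pi> l \<otimes>\<^bsub>B\<^esub> \<phi> b)"
    using cl uF x_closed by algebra
  also have "\<dots> = \<phi> p \<otimes>\<^bsub>B\<^esub> (\<phi> c \<otimes>\<^bsub>B\<^esub> \<xi> [^]\<^bsub>B\<^esub> n \<ominus>\<^bsub>B\<^esub> \<pi> l \<otimes>\<^bsub>B\<^esub> \<phi> b)" unfolding e using cl by simp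
  finally have 1: "\<xi> [^]\<^bsub>B\<^esub> n \<otimes>\<^bsub>B\<^esub> ?y = \<phi> p \<otimes>\<^bsub>B\<^esub> (\<phi> c \<otimes>\<^bsub>B\<^esub> \<xi> [^]\<^bsub>B\<^esub> n \<ominus>\<^bsub>B\<^esub> \<pi> l \<otimes>\<^bsub>B\<^esub> \<phi> b)" .
  have yc: "?y \<in> carrier B" using wc x_closed by simp
  have "\<xi> [^]\<^bsub>B\<^esub> n = \<xi> [^]\<^bsub>B\<^esub> n \<otimes>\<^bsub>B\<^esub> ?y \<otimes>\<^bsub>B\<^esub> v" using v cl(6) yc by (simp only: B.m_assoc B.r_one)
  also have "\<dots> = \<phi> p \<otimes>\<^bsub>B\<^esub> ((\<phi> c \<otimes>\<^bsub>B\<^esub> \<xi> [^]\<^bsub>B\<^esub> n \<ominus>\<^bsub>B\<^esub> \<pi> l \<otimes>\<^bsub>B\<^esub> \<phi> b) \<otimes>\<^bsub>B\<^esub> v)"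
    unfolding 1 by (rule B.m_assoc) (use cl v in auto)
  finally have "\<xi> [^]\<^bsub>B\<^esub> n = \<phi> p \<otimes>\<^bsub>B\<^esub> ((\<phi> c \<otimes>\<^bsub>B\<^esub> \<xi> [^]\<^bsub>B\<^esub> n \<ominus>\<^bsub>B\<^esub> \<pi> l \<otimes>\<^bsub>B\<^esub> \<phi> b) \<otimes>\<^bsub>B\<^esub> v)" .
  moreover have "(\<phi> c \<otimes>\<^bsub>B\<^esub> \<xi> [^]\<^bsub>B\<^esub> n \<ominus>\<^bsub>B\<^esub> \<pi> l \<otimes>\<^bsub>B\<^esub> \<phi> b) \<otimes>\<^bsub>B\<^esub> v \<in> carrier B" using cl v(1) by simp
  ultimately show ?thesis unfolding factor_def by blast
qed

text \<open>The saturation of \<open>C\<close> at \<open>p\<close>. If \<open>C\<close> is generated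
  by a nonzero \<open>c\<close>, a generator of it is the part of \<open>c\<close> prime to
  \<open>p\<close>; it is the whole ring exactly if \<open>C\<close> contains a power of
  \<open>p\<close>.\<close>

lemma saturation_ideal:
  assumes p: "p \<in> carrier R"
  shows "ideal {a \<in> carrier R. \<exists>k::nat. a \<otimes> p [^] k \<in> C} R" (is "ideal ?K R")
proof -
  interpret C: ideal C R by (rule C_ideal)
  have up: "a \<otimes> p [^] m \<in> C" if "a \<in> carrier R" "a \<otimes> p [^] k \<in> C" "k \<le> m" for a and k m :: nat
  proof -
    have "a \<otimes> p [^] m = (a \<otimes> p [^] k) \<otimes> p [^] (m - k)" using that p by (simp add: m_assoc nat_pow_mult)
    then show ?thesis using C.I_r_closed[OF that(2)] p by simp
  qed
  show ?thesis
  proof (rule idealI)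
    show "ring R" by (rule ring_axioms)
    show "subgroup ?K (add_monoid R)"
    proof (rule add.subgroupI)
      show "?K \<subseteq> carrier R" by blast
      show "?K \<noteq> {}" using C.zero_closed p by (auto intro!: exI[of _ \<zero>])
      fix a assume "a \<in> ?K"
      then obtain k :: nat where a: "a \<in> carrier R" "a \<otimes> p [^] k \<in> C" by blast
      then have "\<ominus> a \<otimes> p [^] k \<in> C" using p C.a_inv_closed[OF a(2)] by (simp add: l_minus)
      then show "\<ominus> a \<in> ?K" using a by auto
      fix b assume "b \<in> ?K"
      then obtain m :: nat where b: "b \<in> carrier R" "b \<otimes> p [^] m \<in> C" by blast
      have "(a \<oplus> b) \<otimes> p [^] (k + m) = a \<otimes> p [^] (k + m) \<oplus> b \<otimes> p [^] (k + m)" using a b p by (simp add: l_distr)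
      then have "(a \<oplus> b) \<otimes> p [^] (k + m) \<in> C" using up[OF a, of "k + m"] up[OF b, of "k + m"] by simp
      then show "a \<oplus> b \<in> ?K" using a b by auto
    qed
    fix a x assume "a \<in> ?K" "x \<in> carrier R"
    then obtain k :: nat where a: "a \<in> carrier R" "a \<otimes> p [^] k \<in> C" and x: "x \<in> carrier R" by blast
    have "x \<otimes> a \<otimes> p [^] k = x \<otimes> (a \<otimes> p [^] k)" using a x p by (simp add: m_assoc)
    then have "x \<otimes> a \<otimes> p [^] k \<in> C" using C.I_l_closed[OF a(2) x] by simp
    then show "x \<otimes> a \<in> ?K" using a x by auto
    then show "a \<otimes> x \<in> ?K" using a x by (simp add: m_comm)
  qed
qed

text \<open>\<open>B/\<xi>B\<close> is \<open>R/C\<close>. It has no nontrivial idempotents because \<open>B\<close> is complete and a domain,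
  and this forces \<open>C\<close> to contain a power of any prime \<open>p\<close> above it.\<close>

lemma prime_power_in_C:
  assumes ad: "adic B \<xi>" and c: "c \<in> carrier R" "C = PIdl c" "c \<noteq> \<zero>"
    and p: "p \<in> carrier R" "maximalideal (PIdl p) R" "C \<subseteq> PIdl p"
  shows "\<exists>k::nat. p [^] k \<in> C"
proof -
  interpret ad: adic B \<xi> by fact
  interpret C: ideal C R by (rule C_ideal)
  interpret pm: pid_maximal R p
    by (intro pid_maximal.intro pid_maximal_axioms.intro principal_domain_axioms p)
  let ?K = "{a \<in> carrier R. \<exists>k::nat. a \<otimes> p [^] k \<in> C}"
  obtain d where d: "d \<in> carrier R" "?K = PIdl d" using exists_gen[OF saturation_ideal[OF p(1)]] by blast
  have "d \<in> ?K" using cgenideal_self[OF d(1)] d(2) by simp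
  then obtain k0 :: nat where k0: "d \<otimes> p [^] k0 \<in> C" by blast
  have C_mult: "x \<otimes> y \<in> C" if "x \<in> C" "y \<in> carrier R" for x y using C.I_r_closed[OF that] .
  \<comment> \<open>The additional factor ensures that \<open>p\<close> divides \<open>?a\<close>
    below.\<close>
  define k where "k = Suc k0"
  have dk: "d \<otimes> p [^] k \<in> C" using C_mult[OF k0 p(1)] d(1) p(1) by (simp add: k_def m_assoc)
  have done_if: ?thesis if "e \<in> carrier R" "d \<otimes> e = \<one>" for e
  proof -
    have "(d \<otimes> p [^] k) \<otimes> e = (d \<otimes> e) \<otimes> p [^] k" using d(1) that(1) p(1) by (simp add: m_ac)
    then have "(d \<otimes> p [^] k) \<otimes> e = p [^] k" using that(2) p(1) by simp
    then show ?thesis using C_mult[OF dk that(1)] by metis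
  qed
  have "c \<in> C" using c cgenideal_self by blast
  then have "c \<otimes> p [^] (0::nat) \<in> C" using c(1) by simp
  then have "c \<in> PIdl d" using c(1) d(2) by blast
  then have d0: "d \<noteq> \<zero>" using c(3) unfolding cgenideal_def by auto
  \<comment> \<open>Otherwise \<open>d\<close> divided by \<open>p\<close> would already belong to
    the saturation, hence be a multiple of \<open>d\<close>, and \<open>p\<close> would be a
    unit.\<close>
  have nd: "\<not> p divides d"
  proof
    assume "p divides d"
    then obtain e where e: "e \<in> carrier R" "d = p \<otimes> e" unfolding factor_def by blast
    have "d \<otimes> p [^] k = e \<otimes> p [^] Suc k" unfolding e(2) using e(1) p(1) by (simp add: m_ac)
    then have "e \<otimes> p [^] Suc k \<in> C" using dk by simp
    then have "e \<in> PIdl d" using e(1) d(2) by blast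
    then obtain f where f: "f \<in> carrier R" "e = f \<otimes> d" unfolding cgenideal_def by blast
    have "d \<otimes> \<one> = d \<otimes> (p \<otimes> f)" using e f d(1) p(1) by (metis m_assoc m_comm r_one m_closed)
    then have "\<one> = p \<otimes> f" using m_lcancel[OF d0 d(1), of \<one> "p \<otimes> f"] f(1) p(1) by simp
    then show False using pm.p_not_unit f(1) unfolding factor_def by blast
  qed
  from pm.invertible_mod_p[OF d(1) nd]
  obtain b b' where b: "b \<in> carrier R" "b' \<in> carrier R" "d \<otimes> b \<oplus> p \<otimes> b' = \<one>" .
  have "\<exists>s\<in>carrier R. \<exists>t\<in>carrier R. p [^] i \<otimes> s \<oplus> d \<otimes> t = \<one>" for i :: nat
  proof (induction i)
    case 0
    show ?case using d(1) by (intro bexI[of _ \<one>] bexI[of _ \<zero>]) auto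
  next
    case (Suc i)
    then obtain s t where st: "s \<in> carrier R" "t \<in> carrier R" "p [^] i \<otimes> s \<oplus> d \<otimes> t = \<one>" by blast
    have pic: "p [^] i \<in> carrier R" using p(1) by simp
    have "p [^] Suc i \<otimes> (s \<otimes> b') \<oplus> d \<otimes> (p [^] i \<otimes> s \<otimes> b \<oplus> t) = p [^] i \<otimes> s \<otimes> (d \<otimes> b \<oplus> p \<otimes> b') \<oplus> d \<otimes> t"
      unfolding nat_pow_Suc using st b(1,2) d(1) p(1) pic by algebra
    also have "\<dots> = \<one>" unfolding b(3) using st pic by simp
    finally show ?case using st b(1,2) d(1) pic
      by (intro bexI[of _ "s \<otimes> b'"] bexI[of _ "p [^] i \<otimes> s \<otimes> b \<oplus> t"]) auto
  qed
  then obtain s t where st: "s \<in> carrier R" "t \<in> carrier R" "p [^] k \<otimes> s \<oplus> d \<otimes> t = \<one>" by blast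
  \<comment> \<open>Complementary elements whose product lies in \<open>C\<close>, because
    \<open>d \<otimes> p [^] k\<close> does.\<close>
  let ?a = "p [^] k \<otimes> s" and ?b = "d \<otimes> t"
  have ab: "?a \<in> carrier R" "?b \<in> carrier R" using st d(1) p(1) by auto
  have "?a \<otimes> ?b = (d \<otimes> p [^] k) \<otimes> (s \<otimes> t)" using st d(1) p(1) by (simp add: m_ac)
  then have "?a \<otimes> ?b \<in> C" using C_mult[OF dk] st by simp
  then have xab: "\<xi> divides\<^bsub>B\<^esub> (\<phi> ?a \<otimes>\<^bsub>B\<^esub> \<phi> ?b)" using C_iff[of "?a \<otimes> ?b"] \<phi>.hom_mult[OF ab] ab by simp
  have sum1: "\<phi> ?a \<oplus>\<^bsub>B\<^esub> \<phi> ?b = \<one>\<^bsub>B\<^esub>" using \<phi>.hom_add[OF ab] st(3) by simp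
  have "\<xi> divides\<^bsub>B\<^esub> \<phi> ?a \<or> \<xi> divides\<^bsub>B\<^esub> \<phi> ?b"
    by (rule ad.complementary_mod_q[OF B.domain_axioms \<phi>.hom_closed[OF ab(1)] \<phi>.hom_closed[OF ab(2)] sum1 xab])
  \<comment> \<open>In the first case \<open>s\<close> lies in the saturation, so \<open>d\<close>
    divides both summands of 1 and is a unit. The second case is impossible, because
    \<open>p\<close> would divide both summands.\<close>
  then have "?a \<in> C \<or> ?b \<in> C" using C_iff[OF ab(1)] C_iff[OF ab(2)] by blast
  then show ?thesis
  proof
    assume "?a \<in> C"
    then have "s \<otimes> p [^] k \<in> C" using st p(1) by (simp add: m_comm)
    then have "s \<in> PIdl d" using st(1) d(2) by blast
    then obtain f where f: "f \<in> carrier R" "s = f \<otimes> d" unfolding cgenideal_def by blast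
    have pkc: "p [^] k \<in> carrier R" using p(1) by simp
    have "d \<otimes> (p [^] k \<otimes> f \<oplus> t) = p [^] k \<otimes> s \<oplus> d \<otimes> t" unfolding f(2) using d(1) pkc f(1) st(2) by algebra
    then show ?thesis using done_if[of "p [^] k \<otimes> f \<oplus> t"] st pkc f(1) by simp
  next
    assume "?b \<in> C"
    then have 1: "p divides ?b" using p mem_cgenideal_iff by blast
    have "?a = p \<otimes> (p [^] k0 \<otimes> s)" using p(1) st(1) by (simp add: k_def m_ac)
    then have "p divides ?a" using p(1) st(1) unfolding factor_def by (intro bexI[of _ "p [^] k0 \<otimes> s"]) auto
    then have "p divides (?a \<oplus> ?b)" using 1 by (rule divides_sum[OF p(1)])
    then show ?thesis using pm.p_not_unit st(3) by simp
  qed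
qed

lemma generic_quotient:
  assumes X: "fps_var R \<notin> I" and J: "J = {\<zero>}" and I: "I \<noteq> {\<zero>\<^bsub>F\<^esub>}"
  obtains p k n where "p \<in> carrier R" "p \<noteq> \<zero>" "maximalideal (PIdl p) R" "adic B \<xi>"
    "\<xi> divides\<^bsub>B\<^esub> (\<phi> p [^]\<^bsub>B\<^esub> (k::nat))" "\<phi> p divides\<^bsub>B\<^esub> (\<xi> [^]\<^bsub>B\<^esub> (n::nat))" "inj_on \<phi> (carrier R)"
proof -
  obtain c where c: "c \<in> carrier R" "C = PIdl c" using exists_gen[OF C_ideal] by blast
  obtain g where g: "g \<in> I" "g 0 = c" using C_repr[of c] c cgenideal_self by blast
  have gF: "g \<in> carrier F" using g I.Icarr by blast
  interpret FX: adic F "fps_var R" by (rule fps_adic)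
  note gen = I_generated[OF X c g]
  \<comment> \<open>If all constant terms vanish, \<open>g\<close> is the variable times a member of
    \<open>I\<close>, which is again a multiple of \<open>g\<close>. Then every power of the
    variable divides \<open>g\<close>, so \<open>g\<close> and \<open>I\<close> are zero.\<close>
  have c0: "c \<noteq> \<zero>"
  proof
    assume "c = \<zero>"
    then have g_shift: "g = fps_var R \<otimes>\<^bsub>F\<^esub> fps_shift g"
      using fps_decompose[OF gF] g(2) fps_var_mult[OF fps_shift_closed[OF gF]]
      by (intro ext) (case_tac x, auto simp: fps_shift_def)
    then have "fps_shift g \<in> I" using g(1) X I.I_prime[OF fps_var_closed fps_shift_closed[OF gF]] by simp
    then obtain h where h: "h \<in> carrier F" "fps_shift g = h \<otimes>\<^bsub>F\<^esub> g" using gen by blast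
    have "fps_var R [^]\<^bsub>F\<^esub> n divides\<^bsub>F\<^esub> g" for n :: nat
    proof (induction n)
      case 0
      show ?case using gF by (auto simp: factor_def)
    next
      case (Suc n)
      then obtain u where u: "u \<in> carrier F" "g = fps_var R [^]\<^bsub>F\<^esub> n \<otimes>\<^bsub>F\<^esub> u" unfolding factor_def by blast
      have "g = fps_var R \<otimes>\<^bsub>F\<^esub> (h \<otimes>\<^bsub>F\<^esub> (fps_var R [^]\<^bsub>F\<^esub> n \<otimes>\<^bsub>F\<^esub> u))" using g_shift h(2) u(2) by metis
      also have "\<dots> = fps_var R [^]\<^bsub>F\<^esub> Suc n \<otimes>\<^bsub>F\<^esub> (h \<otimes>\<^bsub>F\<^esub> u)" using u(1) h(1) fps_var_closed by (simp add: I.m_ac)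
      finally show ?case using u(1) h(1) unfolding factor_def by (metis fps_mult_closed)
    qed
    then have "g = \<zero>\<^bsub>F\<^esub>" by (rule FX.separated[OF gF])
    have "f = \<zero>\<^bsub>F\<^esub>" if fI: "f \<in> I" for f
    proof -
      obtain h where "h \<in> carrier F" "f = h \<otimes>\<^bsub>F\<^esub> g" using gen[OF fI] by blast
      then show ?thesis using \<open>g = \<zero>\<^bsub>F\<^esub>\<close> by simp
    qed
    moreover have "\<zero>\<^bsub>F\<^esub> \<in> I" by (rule additive_subgroup.zero_closed[OF I.is_additive_subgroup])
    ultimately have "I = {\<zero>\<^bsub>F\<^esub>}" by blast
    then show False using I by simp
  qed
  have ad: "adic B \<xi>" by (rule quotient_adic[OF X c c0 g])
  have cu: "c \<notin> Units R"
  proof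
    assume "c \<in> Units R"
    then have "\<one> \<in> PIdl c" using Units_l_inv_ex unfolding cgenideal_def by (auto, metis)
    then show False using one_not_in_C c(2) by simp
  qed
  obtain p where p: "p \<in> carrier R" "ring_irreducible p" "p divides c"
    by (rule exists_irreducible_divisor[of c]) (use c(1) c0 cu in auto)
  have max: "maximalideal (PIdl p) R" by (rule irreducible_imp_maximalideal[OF p(1,2)])
  have p0: "p \<noteq> \<zero>" using p(3) c0 unfolding factor_def by auto
  have "C \<subseteq> PIdl p" unfolding c(2)
    by (rule cgenideal_minimal[OF cgenideal_ideal[OF p(1)]]) (use p mem_cgenideal_iff in blast)
  then obtain k :: nat where k: "p [^] k \<in> C" using prime_power_in_C[OF ad c c0 p(1) max] by blast
  have "\<phi> (p [^] k) = \<phi> p [^]\<^bsub>B\<^esub> k" by (induction k) (use p(1) in auto)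
  then have k': "\<xi> divides\<^bsub>B\<^esub> (\<phi> p [^]\<^bsub>B\<^esub> k)" using C_iff[of "p [^] k"] k p(1) by simp
  \<comment> \<open>Otherwise \<open>g\<close> is \<open>p\<close> times a series \<open>l\<close>,
    and \<open>l\<close> lies in \<open>I\<close> because \<open>p\<close> does not. The constant
    term of \<open>l\<close> is again a multiple of \<open>c\<close>, and cancelling
    \<open>c\<close> makes \<open>p\<close> a unit.\<close>
  have "\<not> (\<forall>n. g n \<in> PIdl p)"
  proof
    assume a: "\<forall>n. g n \<in> PIdl p"
    then have "\<exists>c. c \<in> carrier R \<and> g i = p \<otimes> c" for i
      using p mem_cgenideal_iff unfolding factor_def by blast
    then obtain l where l: "\<And>i. l i \<in> carrier R" "\<And>i. g i = p \<otimes> l i" by metis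
    have lF: "l \<in> carrier F" unfolding fps_carrier using l(1) by simp
    have gl: "g = fps_scalar R p \<otimes>\<^bsub>F\<^esub> l" unfolding fps_scalar_mult[OF lF p(1)] using l(2) by (rule ext)
    have "p \<notin> J" using J p0 by simp
    then have "fps_scalar R p \<notin> I" using p(1) unfolding J_def by simp
    then have "l \<in> I" using I.I_prime[OF fps_scalar_closed[OF p(1)] lF] g(1) gl by simp
    then have "l 0 \<in> PIdl c" using coeff_0_in_C c(2) by simp
    then obtain e where e: "e \<in> carrier R" "l 0 = e \<otimes> c" unfolding cgenideal_def by blast
    have "c = p \<otimes> (e \<otimes> c)" using l(2)[of 0] e(2) g(2) by simp
    then have "c \<otimes> \<one> = c \<otimes> (p \<otimes> e)" using c(1) e(1) p(1) by (simp add: m_ac)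
    then have "\<one> = p \<otimes> e" using m_lcancel[OF c0 c(1), of \<one> "p \<otimes> e"] e(1) p(1) by simp
    then have "p divides \<one>" using e(1) unfolding factor_def by blast
    then have "p \<in> Units R" using divides_one_unit[OF p(1)] by simp
    then show False using ring_irreducibleE(4)[OF p(1,2)] by blast
  qed
  then obtain n :: nat where n: "\<phi> p divides\<^bsub>B\<^esub> (\<xi> [^]\<^bsub>B\<^esub> n)" using x_power_divisible[OF ad p(1) max g(1)] by blast
  have "inj_on \<phi> (carrier R)"
    by (rule \<phi>.trivial_ker_imp_inj) (use J J_kernel in simp)
  then show thesis using that[OF p(1) p0 max ad k' n] by blast
qed

end

section \<open>Homomorphisms out of the completion\<close>

context pid_maximal
begin

definition is_limit :: "('s, 'c) ring_scheme \<Rightarrow> ('a \<Rightarrow> 's) \<Rightarrow> (nat \<Rightarrow> 'a) \<Rightarrow> 's \<Rightarrow> bool" where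
  "is_limit B \<phi> r l \<longleftrightarrow> l \<in> carrier B \<and> (\<forall>n::nat. \<phi> p [^]\<^bsub>B\<^esub> n divides\<^bsub>B\<^esub> (l \<ominus>\<^bsub>B\<^esub> \<phi> (r n)))"

text \<open>The universal property of the completion. A coherent sequence goes to the limit of its
  image under \<open>\<phi>\<close>; separatedness makes the limit independent of the
  representatives, so \<open>\<psi>\<close> may be defined by choosing any of them.\<close>

lemma completion_lift:
  fixes B :: "('s, 'c) ring_scheme"
  assumes ad: "adic B (\<phi> p)" and \<phi>: "\<phi> \<in> ring_hom R B"
  obtains \<psi> where "\<psi> \<in> ring_hom S B" "\<And>a. a \<in> carrier R \<Longrightarrow> \<psi> (incl a) = \<phi> a"
proof -
  interpret B: adic B "\<phi> p" by fact
  interpret \<phi>: ring_hom_ring R B \<phi> by (rule ring_hom_ringI2[OF ring_axioms B.ring_axioms \<phi>])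
  let ?P = "\<phi> p"
  have Pc: "?P [^]\<^bsub>B\<^esub> n \<in> carrier B" for n :: nat
    by (rule B.nat_pow_closed[OF B.q_closed])
  have div: "?P [^]\<^bsub>B\<^esub> n divides\<^bsub>B\<^esub> \<phi> a" if "p [^] n divides a" for n :: nat and a
  proof -
    from that obtain x where x: "x \<in> carrier R" "a = p [^] n \<otimes> x" unfolding factor_def by (elim bexE)
    have "\<phi> a = \<phi> (p [^] n) \<otimes>\<^bsub>B\<^esub> \<phi> x" unfolding x(2) by (rule \<phi>.hom_mult) (use x(1) in auto)
    also have "\<phi> (p [^] n) = ?P [^]\<^bsub>B\<^esub> n" by (rule \<phi>.hom_nat_pow) simp
    finally show ?thesis unfolding factor_def by (rule bexI) (rule \<phi>.hom_closed[OF x(1)])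
  qed
  have hom_minus: "\<phi> (a \<ominus> b) = \<phi> a \<ominus>\<^bsub>B\<^esub> \<phi> b" if "a \<in> carrier R" "b \<in> carrier R" for a b
    using that by (simp add: a_minus_def)
  have ex: "\<exists>l. is_limit B \<phi> r l" if r: "coherent r" for r
  proof -
    have "?P [^]\<^bsub>B\<^esub> n divides\<^bsub>B\<^esub> (\<phi> (r (Suc n)) \<ominus>\<^bsub>B\<^esub> \<phi> (r n))" for n
      using div[OF coherentD(2)[OF r]] hom_minus coherentD(1)[OF r] by simp
    then obtain l where "l \<in> carrier B" "\<And>n. ?P [^]\<^bsub>B\<^esub> n divides\<^bsub>B\<^esub> (l \<ominus>\<^bsub>B\<^esub> \<phi> (r n))"
      using B.cauchy[of "\<lambda>n. \<phi> (r n)"] coherentD(1)[OF r] \<phi>.hom_closed by blast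
    then show ?thesis unfolding is_limit_def by blast
  qed
  have uniq: "l = l'" if r: "coherent r" "coherent s" "cls r = cls s" and l: "is_limit B \<phi> r l" "is_limit B \<phi> s l'" for r s l l'
  proof -
    note rc = coherentD(1)[OF r(1)] coherentD(1)[OF r(2)]
    have lc: "l \<in> carrier B" "l' \<in> carrier B" using l unfolding is_limit_def by auto
    have "l \<ominus>\<^bsub>B\<^esub> l' = \<zero>\<^bsub>B\<^esub>"
    proof (rule B.separated)
      fix n :: nat
      have "p [^] n divides (r n \<ominus> s n)" using r(3) cls_eq_iff[of r s] rc by blast
      then have 1: "?P [^]\<^bsub>B\<^esub> n divides\<^bsub>B\<^esub> (\<phi> (r n) \<ominus>\<^bsub>B\<^esub> \<phi> (s n))" using div hom_minus rc by metis
      have 2: "?P [^]\<^bsub>B\<^esub> n divides\<^bsub>B\<^esub> (l \<ominus>\<^bsub>B\<^esub> \<phi> (r n))" "?P [^]\<^bsub>B\<^esub> n divides\<^bsub>B\<^esub> (l' \<ominus>\<^bsub>B\<^esub> \<phi> (s n))"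
        using l unfolding is_limit_def by auto
      have "?P [^]\<^bsub>B\<^esub> n divides\<^bsub>B\<^esub> (((l \<ominus>\<^bsub>B\<^esub> \<phi> (r n)) \<oplus>\<^bsub>B\<^esub> (\<phi> (r n) \<ominus>\<^bsub>B\<^esub> \<phi> (s n))) \<ominus>\<^bsub>B\<^esub> (l' \<ominus>\<^bsub>B\<^esub> \<phi> (s n)))"
        by (rule B.divides_diff[OF Pc B.divides_sum[OF Pc 2(1) 1] 2(2)])
      moreover have "((l \<ominus>\<^bsub>B\<^esub> \<phi> (r n)) \<oplus>\<^bsub>B\<^esub> (\<phi> (r n) \<ominus>\<^bsub>B\<^esub> \<phi> (s n))) \<ominus>\<^bsub>B\<^esub> (l' \<ominus>\<^bsub>B\<^esub> \<phi> (s n)) = l \<ominus>\<^bsub>B\<^esub> l'"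
        using lc \<phi>.hom_closed[OF rc(1)[of n]] \<phi>.hom_closed[OF rc(2)[of n]] by algebra
      ultimately show "?P [^]\<^bsub>B\<^esub> n divides\<^bsub>B\<^esub> (l \<ominus>\<^bsub>B\<^esub> l')" by simp
    qed (use lc in auto)
    then show ?thesis using lc by simp
  qed
  define \<psi> where "\<psi> f = (SOME l. \<exists>r. coherent r \<and> f = cls r \<and> is_limit B \<phi> r l)" for f
  have \<psi>: "\<psi> (cls r) = l" if r: "coherent r" "is_limit B \<phi> r l" for r l
  proof -
    have "\<exists>r'. coherent r' \<and> cls r = cls r' \<and> is_limit B \<phi> r' (\<psi> (cls r))"
      unfolding \<psi>_def by (rule someI[of _ l]) (use r in blast)
    then show ?thesis using uniq r by metis
  qed
  have const: "is_limit B \<phi> (\<lambda>_. a) (\<phi> a)" if "a \<in> carrier R" for a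
    using that B.divides_zero_r[OF Pc] unfolding is_limit_def by (simp add: B.r_neg a_minus_def)
  have incl: "\<psi> (incl a) = \<phi> a" if "a \<in> carrier R" for a
    unfolding incl_def by (rule \<psi>[OF coherent_const[OF that] const[OF that]])
  have ops: "is_limit B \<phi> (\<lambda>n. r n \<oplus> s n) (l \<oplus>\<^bsub>B\<^esub> l')" "is_limit B \<phi> (\<lambda>n. r n \<otimes> s n) (l \<otimes>\<^bsub>B\<^esub> l')"
    if r: "coherent r" "coherent s" and l: "is_limit B \<phi> r l" "is_limit B \<phi> s l'" for r s l l'
  proof -
    note rc = coherentD(1)[OF r(1)] coherentD(1)[OF r(2)]
    note hc = \<phi>.hom_closed[OF rc(1)] \<phi>.hom_closed[OF rc(2)]
    have lc: "l \<in> carrier B" "l' \<in> carrier B" using l unfolding is_limit_def by auto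
    have 2: "?P [^]\<^bsub>B\<^esub> n divides\<^bsub>B\<^esub> (l \<ominus>\<^bsub>B\<^esub> \<phi> (r n))" "?P [^]\<^bsub>B\<^esub> n divides\<^bsub>B\<^esub> (l' \<ominus>\<^bsub>B\<^esub> \<phi> (s n))" for n :: nat
      using l unfolding is_limit_def by auto
    have "?P [^]\<^bsub>B\<^esub> n divides\<^bsub>B\<^esub> ((l \<oplus>\<^bsub>B\<^esub> l') \<ominus>\<^bsub>B\<^esub> \<phi> (r n \<oplus> s n))" for n :: nat
    proof -
      have "?P [^]\<^bsub>B\<^esub> n divides\<^bsub>B\<^esub> ((l \<ominus>\<^bsub>B\<^esub> \<phi> (r n)) \<oplus>\<^bsub>B\<^esub> (l' \<ominus>\<^bsub>B\<^esub> \<phi> (s n)))" by (rule B.divides_sum[OF Pc 2])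
      moreover have "(l \<ominus>\<^bsub>B\<^esub> \<phi> (r n)) \<oplus>\<^bsub>B\<^esub> (l' \<ominus>\<^bsub>B\<^esub> \<phi> (s n)) = (l \<oplus>\<^bsub>B\<^esub> l') \<ominus>\<^bsub>B\<^esub> (\<phi> (r n) \<oplus>\<^bsub>B\<^esub> \<phi> (s n))"
        using lc hc(1)[of n] hc(2)[of n] by algebra
      ultimately show ?thesis using rc by simp
    qed
    then show "is_limit B \<phi> (\<lambda>n. r n \<oplus> s n) (l \<oplus>\<^bsub>B\<^esub> l')" using lc unfolding is_limit_def by simp
    have "?P [^]\<^bsub>B\<^esub> n divides\<^bsub>B\<^esub> ((l \<otimes>\<^bsub>B\<^esub> l') \<ominus>\<^bsub>B\<^esub> \<phi> (r n \<otimes> s n))" for n :: nat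
    proof -
      have "?P [^]\<^bsub>B\<^esub> n divides\<^bsub>B\<^esub> ((l \<ominus>\<^bsub>B\<^esub> \<phi> (r n)) \<otimes>\<^bsub>B\<^esub> l' \<oplus>\<^bsub>B\<^esub> \<phi> (r n) \<otimes>\<^bsub>B\<^esub> (l' \<ominus>\<^bsub>B\<^esub> \<phi> (s n)))"
        by (rule B.divides_sum[OF Pc B.divides_prod_r(1)[OF Pc 2(1) lc(2)] B.divides_prod_r(2)[OF Pc 2(2) hc(1)]])
      moreover have "(l \<ominus>\<^bsub>B\<^esub> \<phi> (r n)) \<otimes>\<^bsub>B\<^esub> l' \<oplus>\<^bsub>B\<^esub> \<phi> (r n) \<otimes>\<^bsub>B\<^esub> (l' \<ominus>\<^bsub>B\<^esub> \<phi> (s n)) = (l \<otimes>\<^bsub>B\<^esub> l') \<ominus>\<^bsub>B\<^esub> (\<phi> (r n) \<otimes>\<^bsub>B\<^esub> \<phi> (s n))"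
        using lc hc(1)[of n] hc(2)[of n] by algebra
      ultimately show ?thesis using rc by simp
    qed
    then show "is_limit B \<phi> (\<lambda>n. r n \<otimes> s n) (l \<otimes>\<^bsub>B\<^esub> l')" using lc unfolding is_limit_def by simp
  qed
  have "\<psi> \<in> ring_hom S B"
  proof (rule ring_hom_memI)
    fix f assume "f \<in> carrier S"
    then obtain r where r: "coherent r" "f = cls r" by (rule S_repr)
    obtain l where l: "is_limit B \<phi> r l" using ex[OF r(1)] by blast
    then show "\<psi> f \<in> carrier B" unfolding r(2) \<psi>[OF r(1) l] is_limit_def by blast
  next
    fix f g assume "f \<in> carrier S" "g \<in> carrier S"
    then obtain r s where r: "coherent r" "f = cls r" and s: "coherent s" "g = cls s" by (metis S_repr)
    obtain l l' where l: "is_limit B \<phi> r l" "is_limit B \<phi> s l'" using ex r(1) s(1) by blast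
    show "\<psi> (f \<otimes>\<^bsub>S\<^esub> g) = \<psi> f \<otimes>\<^bsub>B\<^esub> \<psi> g"
      unfolding r(2) s(2) cls_ops[OF r(1) s(1)] \<psi>[OF r(1) l(1)] \<psi>[OF s(1) l(2)]
      by (rule \<psi>[OF coherent_ops(2)[OF r(1) s(1)] ops(2)[OF r(1) s(1) l]])
    show "\<psi> (f \<oplus>\<^bsub>S\<^esub> g) = \<psi> f \<oplus>\<^bsub>B\<^esub> \<psi> g"
      unfolding r(2) s(2) cls_ops[OF r(1) s(1)] \<psi>[OF r(1) l(1)] \<psi>[OF s(1) l(2)]
      by (rule \<psi>[OF coherent_ops(1)[OF r(1) s(1)] ops(1)[OF r(1) s(1) l]])
  next
    show "\<psi> \<one>\<^bsub>S\<^esub> = \<one>\<^bsub>B\<^esub>" unfolding S_one using incl by simp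
  qed
  then show thesis using that incl by blast
qed

text \<open>A nonzero element of the kernel is a power of \<open>p\<close> up to a unit, so this
  power of \<open>p\<close> would be killed already as an element of \<open>R\<close>.\<close>

lemma completion_hom_inj:
  assumes B: "ring B" and \<psi>: "\<psi> \<in> ring_hom S B"
    and inj: "inj_on (\<lambda>a. \<psi> (incl a)) (carrier R)"
  shows "inj_on \<psi> (carrier S)"
proof -
  interpret B: ring B by fact
  interpret S: domain S by (rule completion_domain)
  interpret \<psi>: ring_hom_ring S B \<psi> by (rule ring_hom_ringI2[OF S.ring_axioms B \<psi>])
  have "f = \<zero>\<^bsub>S\<^esub>" if f: "f \<in> carrier S" "\<psi> f = \<zero>\<^bsub>B\<^esub>" for f
  proof (rule ccontr)
    assume "f \<noteq> \<zero>\<^bsub>S\<^esub>"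
    then obtain k :: nat and u v where *: "u \<in> carrier S" "v \<in> carrier S" "u \<otimes>\<^bsub>S\<^esub> v = \<one>\<^bsub>S\<^esub>" "f = incl p [^]\<^bsub>S\<^esub> k \<otimes>\<^bsub>S\<^esub> u"
      using completion_valuation[OF f(1)] by blast
    have c: "incl (p [^] k) \<in> carrier S" by (rule incl_closed) simp
    have "f \<otimes>\<^bsub>S\<^esub> v = incl (p [^] k)" unfolding *(4) incl_pow[OF p_closed] using *(1-3) c by (simp add: S.m_assoc)
    then have "\<psi> (incl (p [^] k)) = \<psi> f \<otimes>\<^bsub>B\<^esub> \<psi> v" using \<psi>.hom_mult[OF f(1) *(2)] by simp
    also have "\<dots> = \<psi> (incl \<zero>)" unfolding f(2) S_zero[symmetric] using *(2) by simp
    finally have "p [^] k = \<zero>" by (rule inj_onD[OF inj]) auto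
    then have "incl p [^]\<^bsub>S\<^esub> k = \<zero>\<^bsub>S\<^esub>" unfolding incl_pow[OF p_closed] S_zero by simp
    then have "f = \<zero>\<^bsub>S\<^esub>" unfolding *(4) using *(1) by simp
    then show False using \<open>f \<noteq> \<zero>\<^bsub>S\<^esub>\<close> by simp
  qed
  then have "a_kernel S B \<psi> = {\<zero>\<^bsub>S\<^esub>}" unfolding a_kernel_def' by auto
  then show ?thesis by (rule \<psi>.trivial_ker_imp_inj)
qed

end

text \<open>A topological Nakayama lemma. Iterating \<open>gen\<close> writes each element as a
  combination of the powers of \<open>x\<close> below \<open>n\<close> plus a multiple of
  \<open>x [^] n\<close>, hence of \<open>p\<close>. The span is closed under Horner sums in
  \<open>p\<close>, so the resulting digits can be summed inside it.\<close>

lemma (in cdvr) generated_by_powers: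
  assumes ad: "adic R p" and x: "x \<in> carrier R" and xn: "p divides (x [^] (n::nat))"
    and gen: "\<And>b. b \<in> carrier R \<Longrightarrow> \<exists>a\<in>A. \<exists>c\<in>carrier R. b = a \<oplus> x \<otimes> c"
  shows "carrier R = lin_span R A (\<lambda>i. x [^] i) n"
proof -
  interpret ad: adic R p by fact
  have xc: "\<And>i::nat. x [^] i \<in> carrier R" using x by simp
  let ?V = "\<lambda>n. lin_span R A (\<lambda>i. x [^] i) n"
  have Vc: "v \<in> carrier R" if "v \<in> ?V m" for v m using lin_span_closed[of "\<lambda>i. x [^] i" m] xc that by blast
  have expand: "\<exists>v\<in>?V m. \<exists>c\<in>carrier R. b = v \<oplus> x [^] m \<otimes> c" if b: "b \<in> carrier R" for b m
  proof (induction m)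
    case 0
    show ?case using b by (auto intro!: bexI[of _ b])
  next
    case (Suc m)
    then obtain v c where v: "v \<in> ?V m" "c \<in> carrier R" "b = v \<oplus> x [^] m \<otimes> c" by blast
    obtain a d where a: "a \<in> A" "d \<in> carrier R" "c = a \<oplus> x \<otimes> d" using gen[OF v(2)] by blast
    have "b = (v \<oplus> a \<otimes> x [^] m) \<oplus> x [^] Suc m \<otimes> d"
      unfolding v(3) a(3) nat_pow_Suc using Vc[OF v(1)] A_in[OF a(1)] a(2) x xc[of m] by algebra
    moreover have "v \<oplus> a \<otimes> x [^] m \<in> ?V (Suc m)" using v(1) a(1) by auto
    ultimately show ?case using a(2) by blast
  qed
  obtain y where y: "y \<in> carrier R" "x [^] n = p \<otimes> y" using xn unfolding factor_def by blast
  have "\<exists>v c. v \<in> ?V n \<and> c \<in> carrier R \<and> b = v \<oplus> p \<otimes> c" if b: "b \<in> carrier R" for b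
  proof -
    obtain v c where v: "v \<in> ?V n" "c \<in> carrier R" "b = v \<oplus> x [^] n \<otimes> c" using expand[OF b] by blast
    have "b = v \<oplus> p \<otimes> (y \<otimes> c)" unfolding v(3) y(2) using v(2) y(1) by (simp add: m_assoc)
    then show ?thesis using v y(1) m_closed by blast
  qed
  then obtain \<delta> \<gamma> where step: "\<And>b. b \<in> carrier R \<Longrightarrow> \<delta> b \<in> ?V n \<and> \<gamma> b \<in> carrier R \<and> b = \<delta> b \<oplus> p \<otimes> \<gamma> b" by metis
  have "b \<in> ?V n" if b: "b \<in> carrier R" for b
  proof -
    define t where "t j = (\<gamma> ^^ j) b" for j
    have tc: "t j \<in> carrier R" for j unfolding t_def by (induction j) (use b step in auto)
    have tS: "t (Suc j) = \<gamma> (t j)" for j unfolding t_def by simp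
    have t: "t j = \<delta> (t j) \<oplus> p \<otimes> t (Suc j)" for j unfolding tS using step[OF tc[of j]] by blast
    have \<delta>: "\<delta> (t j) \<in> ?V n" for j using step[OF tc] by blast
    have "\<exists>e. (\<forall>j. e j \<in> ?V n) \<and> (\<forall>j. e j = \<delta> (t j) \<oplus> p \<otimes> e (Suc j))"
    proof (rule lin_span_horner[where w="\<lambda>i. x [^] i" and q=p and n=n and d="\<lambda>j. \<delta> (t j)", OF xc p_in _ \<delta>])
      fix d' :: "nat \<Rightarrow> 'a" assume "\<And>j. d' j \<in> A"
      then show "\<exists>e. (\<forall>j. e j \<in> A) \<and> (\<forall>j. e j = d' j \<oplus> p \<otimes> e (Suc j))" by (rule horner_A)
    qed
    then obtain e where e: "\<And>j. e j \<in> ?V n" "\<And>j. e j = \<delta> (t j) \<oplus> p \<otimes> e (Suc j)" by blast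
    have "t 0 = e 0"
      by (rule ad.horner_unique[where e=t and e'=e and d="\<lambda>j. \<delta> (t j)", OF tc t Vc[OF e(1)] e(2) Vc[OF \<delta>]])
    then show ?thesis using e(1)[of 0] by (simp add: t_def)
  qed
  then show ?thesis using Vc by blast
qed

section \<open>Maximal ideals and fields of fractions\<close>

text \<open>Zorn's lemma on the ideals that contain \<open>x\<close> and miss \<open>\<one>\<close>,
  a condition that survives unions of chains.\<close>

lemma (in cring) exists_maximalideal:
  assumes x: "x \<in> carrier R" "x \<notin> Units R"
  shows "\<exists>M. maximalideal M R \<and> x \<in> M"
proof -
  let ?T = "{J. ideal J R \<and> x \<in> J \<and> \<one> \<notin> J}"
  have "\<one> \<notin> PIdl x"
    using mem_cgenideal_iff[OF x(1)] divides_one_unit[OF x(1)] x(2) by blast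
  then have ne: "PIdl x \<in> ?T" using cgenideal_ideal[OF x(1)] cgenideal_self[OF x(1)] by blast
  have "\<exists>M\<in>?T. \<forall>N\<in>?T. M \<subseteq> N \<longrightarrow> N = M"
  proof (rule subset_Zorn_nonempty)
    show "?T \<noteq> {}" using ne by blast
    fix \<C> assume \<C>: "\<C> \<noteq> {}" "subset.chain ?T \<C>"
    then have sub: "\<And>J. J \<in> \<C> \<Longrightarrow> ideal J R \<and> x \<in> J \<and> \<one> \<notin> J" unfolding subset.chain_def by blast
    have tot: "J \<subseteq> K \<or> K \<subseteq> J" if "J \<in> \<C>" "K \<in> \<C>" for J K
      using \<C>(2) that unfolding subset.chain_def by auto
    have carr: "a \<in> carrier R" if "J \<in> \<C>" "a \<in> J" for a J
      by (rule ideal.Icarr[OF conjunct1[OF sub[OF that(1)]] that(2)])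
    have "ideal (\<Union>\<C>) R"
    proof (rule idealI)
      show "ring R" by (rule ring_axioms)
      show "subgroup (\<Union>\<C>) (add_monoid R)"
      proof (rule add.subgroupI)
        show "\<Union>\<C> \<subseteq> carrier R" using carr by blast
        obtain J where "J \<in> \<C>" using \<C>(1) by blast
        then have "x \<in> \<Union>\<C>" using sub by blast
        then show "\<Union>\<C> \<noteq> {}" by blast
        fix a assume "a \<in> \<Union>\<C>"
        then obtain J where J: "J \<in> \<C>" "a \<in> J" by blast
        note JI = additive_subgroup.a_closed[OF ideal.axioms(1)[OF conjunct1[OF sub[OF J(1)]]]]
        have "\<ominus> a \<in> J" by (rule additive_subgroup.a_inv_closed[OF ideal.axioms(1)[OF conjunct1[OF sub[OF J(1)]]] J(2)])
        then show "\<ominus> a \<in> \<Union>\<C>" using J(1) by blast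
        fix b assume "b \<in> \<Union>\<C>"
        then obtain K where K: "K \<in> \<C>" "b \<in> K" by blast
        note KI = additive_subgroup.a_closed[OF ideal.axioms(1)[OF conjunct1[OF sub[OF K(1)]]]]
        from tot[OF J(1) K(1)] show "a \<oplus> b \<in> \<Union>\<C>"
        proof
          assume "J \<subseteq> K"
          then have "a \<oplus> b \<in> K" using KI J(2) K(2) by blast
          then show ?thesis using K(1) by blast
        next
          assume "K \<subseteq> J"
          then have "a \<oplus> b \<in> J" using JI J(2) K(2) by blast
          then show ?thesis using J(1) by blast
        qed
      qed
      fix a y assume "a \<in> \<Union>\<C>" and y: "y \<in> carrier R"
      then obtain J where J: "J \<in> \<C>" "a \<in> J" by blast
      have "y \<otimes> a \<in> J" "a \<otimes> y \<in> J"
        using ideal.I_l_closed[OF conjunct1[OF sub[OF J(1)]] J(2) y] ideal.I_r_closed[OF conjunct1[OF sub[OF J(1)]] J(2) y] .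
      then show "y \<otimes> a \<in> \<Union>\<C>" "a \<otimes> y \<in> \<Union>\<C>" using J(1) by blast+
    qed
    then show "\<Union>\<C> \<in> ?T" using sub \<C>(1) by blast
  qed
  then obtain M where M: "ideal M R" "x \<in> M" "\<one> \<notin> M" and max: "\<And>K. ideal K R \<Longrightarrow> x \<in> K \<Longrightarrow> \<one> \<notin> K \<Longrightarrow> M \<subseteq> K \<Longrightarrow> K = M"
    by blast
  have "maximalideal M R"
  proof (rule maximalidealI[OF M(1)])
    show "carrier R \<noteq> M" using M(3) by blast
    fix J assume J: "ideal J R" "M \<subseteq> J" "J \<subseteq> carrier R"
    show "J = M \<or> J = carrier R" using ideal.one_imp_carrier[OF J(1)] max[OF J(1)] M(2) J(2) by blast
  qed
  then show ?thesis using M(2) by blast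
qed

text \<open>The field is the polynomial ring in Y modulo a maximal ideal containing qY - 1. This
  inverts \<open>q\<close>, and every nonzero \<open>b\<close> divides a power of \<open>q\<close>,
  so no nonzero element is killed. The result is a field containing the domain on an explicit
  type.\<close>

lemma (in domain) embeds_in_field:
  assumes q: "q \<in> carrier R" "q \<noteq> \<zero>"
    and div: "\<And>b. b \<in> carrier R \<Longrightarrow> b \<noteq> \<zero> \<Longrightarrow> \<exists>n::nat. b divides (q [^] n)"
  obtains K :: "('a list set) ring" and j where "field K" "j \<in> ring_hom R K" "inj_on j (carrier R)"
proof -
  let ?P = "poly_ring R"
  interpret P: domain ?P by (rule univ_poly_is_domain[OF carrier_is_subring])
  have c: "poly_of_const \<in> ring_hom R ?P" using canonical_embedding_is_hom[OF carrier_is_subring] by simp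
  let ?f = "[q, \<ominus> \<one>]"
  have fP: "?f \<in> carrier ?P" using q by (simp add: univ_poly_carrier[symmetric] polynomial_def)
  have YP: "[\<one>, \<zero>] \<in> carrier ?P" by (simp add: univ_poly_carrier[symmetric] polynomial_def)
  have qP: "[q] \<in> carrier ?P" using q by (simp add: univ_poly_carrier[symmetric] polynomial_def)
  \<comment> \<open>\<open>?f\<close> is qY - 1. Degrees add over a domain, so a polynomial of
    degree 1 has no inverse.\<close>
  have "?f \<notin> Units ?P"
  proof
    assume "?f \<in> Units ?P"
    then obtain g where g: "g \<in> carrier ?P" "?f \<otimes>\<^bsub>?P\<^esub> g = \<one>\<^bsub>?P\<^esub>" using P.Units_r_inv_ex by blast
    have g0: "g \<noteq> []"
    proof
      assume "g = []"
      then have "?f \<otimes>\<^bsub>?P\<^esub> g = \<zero>\<^bsub>?P\<^esub>" using P.r_null[OF fP] by (simp add: univ_poly_zero)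
      then show False using g(2) by simp
    qed
    have "degree (poly_mult ?f g) = degree ?f + degree g"
      using poly_mult_degree_eq[OF carrier_is_subring, of ?f g] g(1) fP g0 by (simp add: univ_poly_carrier)
    then have "degree (\<one>\<^bsub>?P\<^esub>) = degree ?f + degree g" using g(2) by (simp add: univ_poly_mult)
    then show False by (simp add: univ_poly_one)
  qed
  then obtain M where M: "maximalideal M ?P" "?f \<in> M" using P.exists_maximalideal[OF fP] by blast
  interpret M: maximalideal M ?P by (rule M(1))
  have K: "field (?P Quot M)" by (rule M.quotient_is_field[OF P.cring_axioms])
  interpret K: field "?P Quot M" by (rule K)
  let ?j = "\<lambda>b. M +>\<^bsub>?P\<^esub> poly_of_const b"
  have j: "?j \<in> ring_hom R (?P Quot M)" using ring_hom_trans[OF c M.rcos_ring_hom] by (simp add: comp_def)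
  interpret j: ring_hom_ring R "?P Quot M" ?j by (rule ring_hom_ringI2[OF ring_axioms K.ring_axioms j])
  have "?f = [q] \<otimes>\<^bsub>?P\<^esub> [\<one>, \<zero>] \<ominus>\<^bsub>?P\<^esub> \<one>\<^bsub>?P\<^esub>"
  proof -
    have 1: "[q] \<otimes>\<^bsub>?P\<^esub> [\<one>, \<zero>] = [q, \<zero>]" unfolding univ_poly_mult using q by simp
    have 2: "\<ominus>\<^bsub>?P\<^esub> \<one>\<^bsub>?P\<^esub> = [\<ominus> \<one>]"
      using univ_poly_a_inv_def'[OF carrier_is_subring P.one_closed] by (simp add: univ_poly_one)
    show ?thesis unfolding a_minus_def[of ?P] 1 2 univ_poly_add using q by simp
  qed
  then have "M +>\<^bsub>?P\<^esub> ([q] \<otimes>\<^bsub>?P\<^esub> [\<one>, \<zero>]) = M +>\<^bsub>?P\<^esub> \<one>\<^bsub>?P\<^esub>"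
    using P.quotient_eq_iff_same_a_r_cos[OF M.is_ideal P.m_closed[OF qP YP] P.one_closed] M(2) by simp
  moreover have "[q] = poly_of_const q" using q by (simp add: poly_of_const_def)
  ultimately have "?j q \<otimes>\<^bsub>?P Quot M\<^esub> (M +>\<^bsub>?P\<^esub> [\<one>, \<zero>]) = \<one>\<^bsub>?P Quot M\<^esub>"
    using M.FactRing_ops(2)[OF qP YP] M.FactRing_ops(3) by simp
  moreover have Yc: "M +>\<^bsub>?P\<^esub> [\<one>, \<zero>] \<in> carrier (?P Quot M)" using YP M.FactRing_carrier by blast
  ultimately have q0: "?j q \<noteq> \<zero>\<^bsub>?P Quot M\<^esub>" using K.l_null[OF Yc] K.one_not_zero by metis
  have "b = \<zero>" if b: "b \<in> carrier R" "?j b = \<zero>\<^bsub>?P Quot M\<^esub>" for b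
  proof (rule ccontr)
    assume "b \<noteq> \<zero>"
    then obtain n :: nat where "b divides (q [^] n)" using div b(1) by blast
    then obtain e where e: "e \<in> carrier R" "q [^] n = b \<otimes> e" unfolding factor_def by blast
    have "?j q [^]\<^bsub>?P Quot M\<^esub> n = ?j (q [^] n)" using q(1) by (simp only: j.hom_nat_pow)
    also have "\<dots> = ?j b \<otimes>\<^bsub>?P Quot M\<^esub> ?j e" unfolding e(2) by (rule j.hom_mult[OF b(1) e(1)])
    also have "\<dots> = \<zero>\<^bsub>?P Quot M\<^esub>" unfolding b(2) using j.hom_closed[OF e(1)] by simp
    finally show False using K.pow_nonzero[OF j.hom_closed[OF q(1)] q0] by blast
  qed
  then have "a_kernel R (?P Quot M) ?j = {\<zero>}" unfolding a_kernel_def' using j.hom_zero by auto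
  then have "inj_on ?j (carrier R)" by (rule j.trivial_ker_imp_inj)
  then show thesis using that[OF K j] by blast
qed

section \<open>Algebraic closures of fields of fractions\<close>

text \<open>The fractions of elements of \<open>A\<close> already form a subfield. Denominators are
  cleared in the definition of \<open>?Q\<close> to avoid inverses.\<close>

lemma (in field) generate_field_subset_fractions:
  assumes A: "subring A R"
  shows "generate_field R A \<subseteq> {y \<in> carrier R. \<exists>s\<in>A. \<exists>t\<in>A. t \<noteq> \<zero> \<and> y \<otimes> t = s}" (is "_ \<subseteq> ?Q")
proof -
  have AR: "A \<subseteq> carrier R" using subringE(1)[OF A] .
  note cl = subringE(2,3,5,6,7)[OF A]
  have "subfield ?Q R"
  proof (rule subfieldI')
    show "subring ?Q R"
    proof (rule subringI)
      show "?Q \<subseteq> carrier R" by blast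
      show "\<one> \<in> ?Q" using cl(2) one_not_zero by (auto intro!: bexI[of _ \<one>])
    next
      fix y assume "y \<in> ?Q"
      then obtain s t where y: "y \<in> carrier R" "s \<in> A" "t \<in> A" "t \<noteq> \<zero>" "y \<otimes> t = s" by blast
      have "\<ominus> y \<otimes> t = \<ominus> s" using y AR by (auto simp: l_minus)
      then show "\<ominus> y \<in> ?Q" using y cl(3)[OF y(2)] by blast
    next
      fix y y' assume "y \<in> ?Q" "y' \<in> ?Q"
      then obtain s t s' t' where y: "y \<in> carrier R" "s \<in> A" "t \<in> A" "t \<noteq> \<zero>" "y \<otimes> t = s"
        "y' \<in> carrier R" "s' \<in> A" "t' \<in> A" "t' \<noteq> \<zero>" "y' \<otimes> t' = s'" by blast
      have c: "t \<in> carrier R" "t' \<in> carrier R" using y AR by auto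
      have tt: "t \<otimes> t' \<in> A" "t \<otimes> t' \<noteq> \<zero>" using cl(4)[OF y(3,8)] y c integral by auto
      have "(y \<otimes> y') \<otimes> (t \<otimes> t') = (y \<otimes> t) \<otimes> (y' \<otimes> t')" using y(1,6) c by (simp add: m_ac)
      then have "(y \<otimes> y') \<otimes> (t \<otimes> t') = s \<otimes> s'" unfolding y(5,10) .
      then show "y \<otimes> y' \<in> ?Q" using tt cl(4)[OF y(2,7)] y(1,6) by blast
      have "(y \<oplus> y') \<otimes> (t \<otimes> t') = (y \<otimes> t) \<otimes> t' \<oplus> (y' \<otimes> t') \<otimes> t" using y(1,6) c by algebra
      then have "(y \<oplus> y') \<otimes> (t \<otimes> t') = s \<otimes> t' \<oplus> s' \<otimes> t" unfolding y(5,10) .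
      then show "y \<oplus> y' \<in> ?Q" using tt cl(5)[OF cl(4)[OF y(2,8)] cl(4)[OF y(7,3)]] y(1,6) by blast
    qed
  next
    fix y assume "y \<in> ?Q - {\<zero>}"
    then obtain s t where y: "y \<in> carrier R" "s \<in> A" "t \<in> A" "t \<noteq> \<zero>" "y \<otimes> t = s" "y \<noteq> \<zero>" by blast
    have c: "t \<in> carrier R" using y AR by auto
    have yi: "inv y \<in> carrier R" "inv y \<otimes> y = \<one>" using y field_Units by auto
    have "inv y \<otimes> s = (inv y \<otimes> y) \<otimes> t" unfolding y(5)[symmetric] using yi(1) y(1) c by (simp add: m_assoc)
    then have "inv y \<otimes> s = t" unfolding yi(2) using c by simp
    moreover have "s \<noteq> \<zero>" using y c integral by auto
    ultimately show "inv y \<in> ?Q" using yi(1) y(2,3) by blast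
  qed
  moreover have "A \<subseteq> ?Q"
  proof
    fix a assume a: "a \<in> A"
    then have "a \<otimes> \<one> = a" using AR by auto
    then show "a \<in> ?Q" using a cl(2) one_not_zero AR by blast
  qed
  ultimately show ?thesis by (rule generate_field_min_subfield1[OF AR])
qed

text \<open>The coefficients are multiplied by a common denominator \<open>t\<close>. As a result,
  roots can be coded by lists over the subring itself.\<close>

lemma (in field) algebraic_clear_denominators:
  assumes A: "subring A R" and z: "z \<in> carrier R" "(algebraic over (generate_field R A)) z"
  shows "\<exists>l. set l \<subseteq> A \<and> l \<noteq> [] \<and> hd l \<noteq> \<zero> \<and> eval l z = \<zero>"
proof -
  have AR: "A \<subseteq> carrier R" using subringE(1)[OF A] .
  note cl = subringE(2,3,5,6,7)[OF A]
  have F: "subfield (generate_field R A) R" by (rule generate_field_is_subfield[OF AR])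
  obtain p where p: "p \<in> carrier ((generate_field R A)[X])" "p \<noteq> []" "eval p z = \<zero>"
    using algebraicE[OF subfieldE(1)[OF F] z] by blast
  then have sp: "set p \<subseteq> generate_field R A" "hd p \<noteq> \<zero>"
    unfolding univ_poly_carrier[symmetric] polynomial_def by auto
  have clear: "set q \<subseteq> generate_field R A \<Longrightarrow> \<exists>t\<in>A. t \<noteq> \<zero> \<and> (\<forall>a\<in>set q. t \<otimes> a \<in> A)" for q
  proof (induction q)
    case Nil
    show ?case using cl(2) one_not_zero by (auto intro!: bexI[of _ \<one>])
  next
    case (Cons b q)
    then obtain t where t: "t \<in> A" "t \<noteq> \<zero>" "\<And>a. a \<in> set q \<Longrightarrow> t \<otimes> a \<in> A" by auto
    have "b \<in> generate_field R A" using Cons.prems by simp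
    then obtain s u where u: "b \<in> carrier R" "s \<in> A" "u \<in> A" "u \<noteq> \<zero>" "b \<otimes> u = s"
      using generate_field_subset_fractions[OF A] by blast
    have c: "t \<in> carrier R" "u \<in> carrier R" using t u AR by auto
    have "(t \<otimes> u) \<otimes> a \<in> A" if "a \<in> set (b # q)" for a
    proof (cases "a = b")
      case True
      have "(t \<otimes> u) \<otimes> b = t \<otimes> s" unfolding u(5)[symmetric] using c u(1) by (simp add: m_ac)
      then show ?thesis using True cl(4)[OF t(1) u(2)] by simp
    next
      case False
      then have "a \<in> set q" using that by simp
      moreover from this have "a \<in> carrier R" using Cons.prems subfieldE(3)[OF F] by auto
      ultimately show ?thesis using cl(4)[OF u(3) t(3)[of a]] c by (simp add: m_ac)
    qed
    moreover have "t \<otimes> u \<in> A" "t \<otimes> u \<noteq> \<zero>" using cl(4)[OF t(1) u(3)] t u c integral by auto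
    ultimately show ?case by blast
  qed
  obtain t where t: "t \<in> A" "t \<noteq> \<zero>" "\<And>a. a \<in> set p \<Longrightarrow> t \<otimes> a \<in> A" using clear[OF sp(1)] by blast
  have tc: "t \<in> carrier R" using t AR by auto
  have pc: "set p \<subseteq> carrier R" using sp(1) subfieldE(3)[OF F] by blast
  have "set q \<subseteq> carrier R \<Longrightarrow> eval (map ((\<otimes>) t) q) z = t \<otimes> eval q z" for q
    by (induction q) (use tc z(1) in \<open>auto simp: r_distr m_assoc eval_in_carrier\<close>)
  from this[OF pc] have "eval (map ((\<otimes>) t) p) z = \<zero>" using p(3) tc by simp
  moreover have "hd (map ((\<otimes>) t) p) \<noteq> \<zero>"
    using sp(2) p(2) t(2) tc pc integral by (cases p) auto
  moreover have "set (map ((\<otimes>) t) p) \<subseteq> A" using t(3) by auto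
  ultimately show ?thesis using p(2) by (intro exI[of _ "map ((\<otimes>) t) p"]) simp
qed

lemma hom_generate_field:
  assumes K: "field K" and L: "field L" and h: "h \<in> ring_hom K L" and H: "H \<subseteq> carrier K"
  shows "h ` generate_field K H = generate_field L (h ` H)"
proof -
  interpret K: field K by fact
  interpret L: field L by fact
  interpret h: ring_hom_ring K L h by (rule ring_hom_ringI2[OF K.ring_axioms L.ring_axioms h])
  have HL: "h ` H \<subseteq> carrier L" using H by auto
  have sfK: "subfield (generate_field K H) K" by (rule K.generate_field_is_subfield[OF H])
  have sfL: "subfield (generate_field L (h ` H)) L" by (rule L.generate_field_is_subfield[OF HL])
  have "h x \<in> generate_field L (h ` H)" if "x \<in> generate_field K H" for x using that
  proof (induction rule: generate_field.induct)
    case one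
    then show ?case by (simp add: generate_field.one)
  next
    case (incl x)
    then show ?case by (simp add: generate_field.incl)
  next
    case (a_inv x)
    then have "x \<in> carrier K" using K.generate_field_in_carrier[OF H] by blast
    then show ?case using generate_field.a_inv[OF a_inv.IH] by simp
  next
    case (m_inv x)
    have x: "x \<in> carrier K" by (rule K.generate_field_in_carrier[OF H m_inv.hyps(1)])
    then have i: "inv\<^bsub>K\<^esub> x \<in> carrier K" "x \<otimes>\<^bsub>K\<^esub> inv\<^bsub>K\<^esub> x = \<one>\<^bsub>K\<^esub>" using m_inv.hyps(2) K.field_Units by auto
    have 1: "h x \<otimes>\<^bsub>L\<^esub> h (inv\<^bsub>K\<^esub> x) = \<one>\<^bsub>L\<^esub>" using h.hom_mult[OF x i(1)] i(2) by simp
    have hx: "h x \<in> carrier L" "h (inv\<^bsub>K\<^esub> x) \<in> carrier L" using x i by auto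
    have "h x \<noteq> \<zero>\<^bsub>L\<^esub>" using 1 L.l_null[OF hx(2)] L.one_not_zero by metis
    moreover have "inv\<^bsub>L\<^esub> (h x) = h (inv\<^bsub>K\<^esub> x)" by (rule L.comm_inv_char[OF hx 1])
    ultimately show ?case using generate_field.m_inv[OF m_inv.IH] by simp
  next
    case (eng_add x y)
    then have "x \<in> carrier K" "y \<in> carrier K" using K.generate_field_in_carrier[OF H] by blast+
    then show ?case using generate_field.eng_add[OF eng_add.IH] by simp
  next
    case (eng_mult x y)
    then have "x \<in> carrier K" "y \<in> carrier K" using K.generate_field_in_carrier[OF H] by blast+
    then show ?case using generate_field.eng_mult[OF eng_mult.IH] by simp
  qed
  moreover have "generate_field L (h ` H) \<subseteq> h ` generate_field K H"
  proof (rule L.generate_field_min_subfield1[OF HL])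
    show "subfield (h ` generate_field K H) L" by (rule h.img_is_subfield(2)[OF sfK L.one_not_zero])
    show "h ` H \<subseteq> h ` generate_field K H" by (auto intro: generate_field.incl)
  qed
  ultimately show ?thesis by blast
qed

text \<open>Transitivity of algebraicity: the coefficients of a polynomial for \<open>x\<close>
  generate a finite extension of \<open>F\<close>, and adjoining \<open>x\<close> to it is finite
  again.\<close>

lemma algebraic_closure_change_base:
  assumes cl: "algebraic_closure L K" and F: "subfield F L"
    and alg: "\<And>k. k \<in> K \<Longrightarrow> ((ring.algebraic L) over F) k"
  shows "algebraic_closure L F"
proof -
  interpret algebraic_closure L K by fact
  show ?thesis
  proof (intro algebraic_closure.intro algebraic_closure_axioms.intro field_axioms F)
    fix x assume x: "x \<in> carrier L"
    have K: "subfield K L" by (rule subfield_axioms)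
    obtain q where q: "q \<in> carrier (K[X]\<^bsub>L\<^esub>)" "q \<noteq> []" "eval q x = \<zero>\<^bsub>L\<^esub>"
      using algebraicE[OF subfieldE(1)[OF K] x algebraic_extension[OF x]] by blast
    have sq: "set q \<subseteq> K" "hd q \<noteq> \<zero>\<^bsub>L\<^esub>" using q(1,2) unfolding univ_poly_carrier[symmetric] polynomial_def by auto
    have qL: "set q \<subseteq> carrier L" using sq(1) subfieldE(3)[OF K] by blast
    have algq: "\<And>k. k \<in> set q \<Longrightarrow> (algebraic over F) k" using alg sq(1) by blast
    let ?F = "finite_extension F q"
    have F': "subfield ?F L" by (rule finite_extension_is_subfield[OF F qL algq])
    have fd: "finite_dimension F ?F" by (rule finite_extension_finite_dimension(1)[OF F qL algq])
    have "set q \<subseteq> ?F" by (rule finite_extension_mem[OF subfieldE(1)[OF F] qL])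
    then have "q \<in> carrier (?F[X]\<^bsub>L\<^esub>)" using sq(2) unfolding univ_poly_carrier[symmetric] polynomial_def by simp
    then have "(algebraic over ?F) x" using q(2,3) by (rule algebraicI)
    then have fd2: "finite_dimension ?F (simple_extension ?F x)" using finite_dimension_simple_extension[OF F' x] by blast
    have "finite_dimension F (simple_extension ?F x)" by (rule telescopic_base_dim(1)[OF F F' fd fd2])
    then show "(algebraic over F) x"
      by (rule finite_dimension_imp_algebraic[OF F simple_extension_is_subring[OF subfieldE(1)[OF F'] x] _
            simple_extension_mem[OF subfieldE(1)[OF F'] x]])
  next
    fix P assume "P \<in> carrier (F[X]\<^bsub>L\<^esub>)"
    then have "P \<in> carrier (poly_ring L)" using carrier_polynomial_shell[OF subfieldE(1)[OF F]] by blast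
    then show "splitted P" by (rule roots_over_carrier)
  qed
qed

text \<open>Moves a closure to another type. Roots of a polynomial over the copy are found by
  pulling its coefficients back along the inverse \<open>g\<close>.\<close>

lemma alg_closure_of_frac_transport:
  assumes S: "ring S" and L: "alg_closure_of_frac S L h" and f: "inj_on f (carrier L)"
  shows "alg_closure_of_frac S (image_ring f L) (f \<circ> h)"
proof -
  let ?L = "image_ring f L" and ?F = "generate_field L (h ` carrier S)"
  have h: "h \<in> ring_hom S L" "inj_on h (carrier S)" and cl: "algebraic_closure L ?F"
    using L unfolding alg_closure_of_frac_def by auto
  interpret C: algebraic_closure L ?F by (rule cl)
  have L': "field ?L" by (rule C.inj_imp_image_ring_is_field[OF f])
  interpret L': field ?L by (rule L')
  have fi: "f \<in> ring_iso L ?L" by (rule inj_imp_image_ring_iso[OF f])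
  then have fh: "f \<in> ring_hom L ?L" unfolding ring_iso_def by blast
  interpret f: ring_hom_ring L ?L f by (rule ring_hom_ringI2[OF C.ring_axioms L'.ring_axioms fh])
  have cL: "carrier ?L = f ` carrier L" by (rule image_ring_carrier)
  have hS: "h ` carrier S \<subseteq> carrier L" using ring_hom_closed[OF h(1)] by blast
  have gen: "generate_field ?L ((f \<circ> h) ` carrier S) = f ` ?F"
    using hom_generate_field[OF C.field_axioms L' fh hS] by (simp add: image_comp)
  have F: "subfield ?F L" by (rule C.subfield_axioms)
  have sF: "subfield (f ` ?F) ?L" by (rule f.img_is_subfield(2)[OF F L'.one_not_zero])
  define g where "g = inv_into (carrier L) f"
  have g: "g \<in> ring_hom ?L L" using ring_iso_set_sym[OF C.ring_axioms fi] unfolding g_def ring_iso_def by blast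
  have fg: "f (g y) = y" if "y \<in> carrier ?L" for y
    using that unfolding cL g_def by (rule f_inv_into_f)
  have "algebraically_closed ?L"
  proof (rule L'.algebraically_closedI)
    fix q assume q: "q \<in> carrier (poly_ring ?L)" "degree q > 1"
    have gq: "map g q \<in> carrier (poly_ring L)" by (rule polynomial_hom[OF g L' C.field_axioms q(1)])
    have "C.splitted (map g q)" by (rule C.roots_over_carrier[OF gq])
    then have "C.roots (map g q) \<noteq> {#}" using q(2) unfolding C.splitted_def by auto
    then obtain a where a: "a \<in> carrier L" "a \<in># C.roots (map g q)" using C.not_empty_rootsE[OF gq] by metis
    then have "C.eval (map g q) a = \<zero>\<^bsub>L\<^esub>" using C.roots_mem_iff_is_root[OF gq] unfolding C.is_root_def by blast
    moreover have sq: "set q \<subseteq> carrier ?L" using q(1) unfolding univ_poly_carrier[symmetric] polynomial_def by auto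
    moreover have "set (map g q) \<subseteq> carrier L" using sq ring_hom_closed[OF g] by auto
    ultimately have "L'.eval (map f (map g q)) (f a) = \<zero>\<^bsub>?L\<^esub>" using f.eval_hom'[OF a(1), of "map g q"] f.hom_zero by simp
    moreover have "map f (map g q) = q" using sq fg by (simp add: map_idI subset_iff)
    ultimately show "\<exists>x\<in>carrier ?L. L'.eval q x = \<zero>\<^bsub>?L\<^esub>" using f.hom_closed[OF a(1)] by auto
  qed
  then interpret AC: algebraically_closed ?L .
  have "algebraic_closure ?L (f ` ?F)"
  proof (intro algebraic_closure.intro algebraic_closure_axioms.intro L' sF)
    fix y assume "y \<in> carrier ?L"
    then obtain x where x: "x \<in> carrier L" "y = f x" unfolding cL by blast
    show "(L'.algebraic over (f ` ?F)) y" unfolding x(2)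
      by (rule algebraic_hom[OF fh C.field_axioms L' F x(1) C.algebraic_extension[OF x(1)]])
  next
    fix q assume "q \<in> carrier ((f ` ?F)[X]\<^bsub>?L\<^esub>)"
    then have "q \<in> carrier (poly_ring ?L)" using L'.carrier_polynomial_shell[OF subfieldE(1)[OF sF]] by blast
    then show "L'.splitted q" by (rule AC.roots_over_carrier)
  qed
  moreover have "f \<circ> h \<in> ring_hom S ?L" by (rule ring_hom_trans[OF h(1) fh])
  moreover have "inj_on (f \<circ> h) (carrier S)" by (rule comp_inj_on[OF h(2) inj_on_subset[OF f hS]])
  ultimately show ?thesis unfolding alg_closure_of_frac_def gen by blast
qed

text \<open>An element of the closure is determined by a list of elements of \<open>S\<close>, the coefficients of a
  polynomial that it annihilates, and its position among the finitely many roots.\<close>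

lemma alg_closure_of_frac_card:
  fixes S :: "(nat \<Rightarrow> 'a set, 'c) ring_scheme" and L :: "('l, 'd) ring_scheme"
  assumes S: "ring S" and L: "alg_closure_of_frac S L h"
  shows "\<exists>f :: 'l \<Rightarrow> (nat \<Rightarrow> 'a set) \<times> nat. inj_on f (carrier L)"
proof -
  let ?F = "generate_field L (h ` carrier S)"
  have h: "h \<in> ring_hom S L" and cl: "algebraic_closure L ?F"
    using L unfolding alg_closure_of_frac_def by auto
  interpret C: algebraic_closure L ?F by (rule cl)
  interpret S: ring S by (rule S)
  interpret h: ring_hom_ring S L h by (rule ring_hom_ringI2[OF S C.ring_axioms h])
  have A: "subring (h ` carrier S) L" by (rule h.img_is_subring[OF S.carrier_is_subring])
  define Q where "Q l = {z \<in> carrier L. C.eval (map h l) z = \<zero>\<^bsub>L\<^esub>}" for l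
  have "\<exists>l. z \<in> Q l \<and> finite (Q l)" if z: "z \<in> carrier L" for z
  proof -
    from C.algebraic_clear_denominators[OF A z C.algebraic_extension[OF z]]
    obtain k where k: "set k \<subseteq> h ` carrier S" "k \<noteq> []" "hd k \<noteq> \<zero>\<^bsub>L\<^esub>" "C.eval k z = \<zero>\<^bsub>L\<^esub>"
      by (elim exE conjE)
    define l where "l = map (inv_into (carrier S) h) k"
    have "h (inv_into (carrier S) h y) = y" if "y \<in> set k" for y
      by (rule f_inv_into_f[of y h "carrier S"]) (use that k(1) in blast)
    then have "map (h \<circ> inv_into (carrier S) h) k = k" by (intro map_idI) simp
    then have l: "k = map h l" unfolding l_def map_map ..
    have kP: "k \<in> carrier (poly_ring L)"
      using k subringE(1)[OF A] unfolding univ_poly_carrier[symmetric] polynomial_def by blast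
    have "Q l \<subseteq> set_mset (C.roots k)"
      unfolding Q_def l(1)[symmetric] using C.roots_mem_iff_is_root[OF kP] k(2) unfolding C.is_root_def by blast
    then have "finite (Q l)" by (rule finite_subset) simp
    moreover have "z \<in> Q l" unfolding Q_def l(1)[symmetric] using z k(4) by blast
    ultimately show ?thesis by blast
  qed
  then obtain l where l: "\<And>z. z \<in> carrier L \<Longrightarrow> z \<in> Q (l z) \<and> finite (Q (l z))" by metis
  have "\<exists>\<iota> :: 'l \<Rightarrow> nat. finite (Q k) \<longrightarrow> inj_on \<iota> (Q k)" for k
    using finite_imp_inj_to_nat_seg by blast
  then obtain \<iota> :: "(nat \<Rightarrow> 'a set) list \<Rightarrow> 'l \<Rightarrow> nat" where \<iota>: "\<And>k. finite (Q k) \<Longrightarrow> inj_on (\<iota> k) (Q k)" by metis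
  \<comment> \<open>The entries of a list are interleaved into one function by pairing. Places
    beyond the end are filled with \<open>{}\<close>, so the length has to be recorded
    separately.\<close>
  define code where "code k n = (if fst (prod_decode n) < length k then (k ! fst (prod_decode n)) (snd (prod_decode n)) else {})"
    for k :: "(nat \<Rightarrow> 'a set) list" and n
  have code: "k = k'" if "code k = code k'" "length k = length k'" for k k'
  proof (rule nth_equalityI[OF that(2)])
    fix i assume i: "i < length k"
    show "k ! i = k' ! i"
    proof
      fix j
      show "(k ! i) j = (k' ! i) j" using fun_cong[OF that(1), of "prod_encode (i, j)"] i that(2) unfolding code_def by simp
    qed
  qed
  \<comment> \<open>The number holds the length, needed to recover the list, together with the
    position among the roots.\<close>
  let ?f = "\<lambda>z. (code (l z), prod_encode (length (l z), \<iota> (l z) z))"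
  have "inj_on ?f (carrier L)"
  proof (rule inj_onI)
    fix z w assume zw: "z \<in> carrier L" "w \<in> carrier L" "?f z = ?f w"
    then have e: "code (l z) = code (l w)" "length (l z) = length (l w)" "\<iota> (l z) z = \<iota> (l w) w"
      by (auto simp: prod_encode_eq)
    then have lzw: "l z = l w" using code by blast
    have "\<iota> (l z) z = \<iota> (l z) w" using e(3) unfolding lzw .
    then show "z = w" using inj_onD[OF \<iota>[of "l z"]] l[OF zw(1)] l[OF zw(2)] unfolding lzw by blast
  qed
  then show ?thesis by blast
qed

lemma integral_over_hom:
  assumes B: "ring B" and L: "field L" and g: "g \<in> ring_hom B L" and A: "A \<subseteq> carrier B"
    and b: "b \<in> carrier B" "integral_over B A b"
  shows "integral_over L (g ` A) (g b)"
proof -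
  interpret B: ring B by fact
  interpret L: field L by fact
  interpret g: ring_hom_ring B L g by (rule ring_hom_ringI2[OF B L.ring_axioms g])
  obtain l where l: "set l \<subseteq> A" "l \<noteq> []" "hd l = \<one>\<^bsub>B\<^esub>" "B.eval l b = \<zero>\<^bsub>B\<^esub>"
    using b(2) unfolding integral_over_def polynomial_def by auto
  have "L.eval (map g l) (g b) = \<zero>\<^bsub>L\<^esub>" using g.eval_hom'[OF b(1), of l] l(1,4) A by auto
  moreover have "hd (map g l) = \<one>\<^bsub>L\<^esub>" using l(2,3) by (simp add: hd_map)
  moreover have "set (map g l) \<subseteq> g ` A" using l(1) by auto
  ultimately show ?thesis unfolding integral_over_def polynomial_def
    using l(2) L.one_not_zero by (intro exI[of _ "map g l"]) simp
qed

lemma (in field) integral_over_imp_algebraic: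
  assumes "A \<subseteq> K" "integral_over R A b"
  shows "(algebraic over K) b"
proof -
  obtain l where l: "set l \<subseteq> A" "l \<noteq> []" "hd l = \<one>" "eval l b = \<zero>"
    using assms(2) unfolding integral_over_def polynomial_def by auto
  then have "l \<in> carrier (K[X])" using assms(1) one_not_zero unfolding univ_poly_carrier[symmetric] polynomial_def by auto
  then show ?thesis using l(2,4) by (rule algebraicI)
qed

section \<open>Realisation inside a closure of the fraction field of the completion\<close>

context pid_maximal
begin

text \<open>\<open>B\<close> is put into a field, and the subfield generated by it is closed
  algebraically. This is also a closure of the fraction field of the completion, because integral
  elements are algebraic over that field.\<close>

lemma embeds_in_closure:
  fixes B :: "('s, 'c) ring_scheme"
  assumes p0: "p \<noteq> \<zero>" and B: "domain B" and \<psi>: "\<psi> \<in> ring_hom S B" "inj_on \<psi> (carrier S)"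
    and int: "\<And>b. b \<in> carrier B \<Longrightarrow> integral_over B (\<psi> ` carrier S) b"
  obtains L :: "((nat \<Rightarrow> 'a set) \<times> nat) ring" and g
  where "alg_closure_of_frac S L (g \<circ> \<psi>)" "g \<in> ring_hom B L" "inj_on g (carrier B)"
proof -
  interpret B: domain B by fact
  interpret S: domain S by (rule completion_domain)
  interpret C: cdvr B "\<psi> ` carrier S" "\<psi> (incl p)" by (rule cdvr_image[OF B \<psi>])
  interpret \<psi>: ring_hom_ring S B \<psi> by (rule ring_hom_ringI2[OF S.ring_axioms B.ring_axioms \<psi>(1)])
  \<comment> \<open>If \<open>p\<close> vanished in the completion, it would be divisible by its own
    square in \<open>R\<close>, hence a unit.\<close>
  have P0: "\<psi> (incl p) \<noteq> \<zero>\<^bsub>B\<^esub>"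
  proof
    assume "\<psi> (incl p) = \<zero>\<^bsub>B\<^esub>"
    then have "\<psi> (incl p) = \<psi> (incl \<zero>)" using \<psi>.hom_zero unfolding S_zero by simp
    then have "cls (\<lambda>_. p) = cls (\<lambda>_. \<zero>)" using inj_onD[OF \<psi>(2)] incl_closed unfolding incl_def by simp
    then have "\<forall>n::nat. p [^] n divides (p \<ominus> \<zero>)" using cls_eq_iff[of "\<lambda>_. p" "\<lambda>_. \<zero>"] by simp
    then have "p [^] (2::nat) divides (p \<ominus> \<zero>)" by blast
    moreover have "p \<ominus> \<zero> = p" by (simp add: a_minus_def)
    ultimately obtain y where y: "y \<in> carrier R" "p = p [^] (2::nat) \<otimes> y" unfolding factor_def by auto
    then have "p \<otimes> \<one> = p \<otimes> (p \<otimes> y)" by (simp add: numeral_2_eq_2 m_assoc)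
    then have "\<one> = p \<otimes> y" using m_lcancel[OF p0 p_closed, of \<one> "p \<otimes> y"] y(1) by simp
    then show False using p_not_unit y(1) unfolding factor_def by blast
  qed
  have div: "\<exists>n::nat. b divides\<^bsub>B\<^esub> (\<psi> (incl p) [^]\<^bsub>B\<^esub> n)" if b: "b \<in> carrier B" "b \<noteq> \<zero>\<^bsub>B\<^esub>" for b
    using C.integral_divides_pow[OF B.carrier_is_subring C.A_subset b int[OF b(1)]] unfolding factor_def by blast
  obtain K :: "('s list set) ring" and j where K: "field K" "j \<in> ring_hom B K" "inj_on j (carrier B)"
    by (rule B.embeds_in_field[OF C.p_closed P0 div]) 
  interpret K: field K by (rule K(1))
  have jB: "j ` carrier B \<subseteq> carrier K" using ring_hom_closed[OF K(2)] by blast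
  \<comment> \<open>Restricting to the subfield generated by \<open>B\<close> keeps the base of the
    closure algebraic over the fraction field of the completion.\<close>
  let ?G = "generate_field K (j ` carrier B)"
  let ?K = "K\<lparr>carrier := ?G\<rparr>"
  have G: "subfield ?G K" by (rule K.generate_field_is_subfield[OF jB])
  have "field ?K" by (rule K.subfield_iff(2)[OF G])
  then interpret K1: field ?K .
  obtain L :: "((('s list set) list \<times> nat) multiset \<Rightarrow> 's list set) ring"
    where L: "algebraic_closure L (K1.indexed_const ` carrier ?K)" "K1.indexed_const \<in> ring_hom ?K L"
    by (rule K1.exists_closure)
  interpret L: algebraic_closure L "K1.indexed_const ` carrier ?K" by (rule L(1))
  define c :: "'s list set \<Rightarrow> (('s list set) list \<times> nat) multiset \<Rightarrow> 's list set"
    where "c = K1.indexed_const"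
  have c: "c \<in> ring_hom ?K L" unfolding c_def by (rule L(2))
  have jG: "j b \<in> ?G" if "b \<in> carrier B" for b using that by (simp add: generate_field.incl)
  have j1: "j \<in> ring_hom B ?K"
    by (rule ring_hom_memI) (use jG ring_hom_mult[OF K(2)] ring_hom_add[OF K(2)] ring_hom_one[OF K(2)] in auto)
  define g where "g = c \<circ> j"
  have g: "g \<in> ring_hom B L" unfolding g_def by (rule ring_hom_trans[OF j1 c])
  have cinj: "inj_on c (carrier ?K)"
    by (rule non_trivial_field_hom_is_inj[OF c K1.field_axioms L.field_axioms])
  have ginj: "inj_on g (carrier B)"
    unfolding g_def by (rule comp_inj_on[OF K(3) inj_on_subset[OF cinj]]) (use jG in auto)
  let ?A = "(g \<circ> \<psi>) ` carrier S"
  let ?F = "generate_field L ?A"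
  have h: "g \<circ> \<psi> \<in> ring_hom S L" by (rule ring_hom_trans[OF \<psi>(1) g])
  have AL: "?A \<subseteq> carrier L" using ring_hom_closed[OF h] by blast
  have F: "subfield ?F L" by (rule L.generate_field_is_subfield[OF AL])
  have gB: "g ` carrier B \<subseteq> carrier L" using ring_hom_closed[OF g] by blast
  \<comment> \<open>The algebraic elements form a subfield, so algebraicity extends from the image
    of \<open>B\<close> to the field it generates.\<close>
  let ?E = "{x \<in> carrier L. (L.algebraic over ?F) x}"
  have "g ` carrier B \<subseteq> ?E"
  proof
    fix y assume "y \<in> g ` carrier B"
    then obtain b where b: "b \<in> carrier B" "y = g b" by blast
    have "integral_over L (g ` \<psi> ` carrier S) (g b)"
      by (rule integral_over_hom[OF B.ring_axioms L.field_axioms g C.A_subset b(1) int[OF b(1)]])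
    moreover have "g ` \<psi> ` carrier S \<subseteq> ?F" by (auto intro: generate_field.incl)
    ultimately have "(L.algebraic over ?F) (g b)" using L.integral_over_imp_algebraic by blast
    then show "y \<in> ?E" using b gB by blast
  qed
  then have "generate_field L (g ` carrier B) \<subseteq> ?E"
    by (rule L.generate_field_min_subfield1[OF gB L.subfield_of_algebraics[OF F]])
  moreover have "c ` carrier ?K = generate_field L (g ` carrier B)"
  proof -
    have sub: "j ` carrier B \<subseteq> ?G" using jG by blast
    have "carrier ?K = generate_field K (j ` carrier B)" by simp
    also have "\<dots> = generate_field ?K (j ` carrier B)" by (rule K.subfield_gen_equality[OF G sub])
    finally have "c ` carrier ?K = c ` generate_field ?K (j ` carrier B)" by (rule arg_cong)
    also have "\<dots> = generate_field L (c ` j ` carrier B)"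
      by (rule hom_generate_field[OF K1.field_axioms L.field_axioms c]) (use sub in simp)
    finally show ?thesis unfolding g_def by (simp only: image_comp)
  qed
  ultimately have alg: "(L.algebraic over ?F) k" if "k \<in> c ` carrier ?K" for k using that by blast
  have "algebraic_closure L ?F"
    by (rule algebraic_closure_change_base[OF L(1) F alg]) (simp add: c_def)
  moreover have hinj: "inj_on (g \<circ> \<psi>) (carrier S)"
    by (rule comp_inj_on[OF \<psi>(2) inj_on_subset[OF ginj]]) auto
  ultimately have cl: "alg_closure_of_frac S L (g \<circ> \<psi>)" unfolding alg_closure_of_frac_def using h by blast
  \<comment> \<open>So far the closure lives on a type built from that of \<open>B\<close>; the
    injection moves it to the prescribed type.\<close>
  obtain f :: "_ \<Rightarrow> (nat \<Rightarrow> 'a set) \<times> nat" where f: "inj_on f (carrier L)"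
    using alg_closure_of_frac_card[OF S.ring_axioms cl] by blast
  have fh: "f \<in> ring_hom L (image_ring f L)" using inj_imp_image_ring_iso[OF f] unfolding ring_iso_def by blast
  show thesis
  proof (rule that)
    show "alg_closure_of_frac S (image_ring f L) ((f \<circ> g) \<circ> \<psi>)"
      using alg_closure_of_frac_transport[OF S.ring_axioms cl f] by (simp add: comp_assoc)
    show "f \<circ> g \<in> ring_hom B (image_ring f L)" by (rule ring_hom_trans[OF g fh])
    show "inj_on (f \<circ> g) (carrier B)" by (rule comp_inj_on[OF ginj inj_on_subset[OF f gB]])
  qed
qed

lemma complete_generated_iso_adjoin_ring:
  fixes B :: "('s, 'c) ring_scheme"
  assumes p0: "p \<noteq> \<zero>" and B: "domain B" and ad: "adic B x" and x: "x \<notin> Units B"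
    and \<phi>: "\<phi> \<in> ring_hom R B" "inj_on \<phi> (carrier R)"
    and gen: "\<And>b. b \<in> carrier B \<Longrightarrow> \<exists>a\<in>carrier R. \<exists>c\<in>carrier B. b = \<phi> a \<oplus>\<^bsub>B\<^esub> x \<otimes>\<^bsub>B\<^esub> c"
    and k: "x divides\<^bsub>B\<^esub> (\<phi> p [^]\<^bsub>B\<^esub> (k::nat))" and n: "\<phi> p divides\<^bsub>B\<^esub> (x [^]\<^bsub>B\<^esub> (n::nat))"
  shows "\<exists>(L :: ((nat \<Rightarrow> 'a set) \<times> nat) ring) h y. alg_closure_of_frac S L h \<and>
    (\<exists>M. maximalideal M (L\<lparr>carrier := abs_int_closure S L h\<rparr>) \<and> y \<in> M) \<and> B \<simeq> adjoin_ring S L h y"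
proof -
  interpret B: domain B by fact
  interpret x: adic B x by (rule ad)
  interpret S: domain S by (rule completion_domain)
  have Pc: "\<phi> p \<in> carrier B" using ring_hom_closed[OF \<phi>(1)] by simp
  have adP: "adic B (\<phi> p)" by (rule x.change_base[OF Pc n k])
  obtain \<psi> where \<psi>: "\<psi> \<in> ring_hom S B" "\<And>a. a \<in> carrier R \<Longrightarrow> \<psi> (incl a) = \<phi> a"
  proof (rule completion_lift[OF adP \<phi>(1)])
    fix \<psi> assume "\<psi> \<in> ring_hom S B" "\<And>a. a \<in> carrier R \<Longrightarrow> \<psi> (incl a) = \<phi> a"
    then show thesis by (rule that)
  qed
  have inj: "inj_on \<psi> (carrier S)"
    by (rule completion_hom_inj[OF B.ring_axioms \<psi>(1)]) (use \<phi>(2) \<psi>(2) in \<open>simp add: inj_on_def\<close>)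
  let ?A = "\<psi> ` carrier S"
  interpret C: cdvr B ?A "\<psi> (incl p)" by (rule cdvr_image[OF B \<psi>(1) inj])
  interpret \<psi>: ring_hom_ring S B \<psi> by (rule ring_hom_ringI2[OF S.ring_axioms B.ring_axioms \<psi>(1)])
  have Pp: "\<psi> (incl p) = \<phi> p" using \<psi>(2) by simp
  \<comment> \<open>\<open>gen\<close> takes its constants from the image of \<open>R\<close>, which
    is part of \<open>?A\<close>.\<close>
  have span: "carrier B = lin_span B ?A (\<lambda>i. x [^]\<^bsub>B\<^esub> i) n"
  proof (rule C.generated_by_powers)
    show "adic B (\<psi> (incl p))" unfolding Pp by (rule adP)
    show "\<psi> (incl p) divides\<^bsub>B\<^esub> (x [^]\<^bsub>B\<^esub> n)" unfolding Pp by (rule n)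
    fix b assume "b \<in> carrier B"
    then obtain a c where a: "a \<in> carrier R" "c \<in> carrier B" "b = \<phi> a \<oplus>\<^bsub>B\<^esub> x \<otimes>\<^bsub>B\<^esub> c" using gen by blast
    moreover have "\<phi> a \<in> ?A" unfolding \<psi>(2)[OF a(1), symmetric] by (rule imageI[OF incl_closed[OF a(1)]])
    ultimately show "\<exists>a\<in>?A. \<exists>c\<in>carrier B. b = a \<oplus>\<^bsub>B\<^esub> x \<otimes>\<^bsub>B\<^esub> c" by blast
  qed simp
  have int: "integral_over B ?A b" if b: "b \<in> carrier B" for b
  proof (rule C.integral_overI_powers[OF B.nat_pow_closed[OF x.q_closed] b])
    show "b [^]\<^bsub>B\<^esub> j \<in> lin_span B ?A (\<lambda>i. x [^]\<^bsub>B\<^esub> i) n" for j :: nat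
      using B.nat_pow_closed[OF b, of j] unfolding span[symmetric] .
  qed
  obtain L :: "((nat \<Rightarrow> 'a set) \<times> nat) ring" and g
    where L: "alg_closure_of_frac S L (g \<circ> \<psi>)" "g \<in> ring_hom B L" "inj_on g (carrier B)"
    by (rule embeds_in_closure[OF p0 B \<psi>(1) inj int])
  define h where "h = g \<circ> \<psi>"
  have h_eq: "h s = g (\<psi> s)" for s unfolding h_def by simp
  note L1 = L(1)[folded h_def]
  have h: "h \<in> ring_hom S L" "inj_on h (carrier S)" and cl: "algebraic_closure L (generate_field L (h ` carrier S))"
    using L1 unfolding alg_closure_of_frac_def by auto
  interpret L: field L by (rule algebraic_closure.axioms(1)[OF cl])
  interpret g: ring_hom_ring B L g by (rule ring_hom_ringI2[OF B.ring_axioms L.ring_axioms L(2)])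
  interpret D: cdvr L "h ` carrier S" "h (incl p)" by (rule cdvr_image[OF L.domain_axioms h])
  let ?T = "abs_int_closure S L h" and ?y = "g x"
  have T: "subring ?T L" unfolding abs_int_closure_def by (rule D.integral_closure_is_subring)
  have gT: "g b \<in> ?T" if b: "b \<in> carrier B" for b
    using integral_over_hom[OF B.ring_axioms L.field_axioms L(2) C.A_subset b int[OF b]] g.hom_closed[OF b]
    unfolding abs_int_closure_def h_def image_comp by blast
  have TD: "domain (L\<lparr>carrier := ?T\<rparr>)" by (rule L.subring_is_domain[OF T])
  \<comment> \<open>\<open>?y\<close> to the power \<open>n\<close> is a multiple of
    \<open>p\<close>. An integral inverse \<open>z\<close> of \<open>?y\<close> would therefore make
    \<open>z\<close> to the power \<open>n\<close>, times the cofactor, an integral inverse of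
    \<open>p\<close>.\<close>
  have "?y \<notin> Units (L\<lparr>carrier := ?T\<rparr>)"
  proof
    assume "?y \<in> Units (L\<lparr>carrier := ?T\<rparr>)"
    then obtain z where z: "z \<in> ?T" "?y \<otimes>\<^bsub>L\<^esub> z = \<one>\<^bsub>L\<^esub>" unfolding Units_def by auto
    have zL: "z \<in> carrier L" using z(1) unfolding abs_int_closure_def by blast
    obtain w where w: "w \<in> carrier B" "x [^]\<^bsub>B\<^esub> n = \<phi> p \<otimes>\<^bsub>B\<^esub> w" using n unfolding factor_def by blast
    have zn: "z [^]\<^bsub>L\<^esub> n \<in> ?T"
    proof (induction n)
      case 0
      show ?case using subringE(3)[OF T] by simp
    next
      case (Suc n)
      show ?case unfolding L.nat_pow_Suc by (rule subringE(6)[OF T Suc z(1)])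
    qed
    have yL: "?y \<in> carrier L" by (rule g.hom_closed[OF x.q_closed])
    have gw: "g w \<in> carrier L" "g (\<phi> p) \<in> carrier L" by (rule g.hom_closed[OF w(1)], rule g.hom_closed[OF Pc])
    have "\<one>\<^bsub>L\<^esub> = (?y \<otimes>\<^bsub>L\<^esub> z) [^]\<^bsub>L\<^esub> n" unfolding z(2) by simp
    also have "\<dots> = ?y [^]\<^bsub>L\<^esub> n \<otimes>\<^bsub>L\<^esub> z [^]\<^bsub>L\<^esub> n" by (rule L.nat_pow_distrib[OF yL zL])
    also have "?y [^]\<^bsub>L\<^esub> n = g (x [^]\<^bsub>B\<^esub> n)" by (rule g.hom_nat_pow[OF x.q_closed, symmetric])
    also have "\<dots> = g (\<phi> p) \<otimes>\<^bsub>L\<^esub> g w" unfolding w(2) by (rule g.hom_mult[OF Pc w(1)])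
    also have "g (\<phi> p) \<otimes>\<^bsub>L\<^esub> g w \<otimes>\<^bsub>L\<^esub> z [^]\<^bsub>L\<^esub> n = g (\<phi> p) \<otimes>\<^bsub>L\<^esub> (g w \<otimes>\<^bsub>L\<^esub> z [^]\<^bsub>L\<^esub> n)"
      by (rule L.m_assoc[OF gw(2,1) L.nat_pow_closed[OF zL]])
    finally have 1: "h (incl p) \<otimes>\<^bsub>L\<^esub> (g w \<otimes>\<^bsub>L\<^esub> z [^]\<^bsub>L\<^esub> n) = \<one>\<^bsub>L\<^esub>" unfolding h_eq Pp by simp
    have "g w \<otimes>\<^bsub>L\<^esub> z [^]\<^bsub>L\<^esub> n \<in> ?T" by (rule subringE(6)[OF T gT[OF w(1)] zn])
    then show False using D.p_not_unit_over_integral[of "g w \<otimes>\<^bsub>L\<^esub> z [^]\<^bsub>L\<^esub> n"] 1 unfolding abs_int_closure_def by blast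
  qed
  then have M: "\<exists>M. maximalideal M (L\<lparr>carrier := ?T\<rparr>) \<and> ?y \<in> M"
    using cring.exists_maximalideal[OF domain.axioms(1)[OF TD], of ?y] gT[OF x.q_closed] by simp
  have AL: "h ` carrier S \<union> {?y} \<subseteq> carrier L" using D.A_subset g.hom_closed[OF x.q_closed] by blast
  let ?G = "generate_ring L (h ` carrier S \<union> {?y})"
  have G: "subring ?G L" by (rule L.generate_ring_is_subring[OF AL])
  have "g ` carrier B = ?G"
  proof
    have yi: "?y [^]\<^bsub>L\<^esub> i \<in> ?G" for i :: nat
    proof (induction i)
      case 0
      show ?case using subringE(3)[OF G] by simp
    next
      case (Suc i)
      show ?case unfolding L.nat_pow_Suc by (rule subringE(6)[OF G Suc]) (simp add: generate_ring.incl)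
    qed
    have "lin_span B ?A (\<lambda>i. x [^]\<^bsub>B\<^esub> i) n \<subseteq> {b \<in> carrier B. g b \<in> ?G}"
    proof (rule C.lin_span_subsetI)
      show "\<zero>\<^bsub>B\<^esub> \<in> {b \<in> carrier B. g b \<in> ?G}" using subringE(2)[OF G] by simp
      show "u \<oplus>\<^bsub>B\<^esub> v \<in> {b \<in> carrier B. g b \<in> ?G}" if "u \<in> {b \<in> carrier B. g b \<in> ?G}" "v \<in> {b \<in> carrier B. g b \<in> ?G}" for u v
        using that subringE(7)[OF G] by simp
      fix i :: nat and a assume "a \<in> ?A"
      then obtain s where s: "s \<in> carrier S" "a = \<psi> s" by blast
      have ac: "a \<in> carrier B" using s by simp
      have "g a \<in> ?G" unfolding s(2) h_eq[symmetric] using s(1) by (intro generate_ring.incl) blast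
      then have "g a \<otimes>\<^bsub>L\<^esub> ?y [^]\<^bsub>L\<^esub> i \<in> ?G" using yi by (rule subringE(6)[OF G])
      moreover have "g (a \<otimes>\<^bsub>B\<^esub> x [^]\<^bsub>B\<^esub> i) = g a \<otimes>\<^bsub>L\<^esub> ?y [^]\<^bsub>L\<^esub> i"
        using g.hom_mult[OF ac B.nat_pow_closed[OF x.q_closed]] g.hom_nat_pow[OF x.q_closed] by simp
      ultimately show "a \<otimes>\<^bsub>B\<^esub> x [^]\<^bsub>B\<^esub> i \<in> {b \<in> carrier B. g b \<in> ?G}" using ac by simp
    qed
    then show "g ` carrier B \<subseteq> ?G" unfolding span[symmetric] by blast
    show "?G \<subseteq> g ` carrier B"
      by (rule L.generate_ring_min_subring1[OF AL g.img_is_subring[OF B.carrier_is_subring]])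
        (use \<psi>.hom_closed x.q_closed h_eq in auto)
  qed
  then have "g \<in> ring_iso B (adjoin_ring S L h ?y)"
    using L(3) ring_hom_mult[OF L(2)] ring_hom_add[OF L(2)] ring_hom_one[OF L(2)]
    unfolding adjoin_ring_def ring_iso_def ring_hom_def bij_betw_def by auto
  then have "B \<simeq> adjoin_ring S L h ?y" unfolding is_ring_iso_def by blast
  then show ?thesis using L1 M by blast
qed

end

theorem theorem1p2:
  fixes R :: "('a, 'b) ring_scheme" and D :: "('d, 'e) ring_scheme"
  assumes "principal_domain R" and "domain D"
  shows "(\<exists>I. ideal I (fps_ring R) \<and> D \<simeq> (fps_ring R Quot I)) \<longleftrightarrow>
         (D \<simeq> fps_ring R \<or> D \<simeq> R \<or>
          (\<exists>m. maximalideal m R \<and>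
             (D \<simeq> fps_ring (R Quot m) \<or> D \<simeq> (R Quot m) \<or>
              (\<exists>(L :: ((nat \<Rightarrow> 'a set) \<times> nat) ring) h \<alpha>.
                 alg_closure_of_frac (adic_completion R m) L h \<and>
                 (\<exists>M. maximalideal M (L\<lparr>carrier := abs_int_closure (adic_completion R m) L h\<rparr>) \<and> \<alpha> \<in> M) \<and>
                 D \<simeq> adjoin_ring (adic_completion R m) L h \<alpha>))))"
    (is "?lhs \<longleftrightarrow> ?rhs")
proof
  interpret R: principal_domain R by fact
  assume ?lhs
  then obtain I where I: "ideal I (fps_ring R)" "D \<simeq> (fps_ring R Quot I)" by blast
  interpret F: cring "fps_ring R" by (rule R.fps_cring)
  have Q: "ring (fps_ring R Quot I)" by (rule ideal.quotient_is_ring[OF I(1)])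
  have dom: "domain (fps_ring R Quot I)" by (rule domain_of_iso[OF assms(2) I(2) Q])
  have prime: "primeideal I (fps_ring R)" by (rule F.quot_domain_imp_primeideal[OF I(1) dom])
  interpret P: fps_prime_quotient R I by (intro fps_prime_quotient.intro assms(1) prime)
  show ?rhs
  proof (cases "fps_var R \<in> I")
    case True
    have J: "ideal P.J R" using P.J_prime by (rule primeideal.axioms(1))
    have "fps_ring R Quot I \<simeq> R Quot P.J"
      by (rule ring_iso_sym[OF ideal.quotient_is_ring[OF J] P.quotient_if_var_mem[OF True]])
    then have DJ: "D \<simeq> R Quot P.J" by (rule ring_iso_trans[OF I(2)])
    show ?thesis
    proof (cases "P.J = {\<zero>\<^bsub>R\<^esub>}")
      case True
      then have "D \<simeq> R" using ring_iso_trans[OF DJ] R.FactRing_zeroideal(1) by simp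
      then show ?thesis by blast
    next
      case False
      then have "maximalideal P.J R" using R.nonzero_prime_maximal[OF P.J_prime] by blast
      then show ?thesis using DJ by blast
    qed
  next
    case X: False
    show ?thesis
    proof (cases "P.J = {\<zero>\<^bsub>R\<^esub>}")
      case False
      then show ?thesis
        using P.quotient_if_constant_mem[OF X False] ring_iso_trans[OF I(2)] by blast
    next
      case J: True
      show ?thesis
      proof (cases "I = {\<zero>\<^bsub>fps_ring R\<^esub>}")
        case True
        then have "D \<simeq> fps_ring R" using ring_iso_trans[OF I(2)] F.FactRing_zeroideal(1) by simp
        then show ?thesis by blast
      next
        case False
        obtain p k n where *: "p \<in> carrier R" "p \<noteq> \<zero>\<^bsub>R\<^esub>" "maximalideal (PIdl\<^bsub>R\<^esub> p) R" "adic P.B P.\<xi>"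
          "P.\<xi> divides\<^bsub>P.B\<^esub> (P.\<phi> p [^]\<^bsub>P.B\<^esub> (k::nat))" "P.\<phi> p divides\<^bsub>P.B\<^esub> (P.\<xi> [^]\<^bsub>P.B\<^esub> (n::nat))"
          "inj_on P.\<phi> (carrier R)"
          by (rule P.generic_quotient[OF X J False])
        interpret pm: pid_maximal R p
          by (intro pid_maximal.intro pid_maximal_axioms.intro assms(1) *(1,3))
        obtain L :: "((nat \<Rightarrow> 'a set) \<times> nat) ring" and h y where
          L: "alg_closure_of_frac pm.S L h"
            "\<exists>M. maximalideal M (L\<lparr>carrier := abs_int_closure pm.S L h\<rparr>) \<and> y \<in> M"
            "P.B \<simeq> adjoin_ring pm.S L h y"
          using pm.complete_generated_iso_adjoin_ring[OF *(2) dom *(4) P.x_nonunit P.\<phi>_hom *(7) P.B_decompose *(5,6)]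
          by blast
        have "D \<simeq> adjoin_ring pm.S L h y" by (rule ring_iso_trans[OF I(2) L(3)])
        then show ?thesis using L(1,2) *(3) by blast
      qed
    qed
  qed
next
  interpret R: principal_domain R by fact
  assume ?rhs
  then consider "D \<simeq> fps_ring R" | "D \<simeq> R"
    | m where "maximalideal m R" "D \<simeq> fps_ring (R Quot m)" | m where "maximalideal m R" "D \<simeq> (R Quot m)"
    | m and L :: "((nat \<Rightarrow> 'a set) \<times> nat) ring" and h y M where "maximalideal m R"
      "alg_closure_of_frac (adic_completion R m) L h"
      "maximalideal M (L\<lparr>carrier := abs_int_closure (adic_completion R m) L h\<rparr>)" "y \<in> M"
      "D \<simeq> adjoin_ring (adic_completion R m) L h y"
    by blast
  then show ?lhs
  proof cases
    case 1
    then show ?thesis by (rule R.quotient_trivial)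
  next
    case 2
    then show ?thesis by (rule R.quotient_constant_coeff)
  next
    case 3
    then show ?thesis using R.quotient_fps_mod(1) maximalideal.axioms(1) by blast
  next
    case 4
    then show ?thesis using R.quotient_fps_mod(2) maximalideal.axioms(1) by blast
  next
    case (5 m L h y M)
    obtain p where p: "p \<in> carrier R" "m = PIdl\<^bsub>R\<^esub> p"
      using R.exists_gen[OF maximalideal.axioms(1)[OF 5(1)]] by blast
    interpret pm: pid_maximal R p
      by (intro pid_maximal.intro pid_maximal_axioms.intro assms(1) p(1)) (use 5(1) p(2) in simp)
    show ?thesis by (rule pm.adjoin_ring_is_quotient) (use 5 p(2) in auto)
  qed
qed

end
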